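(* Let $d\ge1$, $r>d/2$, $0\le q<s$ and $s>d/2+r$, and assume that the sampling measures satisfy $\|\nu_m\|_{H^{-r}}\le C_1\delta_m^{r}$ for all $m$, with $C_1$ independent of $m$. Then there is a constant $C>0$, independent of $m$, $n$ and $f$, such that for all $m$, $n\ge1$ and $f\in H^s(\mathbb S^d)$ the hyperinterpolation operator $\mathcal L_n$ satisfies $$\|f-\mathcal L_nf\|_{H^q}\le C\left(n^{-(s-q)}+\delta_m^{r}n^{r+q}\right)\|f\|_{H^s}.$$ Moreover, if $n=n(m)\ge1$ is chosen so that $c_1\delta_m^{-r/(s+r)}\le n\le c_2\delta_m^{-r/(s+r)}$ with constants $c_1,c_2>0$ independent of $m$, then, with $C'$ independent of $m$ and $f$, $$\|f-\mathcal L_nf\|_{H^q}\le C'\,\delta_m^{\frac{r(s-q)}{s+r}}\|f\|_{H^s}.$$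
   Context: $\mathbb S^d=\{x\in\mathbb R^{d+1}:|x|=1\}$ carries the normalized surface measure $\sigma$ ($\sigma(\mathbb S^d)=1$) and the geodesic distance $\rho(x,y)=\arccos(x\cdot y)$. For each $\ell\ge0$, $\{Y_{\ell,k}:1\le k\le Z(d,\ell)\}$ is an $L^2(\mathbb S^d,\sigma)$-orthonormal basis of the (real) spherical harmonics of degree $\ell$; $\lambda_\ell=\ell(\ell+d-1)$ is the corresponding eigenvalue of $-\Delta_{\mathbb S^d}$. For a distribution $u$ put $\widehat u_{\ell,k}=\langle u,Y_{\ell,k}\rangle$. For $s\in\mathbb R$, $H^s(\mathbb S^d)$ is the space of distributions with $\|u\|_{H^s}^2=\sum_{\ell\ge0}(1+\lambda_\ell)^s\sum_k|\widehat u_{\ell,k}|^2<\infty$; for $s>d/2$ its elements are identified with their continuous representatives. Sampling: for each $m$ (in an infinite set of positive integers) there are a point set $\mathcal X_m=\{x_j\}_{j=1}^m\subset\mathbb S^d$ and weights $w_j>0$ with $\sum_{j=1}^mw_j=1$ (points and weights may depend on $m$). The mesh norm is $\delta_m=\sup_{x\in\mathbb S^d}\min_{1\le j\le m}\rho(x,x_j)$. Set $\nu_m=\sum_{j=1}^mw_j\delta_{x_j}-\sigma$, where $\delta_{x_j}$ is the Dirac mass at $x_j$. The hyperinterpolation operator is $\mathcal L_nf(x)=\sum_{j=1}^mw_jf(x_j)G_n(x,x_j)$ with $G_n(x,y)=\sum_{\ell=0}^n\sum_{k=1}^{Z(d,\ell)}Y_{\ell,k}(x)Y_{\ell,k}(y)$;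 it depends on $m$ as well as $n$. *)

theory Defs
  imports "HOL-Analysis.Analysis"
begin

text \<open>
  Throughout, \<open>'a\<close> is the ambient Euclidean space $R^{d+1}$, so $d$ is \<open>DIM('a) - 1\<close>, and
  the unit sphere is \<open>sphere 0 1\<close>.  Functions on the sphere are represented by total functions
  on \<open>'a\<close>, whose values off the sphere play no role.
\<close>

text \<open>
  The normalized surface measure, in polar coordinates: the mass of a Borel subset $A$ of the
  sphere is the relative volume in the unit ball of the cone over $A$.  The centre of the ball,
  which is not mapped to the sphere, is a null set.
\<close>

definition sphere_measure :: "'a::euclidean_space measure" where
  "sphere_measure =
     restrict_space (distr (uniform_measure lborel (ball 0 1)) borel (\<lambda>x. x /\<^sub>R norm x)) (sphere 0 1)"

definition geodesic_dist :: "'a::euclidean_space \<Rightarrow> 'a \<Rightarrow> real" where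
  "geodesic_dist x y = arccos (x \<bullet> y)"

fun iter_partial :: "'a::euclidean_space list \<Rightarrow> ('a \<Rightarrow> real) \<Rightarrow> 'a \<Rightarrow> real" where
  "iter_partial [] f = f"
| "iter_partial (b # bs) f = (\<lambda>x. frechet_derivative (iter_partial bs f) (at x) b)"

definition laplacian :: "('a::euclidean_space \<Rightarrow> real) \<Rightarrow> 'a \<Rightarrow> real" where
  "laplacian f x = (\<Sum>b\<in>Basis. iter_partial [b, b] f x)"

text \<open>Spherical harmonics of degree \<open>l\<close> (including zero).\<close>

definition spherical_harmonics :: "nat \<Rightarrow> ('a::euclidean_space \<Rightarrow> real) set" where
  "spherical_harmonics l =
     {f. \<exists>p. real_polynomial_function p \<and> (\<forall>c x. p (c *\<^sub>R x) = c ^ l * p x) \<and>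
             (\<forall>x. laplacian p x = 0) \<and> (\<forall>x\<in>sphere 0 1. f x = p x)}"

text \<open>
  \<open>Y l k\<close> with \<open>1 \<le> k \<le> Z l\<close> is, for every \<open>l\<close>, an orthonormal basis of the spherical harmonics
  of degree \<open>l\<close>; in particular \<open>Z l\<close> is forced to be the dimension of that space.
\<close>

definition sph_harm_onb :: "(nat \<Rightarrow> nat) \<Rightarrow> (nat \<Rightarrow> nat \<Rightarrow> 'a::euclidean_space \<Rightarrow> real) \<Rightarrow> bool" where
  "sph_harm_onb Z Y \<longleftrightarrow>
     (\<forall>l. (\<forall>k\<in>{1..Z l}. Y l k \<in> spherical_harmonics l) \<and>
          (\<forall>i\<in>{1..Z l}. \<forall>k\<in>{1..Z l}.
             (\<integral>x. Y l i x * Y l k x \<partial>sphere_measure) = (if i = k then 1 else 0)) \<and>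
          (\<forall>f\<in>spherical_harmonics l. \<exists>c. \<forall>x\<in>sphere 0 1. f x = (\<Sum>k = 1..Z l. c k * Y l k x)))"

text \<open>
  A function on the sphere is smooth if its extension to the punctured space that is constant
  along rays is smooth; the derivatives of that extension also give the $C^N$ norms.
\<close>

definition radial_ext :: "('a::euclidean_space \<Rightarrow> real) \<Rightarrow> 'a \<Rightarrow> real" where
  "radial_ext f x = f (x /\<^sub>R norm x)"

definition sphere_smooth :: "('a::euclidean_space \<Rightarrow> real) set" where
  "sphere_smooth =
     {f. \<forall>bs\<in>lists Basis. \<forall>x\<in>- {0}. iter_partial bs (radial_ext f) differentiable at x}"

definition sphere_CN_norm :: "nat \<Rightarrow> ('a::euclidean_space \<Rightarrow> real) \<Rightarrow> real" where
  "sphere_CN_norm N f =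
     (SUP (bs, x)\<in>{bs \<in> lists Basis. length bs \<le> N} \<times> sphere 0 1.
        \<bar>iter_partial bs (radial_ext f) x\<bar>)"

text \<open>
  Distributions are the continuous linear functionals on the smooth functions.  Only their values
  on smooth functions are relevant.
\<close>

definition sphere_distribution :: "(('a::euclidean_space \<Rightarrow> real) \<Rightarrow> real) \<Rightarrow> bool" where
  "sphere_distribution u \<longleftrightarrow>
     (\<forall>f\<in>sphere_smooth. \<forall>g\<in>sphere_smooth. u (\<lambda>x. f x + g x) = u f + u g) \<and>
     (\<forall>f\<in>sphere_smooth. \<forall>c. u (\<lambda>x. c * f x) = c * u f) \<and>
     (\<exists>C N. \<forall>f\<in>sphere_smooth. \<bar>u f\<bar> \<le> C * sphere_CN_norm N f)"

definition fun_distribution ::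
    "('a::euclidean_space \<Rightarrow> real) \<Rightarrow> ('a \<Rightarrow> real) \<Rightarrow> real" where
  "fun_distribution f = (\<lambda>\<phi>. \<integral>x. f x * \<phi> x \<partial>sphere_measure)"

text \<open>The eigenvalue $l(l+d-1)$ of the negative Laplace-Beltrami operator on the $d$-sphere.\<close>

definition sphere_eigenvalue :: "nat \<Rightarrow> nat \<Rightarrow> real" where
  "sphere_eigenvalue d l = real l * (real l + real d - 1)"

definition sobolev_norm_sq ::
    "(nat \<Rightarrow> nat) \<Rightarrow> (nat \<Rightarrow> nat \<Rightarrow> 'a::euclidean_space \<Rightarrow> real) \<Rightarrow> real \<Rightarrow>
     (('a \<Rightarrow> real) \<Rightarrow> real) \<Rightarrow> ennreal" where
  "sobolev_norm_sq Z Y s u =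
     (\<Sum>l. ennreal ((1 + sphere_eigenvalue (DIM('a) - 1) l) powr s *
                   (\<Sum>k = 1..Z l. \<bar>u (Y l k)\<bar>\<^sup>2)))"

text \<open>The norm takes the value \<open>\<infinity>\<close> exactly when the series diverges.\<close>

definition sobolev_norm ::
    "(nat \<Rightarrow> nat) \<Rightarrow> (nat \<Rightarrow> nat \<Rightarrow> 'a::euclidean_space \<Rightarrow> real) \<Rightarrow> real \<Rightarrow>
     (('a \<Rightarrow> real) \<Rightarrow> real) \<Rightarrow> ennreal" where
  "sobolev_norm Z Y s u =
     (if sobolev_norm_sq Z Y s u = \<infinity> then \<infinity>
      else ennreal (sqrt (enn2real (sobolev_norm_sq Z Y s u))))"

definition sobolev_space ::
    "(nat \<Rightarrow> nat) \<Rightarrow> (nat \<Rightarrow> nat \<Rightarrow> 'a::euclidean_space \<Rightarrow> real) \<Rightarrow> real \<Rightarrow>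
     (('a \<Rightarrow> real) \<Rightarrow> real) set" where
  "sobolev_space Z Y s = {u. sphere_distribution u \<and> sobolev_norm Z Y s u < \<infinity>}"

text \<open>The continuous representatives of the elements of the Sobolev space (for \<open>s > d/2\<close>).\<close>

definition sobolev_functions ::
    "(nat \<Rightarrow> nat) \<Rightarrow> (nat \<Rightarrow> nat \<Rightarrow> 'a::euclidean_space \<Rightarrow> real) \<Rightarrow> real \<Rightarrow> ('a \<Rightarrow> real) set" where
  "sobolev_functions Z Y s =
     {f. continuous_on (sphere 0 1) f \<and> fun_distribution f \<in> sobolev_space Z Y s}"

definition mesh_norm :: "nat \<Rightarrow> (nat \<Rightarrow> 'a::euclidean_space) \<Rightarrow> real" where
  "mesh_norm m X = (SUP x\<in>sphere 0 1. Min ((\<lambda>j. geodesic_dist x (X j)) ` {1..m}))"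

text \<open>The signed measure $\sum_j w_j \delta_{x_j} - \sigma$ as a distribution.\<close>

definition sampling_error ::
    "nat \<Rightarrow> (nat \<Rightarrow> 'a::euclidean_space) \<Rightarrow> (nat \<Rightarrow> real) \<Rightarrow> ('a \<Rightarrow> real) \<Rightarrow> real" where
  "sampling_error m X w = (\<lambda>\<phi>. (\<Sum>j = 1..m. w j * \<phi> (X j)) - (\<integral>x. \<phi> x \<partial>sphere_measure))"

definition reproducing_kernel ::
    "(nat \<Rightarrow> nat) \<Rightarrow> (nat \<Rightarrow> nat \<Rightarrow> 'a::euclidean_space \<Rightarrow> real) \<Rightarrow> nat \<Rightarrow> 'a \<Rightarrow> 'a \<Rightarrow> real" where
  "reproducing_kernel Z Y n x y = (\<Sum>l = 0..n. \<Sum>k = 1..Z l. Y l k x * Y l k y)"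

definition hyperinterpolation ::
    "(nat \<Rightarrow> nat) \<Rightarrow> (nat \<Rightarrow> nat \<Rightarrow> 'a::euclidean_space \<Rightarrow> real) \<Rightarrow>
     nat \<Rightarrow> (nat \<Rightarrow> 'a) \<Rightarrow> (nat \<Rightarrow> real) \<Rightarrow> nat \<Rightarrow> ('a \<Rightarrow> real) \<Rightarrow> 'a \<Rightarrow> real" where
  "hyperinterpolation Z Y m X w n f x =
     (\<Sum>j = 1..m. w j * f (X j) * reproducing_kernel Z Y n x (X j))"

end

theory Submission
  imports Defs
begin

text \<open>
  The degree-$l$ coefficients of $f - L_n f$ are those of $f$ for $l > n$, which gives the
  truncation term, and $-\nu_m(f Y_{l,k})$ for $l \le n$.  By duality the latter are controlled by
  $|\nu_m(f p)|$ for polynomials $p$ of degree at most $n$.  Expand $f = \sum_l f_l$ into spherical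
  harmonics.  The product $f_l p$ is a spherical polynomial of degree at most $l + n$, so
  $|\nu_m(f_l p)| \le \|\nu_m\|_{H^{-r}} (1 + \lambda_{l+n})^{r/2} \|f_l\|_\infty \|p\|_2$, and
  $\|f_l\|_\infty \le Z_l^{1/2} \|f_l\|_2$ by the addition theorem.  The sum over $l$ converges
  because $\sum_{l \le N} Z_l = O(N^d)$ and $s > d/2 + r$.

  The facts on spherical harmonics rest on one identity for a homogeneous polynomial $g$ of degree
  $k$ on $R^D$, namely $\int \partial_b g \, d\sigma = (D + k - 1) \int x_b g \, d\sigma$: it makes
  $\int p q \, d\sigma$ times the degree of a harmonic $p$ symmetric in $p$ and $q$, whence the
  orthogonality of different degrees, and it makes the rotation fields
  $x_a \partial_b - x_b \partial_a$ antisymmetric, whence the addition theorem.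
\<close>

section \<open>Homogeneous polynomials\<close>

text \<open>The surface measure is given by cones, so nothing is integrated on the sphere directly.
  The integral of a homogeneous polynomial over the ball is its sphere integral times a constant
  depending on the degree. The basic identity is an integration by parts in the ball against a
  cutoff vanishing at the boundary, rewritten with these constants.

  The obstacle in the error estimate is that the sampling error acts on a product f p of which only
  p has bounded degree. After the expansion of f, the inequality 1 + l + n \<le> (1 + l)(1 + n)
  separates the two degrees. The factor in n becomes the n^r of the theorem, and the factor in l
  costs f another r derivatives, on top of the d/2 that pay for the supremum norms of its
  components. The n^q comes from measuring a polynomial of degree n in H^q.

  The dimension count controls only cumulative sums of Z_l, so convergence in l is obtained by
  partial summation. The prescribed size of n makes n^-(s-q) and \<delta>^r n^(r+q) comparable:
  equality means n^(s+r) = \<delta>^-r.\<close>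

definition partial :: "'a::euclidean_space \<Rightarrow> ('a \<Rightarrow> real) \<Rightarrow> 'a \<Rightarrow> real" where
  "partial b p x = frechet_derivative p (at x) b"

text \<open>The scaling law is required for every real c. At c = 0, where \<open>0 ^ 0 = 1\<close>,
  it makes degree 0 consist of the constants. The zero function belongs to every degree.\<close>

definition hom_polys :: "nat \<Rightarrow> ('a::euclidean_space \<Rightarrow> real) set" where
  "hom_polys k = {p. real_polynomial_function p \<and> (\<forall>c x. p (c *\<^sub>R x) = c ^ k * p x)}"

lemma poly_differentiable:
  fixes p :: "'a::euclidean_space \<Rightarrow> real"
  assumes "real_polynomial_function p"
  shows "p differentiable (at x)"
  using assms by (simp add: differentiable_at_real_polynomial_function)

lemma poly_has_derivative:
  fixes p :: "'a::euclidean_space \<Rightarrow> real"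
  assumes "real_polynomial_function p"
  shows "(p has_derivative (\<lambda>h. partial h p x)) (at x)"
  using poly_differentiable[OF assms, of x] unfolding partial_def
  by (metis (no_types, lifting) ext frechet_derivative_works)

lemma partial_eqI:
  "(p has_derivative D) (at x) \<Longrightarrow> partial b p x = D b"
  unfolding partial_def using frechet_derivative_at by metis

lemma partial_linear: "bounded_linear f \<Longrightarrow> partial b f = (\<lambda>x. f b)"
  by (rule ext, rule partial_eqI, rule bounded_linear_imp_has_derivative)

lemma partial_const [simp]: "partial b (\<lambda>x. c) = (\<lambda>x. 0)"
  by (rule ext, rule partial_eqI[where D = "\<lambda>_. 0", simplified]) simp

lemma partial_inner [simp]: "partial b (\<lambda>x. x \<bullet> a) = (\<lambda>x. b \<bullet> a)"
  by (rule partial_linear) (rule bounded_linear_inner_left)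

lemma partial_add:
  assumes "real_polynomial_function f" "real_polynomial_function g"
  shows "partial b (\<lambda>x. f x + g x) = (\<lambda>x. partial b f x + partial b g x)"
  by (rule ext, rule partial_eqI[OF has_derivative_add[OF poly_has_derivative poly_has_derivative]])
     (use assms in auto)

lemma partial_diff:
  assumes "real_polynomial_function f" "real_polynomial_function g"
  shows "partial b (\<lambda>x. f x - g x) = (\<lambda>x. partial b f x - partial b g x)"
  by (rule ext, rule partial_eqI[OF has_derivative_diff[OF poly_has_derivative poly_has_derivative]])
     (use assms in auto)

lemma partial_mult:
  assumes "real_polynomial_function f" "real_polynomial_function g"
  shows "partial b (\<lambda>x. f x * g x) = (\<lambda>x. f x * partial b g x + partial b f x * g x)"
  by (rule ext, rule partial_eqI[OF has_derivative_mult[OF poly_has_derivative poly_has_derivative]])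
     (use assms in auto)

lemma partial_cmult:
  assumes "real_polynomial_function f"
  shows "partial b (\<lambda>x. c * f x) = (\<lambda>x. c * partial b f x)"
  using partial_mult[OF real_polynomial_function.intros(2) assms, of b c] by simp

lemma partial_sum:
  assumes "finite I" "\<And>i. i \<in> I \<Longrightarrow> real_polynomial_function (f i)"
  shows "partial b (\<lambda>x. \<Sum>i\<in>I. f i x) = (\<lambda>x. \<Sum>i\<in>I. partial b (f i) x)"
  by (rule ext, rule partial_eqI[OF has_derivative_sum[OF poly_has_derivative]])
     (use assms in auto)

lemma poly_partial [intro]:
  assumes "real_polynomial_function p"
  shows "real_polynomial_function (partial b p)"
  using assms
  by induction (auto simp: partial_linear partial_add partial_mult)

lemma poly_inner [intro]: "real_polynomial_function (\<lambda>x::'a::euclidean_space. x \<bullet> a)"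
  by (rule real_polynomial_function.intros(1)) (rule bounded_linear_inner_left)

lemma poly_inner_self [intro]: "real_polynomial_function (\<lambda>x::'a::euclidean_space. x \<bullet> x)"
  by (subst euclidean_inner) (intro real_polynomial_function_sum finite_Basis real_polynomial_function.intros(4) poly_inner)

lemma poly_cmult [intro]:
  "real_polynomial_function f \<Longrightarrow> real_polynomial_function (\<lambda>x. c * f x)"
  by (rule real_polynomial_function.intros(4)[OF real_polynomial_function.intros(2)])

lemma partial_commute:
  assumes "real_polynomial_function p"
  shows "partial a (partial b p) = partial b (partial a p)"
  using assms
proof induction
  case (mult f g)
  note P = mult.hyps poly_partial[OF mult.hyps(1)] poly_partial[OF mult.hyps(2)]
  show ?case
    using P mult.IH
    by (simp add: partial_mult partial_add real_polynomial_function.intros(4) fun_eq_iff algebra_simps)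
qed (simp_all add: partial_linear partial_add poly_partial)

lemma hom_polysI:
  "real_polynomial_function p \<Longrightarrow> (\<And>c x. p (c *\<^sub>R x) = c ^ k * p x) \<Longrightarrow> p \<in> hom_polys k"
  by (simp add: hom_polys_def)

lemma hom_polys_poly [dest]: "p \<in> hom_polys k \<Longrightarrow> real_polynomial_function p"
  by (simp add: hom_polys_def)

lemma hom_polys_scale: "p \<in> hom_polys k \<Longrightarrow> p (c *\<^sub>R x) = c ^ k * p x"
  by (simp add: hom_polys_def)

lemma hom_polys_zero [simp, intro]: "(\<lambda>x. 0) \<in> hom_polys k"
  by (auto intro!: hom_polysI)

lemma hom_polys_const [simp, intro]: "(\<lambda>x. c) \<in> hom_polys 0"
  by (auto intro!: hom_polysI)

lemma hom_polys_inner [simp, intro]: "(\<lambda>x. x \<bullet> a) \<in> hom_polys 1"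
  by (auto intro!: hom_polysI)

lemma hom_polys_add [intro]:
  "f \<in> hom_polys k \<Longrightarrow> g \<in> hom_polys k \<Longrightarrow> (\<lambda>x. f x + g x) \<in> hom_polys k"
  unfolding hom_polys_def
  by (simp add: real_polynomial_function.intros real_polynomial_function_diff distrib_left right_diff_distrib)

lemma hom_polys_diff [intro]:
  "f \<in> hom_polys k \<Longrightarrow> g \<in> hom_polys k \<Longrightarrow> (\<lambda>x. f x - g x) \<in> hom_polys k"
  unfolding hom_polys_def
  by (simp add: real_polynomial_function.intros real_polynomial_function_diff distrib_left right_diff_distrib)

lemma hom_polys_mult [intro]:
  "f \<in> hom_polys k \<Longrightarrow> g \<in> hom_polys l \<Longrightarrow> (\<lambda>x. f x * g x) \<in> hom_polys (k + l)"
  unfolding hom_polys_def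
  by (simp add: real_polynomial_function.intros power_add)

lemma hom_polys_cmult [intro]: "f \<in> hom_polys k \<Longrightarrow> (\<lambda>x. c * f x) \<in> hom_polys k"
  unfolding hom_polys_def by (simp add: poly_cmult)

lemma hom_polys_sum [intro]:
  assumes "finite I" "\<And>i. i \<in> I \<Longrightarrow> f i \<in> hom_polys k"
  shows "(\<lambda>x. \<Sum>i\<in>I. f i x) \<in> hom_polys k"
  using assms by (induction I) auto

lemma hom_polys_inner_mult [intro]:
  "f \<in> hom_polys k \<Longrightarrow> (\<lambda>x. (x \<bullet> a) * f x) \<in> hom_polys (Suc k)"
  using hom_polys_mult[OF hom_polys_inner, of f k a] by simp

lemma hom_polys_inner_self_mult [intro]:
  "f \<in> hom_polys k \<Longrightarrow> (\<lambda>x. (x \<bullet> x) * f x) \<in> hom_polys (k + 2)"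
  unfolding hom_polys_def
  by (simp add: real_polynomial_function.intros(4) poly_inner_self power2_eq_square power_add)

lemma hom_polys_power_inner_self_mult [intro]:
  "f \<in> hom_polys k \<Longrightarrow> (\<lambda>x. (x \<bullet> x) ^ j * f x) \<in> hom_polys (k + 2 * j)"
proof (induction j)
  case (Suc j)
  then show ?case
    using hom_polys_inner_self_mult[of "\<lambda>x. (x \<bullet> x) ^ j * f x" "k + 2 * j"]
    by (simp add: mult.assoc)
qed auto

lemma hom_polys_0D:
  assumes "p \<in> hom_polys 0"
  shows "p = (\<lambda>x. p 0)"
  proof
  show "p x = p 0" for x using hom_polys_scale[OF assms, of 0 x] by simp
qed

lemma partial_hom_polys_0: "p \<in> hom_polys 0 \<Longrightarrow> partial b p = (\<lambda>x. 0)"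
  by (subst hom_polys_0D) auto

text \<open>Differentiating the scaling law in x leaves one factor c on each side, which cancels
  only for nonzero c. The case c = 0 follows by letting c tend to 0, since the derivative is itself
  a polynomial and hence continuous.\<close>

lemma partial_hom_polys:
  assumes p: "p \<in> hom_polys (Suc k)"
  shows "partial b p \<in> hom_polys k"
proof (rule hom_polysI)
  show poly: "real_polynomial_function (partial b p)"
    using p by auto
  have *: "partial b p (c *\<^sub>R x) = c ^ k * partial b p x" if c: "c \<noteq> 0" for c x
  proof -
    have "((\<lambda>x. p (c *\<^sub>R x)) has_derivative (\<lambda>h. partial (c *\<^sub>R h) p (c *\<^sub>R x))) (at x)"
      by (rule has_derivative_compose[OF _ poly_has_derivative])
         (use p in \<open>auto intro!: derivative_eq_intros\<close>)
    moreover have "((\<lambda>x. p (c *\<^sub>R x)) has_derivative (\<lambda>h. c ^ Suc k * partial h p x)) (at x)"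
      unfolding hom_polys_scale[OF p]
      by (intro has_derivative_mult_right poly_has_derivative) (use p in auto)
    ultimately have "partial (c *\<^sub>R b) p (c *\<^sub>R x) = c ^ Suc k * partial b p x"
      using has_derivative_unique by metis
    moreover have "partial (c *\<^sub>R b) p (c *\<^sub>R x) = c * partial b p (c *\<^sub>R x)"
      using linear_cmul[OF has_derivative_linear[OF poly_has_derivative[of p "c *\<^sub>R x"]]] p
      by auto
    ultimately show ?thesis using c by simp
  qed
  show "partial b p (c *\<^sub>R x) = c ^ k * partial b p x" for c x
  proof (cases "c = 0")
    case False
    then show ?thesis by (rule *)
  next
    case True
    have "isCont (partial b p) (0 *\<^sub>R x)"
      using poly_differentiable[OF poly] differentiable_imp_continuous_within by blast
    then have "((\<lambda>c. partial b p (c *\<^sub>R x)) \<longlongrightarrow> partial b p (0 *\<^sub>R x)) (at 0)"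
      by (rule isCont_tendsto_compose) (intro tendsto_intros)
    moreover have "((\<lambda>c. partial b p (c *\<^sub>R x)) \<longlongrightarrow> 0 ^ k * partial b p x) (at 0)"
    proof (rule Lim_transform_eventually)
      show "((\<lambda>c. c ^ k * partial b p x) \<longlongrightarrow> 0 ^ k * partial b p x) (at 0)"
        by (intro tendsto_intros)
      show "\<forall>\<^sub>F c in at 0. c ^ k * partial b p x = partial b p (c *\<^sub>R x)"
        by (auto simp: eventually_at_filter *)
    qed
    ultimately have "partial b p (0 *\<^sub>R x) = 0 ^ k * partial b p x"
      by (rule tendsto_unique[rotated]) simp
    then show ?thesis using True by simp
  qed
qed

text \<open>Truncated subtraction is harmless: the derivative of a constant is zero, which is
  homogeneous of every degree.\<close>

lemma partial_hom_polys':
  assumes "p \<in> hom_polys k"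
  shows "partial b p \<in> hom_polys (k - 1)"
  using assms by (cases k) (auto simp: partial_hom_polys partial_hom_polys_0)

text \<open>Both sides are the derivative of \<open>p (c *\<^sub>R x)\<close> with respect to c at c
  = 1.\<close>

lemma euler_identity:
  assumes p: "p \<in> hom_polys k"
  shows "(\<Sum>b\<in>Basis. (x \<bullet> b) * partial b p x) = real k * p x"
proof -
  have poly: "real_polynomial_function p" using p by auto
  have "((\<lambda>c. p (c *\<^sub>R x)) has_derivative (\<lambda>h. partial (h *\<^sub>R x) p (1 *\<^sub>R x))) (at 1)"
    by (rule has_derivative_compose[OF _ poly_has_derivative])
       (use poly in \<open>auto intro!: derivative_eq_intros\<close>)
  moreover have "((\<lambda>c. p (c *\<^sub>R x)) has_derivative (\<lambda>h. h * (real k * 1 ^ (k - 1) * p x))) (at 1)"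
    unfolding hom_polys_scale[OF p]
    by (auto intro!: derivative_eq_intros)
  ultimately have "partial (1 *\<^sub>R x) p (1 *\<^sub>R x) = 1 * (real k * 1 ^ (k - 1) * p x)"
    using has_derivative_unique by metis
  moreover note lin = has_derivative_linear[OF poly_has_derivative[OF poly, of x]]
  have "partial (\<Sum>b\<in>Basis. (x \<bullet> b) *\<^sub>R b) p x = (\<Sum>b\<in>Basis. (x \<bullet> b) * partial b p x)"
    by (simp add: linear_sum[OF lin] linear_cmul[OF lin] del: euclidean_representation)
  ultimately show ?thesis by (simp add: euclidean_representation)
qed

section \<open>The Laplacian of homogeneous polynomials\<close>

lemma laplacian_eq: "laplacian p = (\<lambda>x. \<Sum>b\<in>Basis. partial b (partial b p) x)"
  by (simp add: laplacian_def partial_def[abs_def] fun_eq_iff)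

lemma laplacian_hom_polys:
  assumes "p \<in> hom_polys k"
  shows "laplacian p \<in> hom_polys (k - 2)"
  unfolding laplacian_eq
  using partial_hom_polys'[OF partial_hom_polys'[OF assms]] by (auto simp: numeral_2_eq_2)

lemma laplacian_hom_polys_lt_2:
  assumes "p \<in> hom_polys k" "k < 2"
  shows "laplacian p = (\<lambda>x. 0)"
proof -
  have "partial b p \<in> hom_polys 0" for b
    using partial_hom_polys'[OF assms(1)] assms(2) by (cases k) auto
  then show ?thesis by (simp add: laplacian_eq partial_hom_polys_0)
qed

lemma laplacian_zero [simp]: "laplacian (\<lambda>x. 0) = (\<lambda>x. 0)"
  by (simp add: laplacian_eq)

lemma laplacian_diff:
  assumes "real_polynomial_function f" "real_polynomial_function g"
  shows "laplacian (\<lambda>x. f x - g x) = (\<lambda>x. laplacian f x - laplacian g x)"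
  using assms by (simp add: laplacian_eq partial_diff poly_partial sum_subtractf)

lemma laplacian_cmult:
  assumes "real_polynomial_function f"
  shows "laplacian (\<lambda>x. c * f x) = (\<lambda>x. c * laplacian f x)"
  using assms by (simp add: laplacian_eq partial_cmult poly_partial sum_distrib_left)

lemma laplacian_mult:
  assumes "real_polynomial_function f" "real_polynomial_function g"
  shows "laplacian (\<lambda>x. f x * g x) =
    (\<lambda>x. f x * laplacian g x + 2 * (\<Sum>b\<in>Basis. partial b f x * partial b g x) + laplacian f x * g x)"
  using assms
  by (simp add: laplacian_eq partial_mult partial_add poly_partial real_polynomial_function.intros(4)
      sum.distrib sum_distrib_left sum_distrib_right fun_eq_iff algebra_simps flip: mult_2)

lemma partial_inner_self: "partial b (\<lambda>x. x \<bullet> x) = (\<lambda>x::'a::euclidean_space. 2 * (x \<bullet> b))"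
  by (rule ext, rule partial_eqI[where D = "\<lambda>h. 2 * (_ \<bullet> h)"])
     (auto intro!: derivative_eq_intros simp: inner_commute)

lemma laplacian_inner_self: "laplacian (\<lambda>x::'a::euclidean_space. x \<bullet> x) = (\<lambda>x. real DIM('a) * 2)"
  by (simp add: laplacian_eq partial_inner_self partial_cmult poly_inner)

text \<open>In the product rule the gradient of \<open>x \<bullet> x\<close> is 2x, so Euler's
  identity turns the cross term into 4k u; the Laplacian of \<open>x \<bullet> x\<close> contributes
  2 DIM.\<close>

lemma laplacian_inner_self_mult:
  fixes u :: "'a::euclidean_space \<Rightarrow> real"
  assumes u: "u \<in> hom_polys k"
  shows "laplacian (\<lambda>x. (x \<bullet> x) * u x) x = (2 * DIM('a) + 4 * k) * u x + (x \<bullet> x) * laplacian u x"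
proof -
  have "(\<Sum>b\<in>Basis. partial b (\<lambda>x. x \<bullet> x) x * partial b u x) = 2 * (real k * u x)"
    unfolding euler_identity[OF u, symmetric]
    by (simp add: partial_inner_self sum_distrib_left mult.assoc)
  then show ?thesis
    using u by (simp add: laplacian_mult poly_inner_self hom_polys_poly laplacian_inner_self algebra_simps)
qed

text \<open>The case of one factor is iterated, with the degree growing by 2 each time. The constant
  is the sum of 2 DIM + 4 (k + 2 i) over i = 0, ..., j.\<close>

lemma laplacian_power_inner_self_mult:
  fixes u :: "'a::euclidean_space \<Rightarrow> real"
  assumes u: "u \<in> hom_polys k"
  shows "laplacian (\<lambda>x. (x \<bullet> x) ^ Suc j * u x) x =
    2 * (real j + 1) * (real DIM('a) + 2 * real k + 2 * real j) * ((x \<bullet> x) ^ j * u x)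
      + (x \<bullet> x) ^ Suc j * laplacian u x"
proof (induction j)
  case 0
  then show ?case using laplacian_inner_self_mult[OF u, of x] by (simp add: algebra_simps)
next
  case (Suc j)
  have "(\<lambda>x. (x \<bullet> x) ^ Suc j * u x) \<in> hom_polys (k + 2 * Suc j)"
    by (rule hom_polys_power_inner_self_mult[OF u])
  from laplacian_inner_self_mult[OF this, of x] Suc show ?case
    by (simp add: algebra_simps)
qed

section \<open>Decomposition of polynomials into harmonics\<close>

text \<open>Up to the positive constant \<open>a\<close>, \<open>(x \<bullet> x) ^ Suc j * u\<close>
  already has the required Laplacian, with an error
  \<open>(x \<bullet> x) ^ Suc j * laplacian u\<close>. The error has the same shape with degree k -
  2 and exponent j + 1, so induction on the degree removes it. This is why j is generalized.\<close>

lemma laplacian_preimage: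
  fixes u :: "'a::euclidean_space \<Rightarrow> real"
  assumes "u \<in> hom_polys k"
  shows "\<exists>q\<in>hom_polys k. \<forall>x. laplacian (\<lambda>x. (x \<bullet> x) ^ Suc j * q x) x = (x \<bullet> x) ^ j * u x"
  using assms
proof (induction k arbitrary: u j rule: less_induct)
  case (less k)
  define a where "a = 2 * (real j + 1) * (real DIM('a) + 2 * real k + 2 * real j)"
  have "a > 0" unfolding a_def by (intro mult_pos_pos add_pos_nonneg add_nonneg_pos) (auto simp: DIM_positive)
  note lap = laplacian_power_inner_self_mult[OF less.prems, of j, folded a_def]
  obtain v where v: "v \<in> hom_polys k"
    "\<And>x. laplacian (\<lambda>x. (x \<bullet> x) ^ Suc j * v x) x = (x \<bullet> x) ^ Suc j * laplacian u x"
  proof (cases "k < 2")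
    case True
    then show ?thesis
      using that[of "\<lambda>x. 0"] laplacian_hom_polys_lt_2[OF less.prems True] by simp
  next
    case False
    obtain q where q: "q \<in> hom_polys (k - 2)"
      "\<And>x. laplacian (\<lambda>x. (x \<bullet> x) ^ Suc (Suc j) * q x) x = (x \<bullet> x) ^ Suc j * laplacian u x"
      using less.IH[OF _ laplacian_hom_polys[OF less.prems], of "Suc j"] False by auto
    \<comment> \<open>One factor \<open>x \<bullet> x\<close> of the corrector is moved into
      \<open>v\<close>, which restores the degree k and the outer exponent
      \<open>Suc j\<close>.\<close>
    have "k - 2 + 2 = k" using False by simp
    then show ?thesis
      using that[of "\<lambda>x. (x \<bullet> x) * q x"] hom_polys_inner_self_mult[OF q(1)] q(2)
      by (simp add: mult.assoc mult.left_commute del: add_2_eq_Suc')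
  qed
  let ?q = "\<lambda>x. inverse a * (u x - v x)"
  have "laplacian (\<lambda>x. (x \<bullet> x) ^ Suc j * ?q x) x = (x \<bullet> x) ^ j * u x" for x
  proof -
    have "(\<lambda>x. (x \<bullet> x) ^ Suc j * ?q x) =
        (\<lambda>x. inverse a * ((x \<bullet> x) ^ Suc j * u x - (x \<bullet> x) ^ Suc j * v x))"
      by (simp add: algebra_simps)
    moreover have "real_polynomial_function (\<lambda>x. (x \<bullet> x) ^ Suc j * u x)"
      "real_polynomial_function (\<lambda>x. (x \<bullet> x) ^ Suc j * v x)"
      using less.prems v(1) hom_polys_power_inner_self_mult hom_polys_poly by blast+
    ultimately show ?thesis
      using \<open>a > 0\<close> by (simp only: laplacian_cmult laplacian_diff real_polynomial_function_diff lap v(2)) simp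
  qed
  moreover have "?q \<in> hom_polys k" using less.prems v(1) by auto
  ultimately show ?case by (intro bexI[of _ ?q]) auto
qed

text \<open>Choose q so that \<open>(x \<bullet> x) * q x\<close> has the same Laplacian as p; the
  difference is harmonic. The last clause settles degrees 0 and 1, where the truncated k - 2 would
  be a wrong degree for a nonzero q.\<close>

lemma hom_polys_decomposition:
  fixes p :: "'a::euclidean_space \<Rightarrow> real"
  assumes "p \<in> hom_polys k"
  shows "\<exists>h\<in>hom_polys k. \<exists>q\<in>hom_polys (k - 2). (\<forall>x. laplacian h x = 0) \<and>
     (\<forall>x. p x = h x + (x \<bullet> x) * q x) \<and> (k < 2 \<longrightarrow> q = (\<lambda>x. 0))"
proof (cases "k < 2")
  case True
  then show ?thesis
    using assms laplacian_hom_polys_lt_2[OF assms] by (intro bexI[of _ p] bexI[of _ "\<lambda>x. 0"]) auto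
next
  case False
  obtain q where q: "q \<in> hom_polys (k - 2)"
    "\<And>x. laplacian (\<lambda>x. (x \<bullet> x) ^ Suc 0 * q x) x = (x \<bullet> x) ^ 0 * laplacian p x"
    using laplacian_preimage[OF laplacian_hom_polys[OF assms]] by metis
  have r: "(\<lambda>x. (x \<bullet> x) * q x) \<in> hom_polys k"
    using hom_polys_inner_self_mult[OF q(1)] False by (metis le_add_diff_inverse2 not_less)
  show ?thesis
    using False q r assms
    by (intro bexI[of _ "\<lambda>x. p x - (x \<bullet> x) * q x"] bexI[of _ q])
       (auto simp: laplacian_diff hom_polys_poly)
qed

section \<open>Integration over the sphere\<close>

lemma continuous_on_compact_bounded:
  fixes f :: "'a::topological_space \<Rightarrow> real"
  assumes "continuous_on S f" "compact S"
  obtains B where "B \<ge> 0" "\<And>x. x \<in> S \<Longrightarrow> \<bar>f x\<bar> \<le> B"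
proof -
  obtain B where "\<forall>y\<in>f ` S. norm y \<le> B"
    using compact_imp_bounded[OF compact_continuous_image[OF assms]] unfolding bounded_iff by blast
  then show ?thesis by (intro that[of "max 0 B"]) (auto simp: le_max_iff_disj)
qed

lemma radial_proj_measurable [measurable]:
  "(\<lambda>x::'a::euclidean_space. x /\<^sub>R norm x) \<in> borel_measurable borel"
  by measurable

lemma ball_emeasure:
  "emeasure lborel (ball 0 1 :: 'a::euclidean_space set) = ennreal (measure lborel (ball 0 1 :: 'a set))"
  "0 < measure lborel (ball 0 1 :: 'a::euclidean_space set)"
proof -
  have "emeasure lborel (ball 0 1 :: 'a set) < \<infinity>"
    by (rule emeasure_bounded_finite) auto
  then show *: "emeasure lborel (ball 0 1 :: 'a set) = ennreal (measure lborel (ball 0 1 :: 'a set))"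
    by (intro emeasure_eq_ennreal_measure) auto
  show "0 < measure lborel (ball 0 1 :: 'a set)"
    using content_ball_pos[of 1 "0 :: 'a"] by (simp add: measure_completion)
qed

lemma space_sphere_measure [simp]: "space (sphere_measure :: 'a::euclidean_space measure) = sphere 0 1"
  by (simp add: sphere_measure_def space_restrict_space)

lemma sets_sphere_measure: "sets (sphere_measure :: 'a::euclidean_space measure) = sets (restrict_space borel (sphere 0 1))"
  by (simp add: sphere_measure_def sets_restrict_space)

lemma sphere_measurable_cone:
  fixes f :: "'a::euclidean_space \<Rightarrow> real"
  assumes "continuous_on (sphere 0 1) f"
  shows "(\<lambda>x. indicator (sphere 0 1) x * f x) \<in> borel_measurable borel"
  using borel_measurable_continuous_on_indicator[OF _ assms] by simp

lemma radial_measurable: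
  fixes f :: "'a::euclidean_space \<Rightarrow> real"
  assumes f: "continuous_on (sphere 0 1) f"
  shows "(\<lambda>x. f (x /\<^sub>R norm x)) \<in> borel_measurable borel"
proof -
  note [measurable] = sphere_measurable_cone[OF f]
  \<comment> \<open>The origin is projected to 0, which is off the sphere, so the cutoff would
    replace the arbitrary value \<open>f 0\<close> by 0. It is put back by hand.\<close>
  have "(\<lambda>x. if x = 0 then f 0 else indicator (sphere 0 1) (x /\<^sub>R norm x) * f (x /\<^sub>R norm x))
      \<in> borel_measurable borel"
    by measurable
  then show ?thesis
    by (rule measurable_cong[THEN iffD1, rotated]) (auto simp: indicator_def)
qed

lemma AE_lborel_neq: "AE x in lborel. x \<noteq> (c::'a::euclidean_space)"
  by (rule AE_lborel_singleton)

lemma sphere_integral_eq: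
  fixes f :: "'a::euclidean_space \<Rightarrow> real"
  assumes f: "continuous_on (sphere 0 1) f"
  shows "(\<integral>x. f x \<partial>sphere_measure) =
     (\<integral>x. indicator (ball 0 1) x * f (x /\<^sub>R norm x) \<partial>lborel) / measure lborel (ball 0 1 :: 'a set)"
    (is "_ = ?R / ?v")
proof -
  let ?g = "\<lambda>x. indicator (sphere 0 1) x * f x"
  note [measurable] = radial_measurable[OF f]
  have g [measurable]: "?g \<in> borel_measurable borel" by (rule sphere_measurable_cone[OF f])
  have "(\<integral>x. f x \<partial>sphere_measure) =
      (\<integral>x. ?g x \<partial>distr (uniform_measure lborel (ball 0 1)) borel (\<lambda>x. x /\<^sub>R norm x))"
    unfolding sphere_measure_def by (subst integral_restrict_space) auto
  also have "\<dots> = (\<integral>x. ?g (x /\<^sub>R norm x) \<partial>uniform_measure lborel (ball 0 1))"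
    by (rule integral_distr) auto
  also have "uniform_measure lborel (ball 0 1 :: 'a set) =
      density lborel (\<lambda>x. ennreal (indicator (ball 0 1) x / ?v))"
    unfolding uniform_measure_def ball_emeasure(1)
    by (intro density_cong) (use ball_emeasure(2) in \<open>auto simp: indicator_def divide_ennreal simp flip: ennreal_1\<close>)
  also have "(\<integral>x. ?g (x /\<^sub>R norm x) \<partial>density lborel (\<lambda>x. ennreal (indicator (ball 0 1) x / ?v))) =
      (\<integral>x. (indicator (ball 0 1) x / ?v) *\<^sub>R ?g (x /\<^sub>R norm x) \<partial>lborel)"
  proof (rule integral_density)
    show "(\<lambda>x::'a. indicator (ball 0 1) x / ?v) \<in> borel_measurable lborel"
      by (intro borel_measurable_divide borel_measurable_indicator) auto
  qed (use ball_emeasure(2)[where 'a='a] in auto)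
  also have "\<dots> = (\<integral>x. (indicator (ball 0 1) x * f (x /\<^sub>R norm x)) / ?v \<partial>lborel)"
    using AE_lborel_neq[of 0]
    by (intro integral_cong_AE)
       (auto elim!: eventually_mono simp: indicator_def)
  finally show ?thesis by simp
qed

lemma finite_measure_sphere_measure:
  "finite_measure (sphere_measure :: 'a::euclidean_space measure)"
proof -
  have "emeasure (sphere_measure :: 'a measure) (sphere 0 1) \<le> emeasure (uniform_measure lborel (ball 0 1 :: 'a set)) UNIV"
    unfolding sphere_measure_def
    by (subst emeasure_restrict_space, simp, simp, subst emeasure_distr, simp, simp, rule emeasure_mono) auto
  also have "\<dots> < \<infinity>"
    using ball_emeasure[where 'a='a] by (simp add: divide_ennreal less_top[symmetric])
  finally show ?thesis by (intro finite_measureI) auto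
qed

lemma sphere_integrable:
  fixes f :: "'a::euclidean_space \<Rightarrow> real"
  assumes f: "continuous_on (sphere 0 1) f"
  shows "integrable sphere_measure f"
proof -
  interpret finite_measure "sphere_measure :: 'a measure" by (rule finite_measure_sphere_measure)
  obtain B where "\<And>x. x \<in> sphere 0 1 \<Longrightarrow> norm (f x) \<le> B"
    using continuous_on_compact_bounded[OF f] by auto
  moreover have "f \<in> borel_measurable (sphere_measure :: 'a measure)"
    using borel_measurable_continuous_on_restrict[OF f]
    by (simp cong: measurable_cong_sets add: sets_sphere_measure)
  ultimately show ?thesis by (intro integrable_const_bound[of _ B]) auto
qed

lemma integral_lborel_scale:
  fixes f :: "'a::euclidean_space \<Rightarrow> real"
  assumes [measurable]: "f \<in> borel_measurable borel" and c: "c > 0"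
  shows "(\<integral>x. f x \<partial>lborel) = c ^ DIM('a) * (\<integral>x. f (c *\<^sub>R x) \<partial>lborel)"
proof -
  have "(\<integral>x. f x \<partial>lborel) =
      (\<integral>x. f x \<partial>density (distr lborel borel (\<lambda>x. 0 + c *\<^sub>R x)) (\<lambda>_. ennreal (\<bar>c\<bar> ^ DIM('a))))"
    using lborel_affine[of c "0::'a"] c by simp
  also have "\<dots> = (\<integral>x. \<bar>c\<bar> ^ DIM('a) *\<^sub>R f x \<partial>distr lborel borel (\<lambda>x. 0 + c *\<^sub>R x))"
    by (rule integral_density) auto
  also have "\<dots> = (\<integral>x. \<bar>c\<bar> ^ DIM('a) *\<^sub>R f (0 + c *\<^sub>R x) \<partial>lborel)"
    by (rule integral_distr) auto
  finally show ?thesis using c by simp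
qed

lemma measurable_indicator_ball_times:
  fixes f :: "'a::euclidean_space \<Rightarrow> real"
  shows "f \<in> borel_measurable borel \<Longrightarrow> (\<lambda>x. indicator (ball 0 t) x * f x) \<in> borel_measurable borel"
  by (intro borel_measurable_times borel_measurable_indicator) auto

lemma integrable_on_ball:
  fixes f :: "'a::euclidean_space \<Rightarrow> real"
  assumes [measurable]: "f \<in> borel_measurable borel"
    and B: "\<And>x. x \<in> ball 0 t \<Longrightarrow> \<bar>f x\<bar> \<le> B"
  shows "integrable lborel (\<lambda>x. indicator (ball 0 t) x * f x)"
proof (rule Bochner_Integration.integrable_bound)
  have "emeasure lborel (ball 0 t :: 'a set) < \<infinity>"
    by (rule emeasure_bounded_finite) auto
  then show "integrable lborel (\<lambda>x::'a. B * indicator (ball 0 t) x)"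
    by (intro integrable_mult_right integrable_real_indicator) auto
qed (auto simp: indicator_def intro!: order.trans[OF B])

lemma poly_continuous_on:
  fixes p :: "'a::euclidean_space \<Rightarrow> real"
  assumes "real_polynomial_function p"
  shows "continuous_on S p"
  using poly_differentiable[OF assms] differentiable_imp_continuous_within
  by (blast intro: continuous_at_imp_continuous_on)

lemma hom_polys_continuous_on: "p \<in> hom_polys k \<Longrightarrow> continuous_on S p"
  by (rule poly_continuous_on) auto

text \<open>This is integration in polar coordinates, obtained from scaling alone. On the thin shell
  between the radii 1 and t, p and its extension of degree 0 differ by O(t - 1), and the shell has
  volume O(t - 1). The two shell integrals therefore have the same derivative at t = 1, and scaling
  evaluates these derivatives as (D + k) A and D a.\<close>

lemma integral_ball_hom_polys:
  fixes p :: "'a::euclidean_space \<Rightarrow> real"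
  assumes p: "p \<in> hom_polys k"
  shows "(\<integral>x. indicator (ball 0 1) x * p x \<partial>lborel) =
    measure lborel (ball 0 1 :: 'a set) * DIM('a) / (DIM('a) + k) * (\<integral>x. p x \<partial>sphere_measure)"
proof -
  define D where "D = DIM('a)"
  have "D > 0" by (simp add: D_def)
  \<comment> \<open>\<open>a\<close> is the sphere integral of p times the volume of the ball;
    \<open>A\<close> is the ball integral to be computed.\<close>
  define g where "g x = p (x /\<^sub>R norm x)" for x
  define A where "A = (\<integral>x. indicator (ball 0 1) x * p x \<partial>lborel)"
  define a where "a = (\<integral>x. indicator (ball 0 1) x * g x \<partial>lborel)"
  define v where "v = (\<integral>x. indicator (ball 0 1) x * (1::real) \<partial>(lborel :: 'a measure))"
  have cont: "continuous_on S p" for S by (rule hom_polys_continuous_on[OF p])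
  have [measurable]: "p \<in> borel_measurable borel"
    using cont[of UNIV] by (rule borel_measurable_continuous_onI)
  have [measurable]: "g \<in> borel_measurable borel"
    unfolding g_def by (rule radial_measurable[OF cont])
  obtain M where M: "\<And>x. x \<in> cball 0 1 \<Longrightarrow> \<bar>p x\<bar> \<le> M"
    using continuous_on_compact_bounded[OF cont compact_cball] by metis
  have pg: "p x = norm x ^ k * g x" for x
    using hom_polys_scale[OF p, of "norm x" "x /\<^sub>R norm x"] by (cases "x = 0") (auto simp: g_def)
  have gM: "\<bar>g x\<bar> \<le> M" for x
    unfolding g_def by (rule M) (auto simp: divide_simps)
  have M0: "0 \<le> M" using gM[of 0] by simp
  have pint: "integrable lborel (\<lambda>x. indicator (ball 0 t) x * p x)" for t
  proof (rule integrable_on_ball)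
    fix x :: 'a assume "x \<in> ball 0 t"
    then have "norm x ^ k \<le> \<bar>t\<bar> ^ k" by (intro power_mono) auto
    then show "\<bar>p x\<bar> \<le> \<bar>t\<bar> ^ k * M"
      unfolding pg[of x] abs_mult using gM[of x] by (intro mult_mono) auto
  qed auto
  have gint: "integrable lborel (\<lambda>x. indicator (ball 0 t) x * g x)" for t
    by (rule integrable_on_ball[OF _ gM]) auto
  have vint: "integrable lborel (\<lambda>x::'a. indicator (ball 0 t) x * (1::real))" for t
    using integrable_on_ball[of "\<lambda>_. 1" t 1] by simp
  have ind: "indicator (ball 0 t) (t *\<^sub>R x) = (indicator (ball 0 1) x :: real)" if "t > 0" for t and x :: 'a
    using that by (auto simp: indicator_def)
  have At: "(\<integral>x. indicator (ball 0 t) x * p x \<partial>lborel) = t ^ (D + k) * A" if "t > 0" for t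
    using that integral_lborel_scale[of "\<lambda>x. indicator (ball 0 t) x * p x" t]
      measurable_indicator_ball_times[of "\<lambda>x. p x" t]
    by (simp add: ind hom_polys_scale[OF p] A_def D_def power_add mult.assoc mult.left_commute[of _ "t ^ k"])
  have aat: "(\<integral>x. indicator (ball 0 t) x * g x \<partial>lborel) = t ^ D * a" if "t > 0" for t
  proof -
    have "g (t *\<^sub>R x) = g x" for x using that by (simp add: g_def field_simps)
    then show ?thesis
      using that integral_lborel_scale[of "\<lambda>x. indicator (ball 0 t) x * g x" t]
      measurable_indicator_ball_times[of "\<lambda>x. g x" t]
      by (simp add: ind a_def D_def)
  qed
  have vt: "(\<integral>x. indicator (ball 0 t) x * (1::real) \<partial>(lborel :: 'a measure)) = t ^ D * v" if "t > 0" for t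
    using that integral_lborel_scale[of "\<lambda>x::'a. indicator (ball 0 t) x * (1::real)" t]
      measurable_indicator_ball_times[of "\<lambda>x::'a. 1" t]
    by (simp add: ind v_def D_def)
  \<comment> \<open>\<open>\<phi> t\<close> is the integral of p - g over the shell. The two factors
    of its bound \<open>\<psi> t\<close> that depend on t both vanish at 1, so the bound has
    derivative zero there.\<close>
  define \<phi> where "\<phi> t = (t ^ (D + k) - 1) * A - (t ^ D - 1) * a" for t
  define \<psi> where "\<psi> t = M * (t ^ k - 1) * ((t ^ D - 1) * v)" for t
  have shell: "\<bar>\<phi> t\<bar> \<le> \<psi> t" if t: "t > 1" for t
  proof -
    let ?s = "\<lambda>x::'a. indicator (ball 0 t) x - indicator (ball 0 1) x :: real"
    have "\<phi> t = (\<integral>x. ?s x * p x - ?s x * g x \<partial>lborel)"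
      using t pint gint At[of t] aat[of t]
      by (simp add: \<phi>_def left_diff_distrib A_def[symmetric] a_def[symmetric])
    also have "\<bar>\<dots>\<bar> \<le> (\<integral>x. \<bar>?s x * p x - ?s x * g x\<bar> \<partial>lborel)"
      by (rule integral_abs_bound)
    also have "\<dots> \<le> (\<integral>x. M * (t ^ k - 1) * (?s x * (1::real)) \<partial>lborel)"
    proof (rule Bochner_Integration.integral_mono)
      show "integrable lborel (\<lambda>x. \<bar>?s x * p x - ?s x * g x\<bar>)"
        unfolding left_diff_distrib by (intro integrable_abs Bochner_Integration.integrable_diff pint gint)
      show "integrable lborel (\<lambda>x. M * (t ^ k - 1) * (?s x * (1::real)))"
        unfolding left_diff_distrib
        by (intro integrable_mult_right Bochner_Integration.integrable_diff vint)
      fix x :: 'a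
      show "\<bar>?s x * p x - ?s x * g x\<bar> \<le> M * (t ^ k - 1) * (?s x * (1::real))"
      proof (cases "x \<in> ball 0 t - ball 0 1")
        case True
        then have n: "1 \<le> norm x" "norm x \<le> t" by auto
        have "p x - g x = (norm x ^ k - 1) * g x"
          by (simp add: pg[of x] left_diff_distrib)
        moreover have "1 \<le> norm x ^ k" "norm x ^ k \<le> t ^ k"
          using n by (auto intro: power_mono)
        ultimately have "\<bar>p x - g x\<bar> \<le> (t ^ k - 1) * M"
          unfolding abs_mult using gM[of x] by (auto simp: abs_mult intro!: mult_mono)
        then show ?thesis using True by (simp add: indicator_def mult.commute)
      next
        case False
        then have "?s x = 0" using t by (auto simp: indicator_def)
        then show ?thesis by simp
      qed
    qed
    also have "\<dots> = \<psi> t"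
      using t vint vt[of t] by (simp add: \<psi>_def left_diff_distrib v_def algebra_simps)
    finally show ?thesis .
  qed
  have d\<phi>: "(\<phi> has_real_derivative real (D + k) * A - real D * a) (at 1)"
    unfolding \<phi>_def[abs_def] by (auto intro!: derivative_eq_intros)
  have d\<psi>: "(\<psi> has_real_derivative 0) (at 1)"
    unfolding \<psi>_def[abs_def] by (auto intro!: derivative_eq_intros)
  have r\<phi>: "((\<lambda>t. (\<phi> t - \<phi> 1) / (t - 1)) \<longlongrightarrow> real (D + k) * A - real D * a) (at_right 1)"
    using d\<phi> unfolding has_field_derivative_iff by (rule filterlim_mono) (auto simp: at_le)
  have r\<psi>: "((\<lambda>t. (\<psi> t - \<psi> 1) / (t - 1)) \<longlongrightarrow> 0) (at_right 1)"
    using d\<psi> unfolding has_field_derivative_iff by (rule filterlim_mono) (auto simp: at_le)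
  have "((\<lambda>t. (\<phi> t - \<phi> 1) / (t - 1)) \<longlongrightarrow> 0) (at_right 1)"
  proof (rule Lim_null_comparison[OF _ r\<psi>])
    show "\<forall>\<^sub>F t in at_right 1. norm ((\<phi> t - \<phi> 1) / (t - 1)) \<le> (\<psi> t - \<psi> 1) / (t - 1)"
      using shell by (auto simp: eventually_at_filter \<phi>_def[of 1] \<psi>_def[of 1] divide_right_mono)
  qed
  then have "real (D + k) * A - real D * a = 0"
    by (rule tendsto_unique[OF _ r\<phi>, rotated]) simp
  then have "A = a * real D / (real D + real k)"
    using \<open>D > 0\<close> by (simp add: field_simps add_pos_nonneg)
  moreover have "(\<integral>x. p x \<partial>sphere_measure) * measure lborel (ball 0 1 :: 'a set) = a"
    using sphere_integral_eq[OF cont] ball_emeasure(2)[where 'a='a] by (simp add: a_def g_def)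
  ultimately show ?thesis by (simp add: A_def D_def mult_ac)
qed

text \<open>By translation invariance every difference quotient of F along b has integral zero. The
  quotients converge to G, and the mean value theorem bounds them by the supremum of G, so dominated
  convergence applies.\<close>

lemma integral_directional_derivative:
  fixes F G :: "'a::euclidean_space \<Rightarrow> real"
  assumes deriv: "\<And>x. ((\<lambda>t. F (x + t *\<^sub>R b)) has_real_derivative G x) (at 0)"
    and cont: "continuous_on UNIV F" "continuous_on UNIV G"
    and supp: "\<And>x. norm x > 1 \<Longrightarrow> F x = 0" "\<And>x. norm x > 1 \<Longrightarrow> G x = 0"
    and b: "norm b \<le> 1"
  shows "(\<integral>x. G x \<partial>lborel) = 0"
proof -
  have [measurable]: "F \<in> borel_measurable borel" "G \<in> borel_measurable borel"
    using cont by (auto intro: borel_measurable_continuous_onI)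
  have bound: "\<exists>L. \<forall>x. \<bar>H x\<bar> \<le> L" if "continuous_on UNIV H" "\<And>x. norm x > 1 \<Longrightarrow> H x = 0"
    for H :: "'a \<Rightarrow> real"
  proof -
    have "continuous_on (cball 0 1) H" using that(1) continuous_on_subset by blast
    from continuous_on_compact_bounded[OF this compact_cball]
    obtain L where "\<And>x. norm x \<le> 1 \<Longrightarrow> \<bar>H x\<bar> \<le> L"
      by (metis mem_cball_0)
    then have "\<bar>H x\<bar> \<le> max L 0" for x
      using that(2)[of x] by (cases "norm x \<le> 1") (auto simp: le_max_iff_disj)
    then show ?thesis by blast
  qed
  obtain L where L: "\<And>x. \<bar>G x\<bar> \<le> L" using bound[OF cont(2) supp(2)] by blast
  obtain K where K: "\<And>x. \<bar>F x\<bar> \<le> K" using bound[OF cont(1) supp(1)] by blast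
  have Fint: "integrable lborel F"
  proof -
    have "(\<lambda>x. indicator (ball 0 2) x * F x) = F"
      using supp(1) by (auto simp: fun_eq_iff indicator_def)
    then show ?thesis using integrable_on_ball[of F 2 K] K by simp
  qed
  define s where "s i x = (F (x + inverse (real (Suc i)) *\<^sub>R b) - F x) / inverse (real (Suc i))" for i x
  have "(\<lambda>i. \<integral>x. s i x \<partial>lborel) \<longlonglongrightarrow> (\<integral>x. G x \<partial>lborel)"
  \<comment> \<open>F vanishes outside the closed unit ball and the shifts have length at most 1, so
    the ball of radius 3 has room for every quotient.\<close>
  proof (rule integral_dominated_convergence[where w = "\<lambda>x. indicator (ball 0 3) x * L"])
    show "integrable lborel (\<lambda>x::'a. indicator (ball 0 3) x * L)"
      by (rule integrable_on_ball[where B = "\<bar>L\<bar>"]) auto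
    show "AE x in lborel. (\<lambda>i. s i x) \<longlonglongrightarrow> G x"
    proof (rule AE_I2)
      fix x :: 'a
      have "((\<lambda>h. (F (x + h *\<^sub>R b) - F x) / h) \<longlongrightarrow> G x) (at 0)"
        using deriv[of x] by (simp add: DERIV_def)
      moreover have "filterlim (\<lambda>i. inverse (real (Suc i))) (at 0) sequentially"
        using LIMSEQ_inverse_real_of_nat by (auto simp: filterlim_at)
      ultimately show "(\<lambda>i. s i x) \<longlonglongrightarrow> G x"
        unfolding s_def by (rule filterlim_compose)
    qed
    show "AE x in lborel. norm (s i x) \<le> indicator (ball 0 3) x * L" for i
    proof (rule AE_I2)
      fix x :: 'a
      define h where "h = inverse (real (Suc i))"
      have h: "0 < h" "h \<le> 1" by (auto simp: h_def divide_simps)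
      have hb: "norm (h *\<^sub>R b) \<le> 1"
        using h b mult_mono[of h 1 "norm b" 1] by simp
      show "norm (s i x) \<le> indicator (ball 0 3) x * L"
      proof (cases "norm x < 3")
        case True
        have D: "((\<lambda>t. F (x + t *\<^sub>R b)) has_real_derivative G (x + t *\<^sub>R b)) (at t)" for t
          using deriv[of "x + t *\<^sub>R b"] DERIV_shift[of "\<lambda>t. F (x + t *\<^sub>R b)" "G (x + t *\<^sub>R b)" 0 t]
          by (simp add: algebra_simps)
        obtain z where "F (x + h *\<^sub>R b) - F (x + 0 *\<^sub>R b) = (h - 0) * G (x + z *\<^sub>R b)"
          using MVT2[OF h(1), of "\<lambda>t. F (x + t *\<^sub>R b)" "\<lambda>t. G (x + t *\<^sub>R b)"] D by blast
        then have "s i x = G (x + z *\<^sub>R b)"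
          unfolding s_def h_def[symmetric] using h(1) by simp
        then show ?thesis using True L by simp
      next
        case False
        moreover have "norm x \<le> norm (x + h *\<^sub>R b) + norm (h *\<^sub>R b)"
          using norm_triangle_ineq4[of "x + h *\<^sub>R b" "h *\<^sub>R b"] by simp
        ultimately have "F (x + h *\<^sub>R b) = 0" "F x = 0"
          using hb by (auto intro!: supp(1))
        then show ?thesis unfolding s_def h_def[symmetric] using False by simp
      qed
    qed
  qed (auto simp: s_def)
  moreover have "(\<integral>x. s i x \<partial>lborel) = 0" for i
  proof -
    let ?h = "inverse (real (Suc i)) *\<^sub>R b"
    have "integrable (distr lborel borel ((+) ?h)) F" using Fint by (simp add: lborel_distr_plus)
    then have "integrable lborel (\<lambda>x. F (?h + x))"
      by (rule integrable_distr[rotated]) auto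
    moreover have "(\<integral>x. F (?h + x) \<partial>lborel) = (\<integral>x. F x \<partial>lborel)"
      by (subst lborel_distr_plus[of ?h, symmetric], subst integral_distr) auto
    ultimately show ?thesis
      using Fint unfolding s_def add.commute[of _ ?h] by simp
  qed
  ultimately show ?thesis by (simp add: LIMSEQ_const_iff)
qed

text \<open>The weight is the square of the positive part of \<open>1 - x \<bullet> x\<close>. The
  square makes it continuously differentiable across the boundary, so the product with p extends by
  zero to the whole space and no boundary term arises.\<close>

lemma integral_ball_by_parts:
  fixes p :: "'a::euclidean_space \<Rightarrow> real"
  assumes p: "real_polynomial_function p" and b: "norm b \<le> 1"
  shows "(\<integral>x. indicator (ball 0 1) x * (partial b p x * (1 - x \<bullet> x)\<^sup>2 - 4 * (x \<bullet> b) * p x * (1 - x \<bullet> x)) \<partial>lborel) = 0"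
proof -
  define F where "F x = p x * (max 0 (1 - x \<bullet> x))\<^sup>2" for x
  define G where "G x = partial b p x * (max 0 (1 - x \<bullet> x))\<^sup>2 - 4 * (x \<bullet> b) * p x * max 0 (1 - x \<bullet> x)" for x
  have sq: "((\<lambda>u::real. (max 0 u)\<^sup>2) has_real_derivative 2 * max 0 u) (at u)" for u
  proof -
    consider "u > 0" | "u < 0" | "u = 0" by linarith
    then show ?thesis
    proof cases
      case 1
      have "((\<lambda>u. u\<^sup>2) has_real_derivative 2 * max 0 u) (at u)"
        using 1 by (auto intro!: derivative_eq_intros)
      then show ?thesis
        by (rule DERIV_cong_ev[OF refl _ refl, THEN iffD1, rotated])
           (use 1 in \<open>auto intro!: eventually_mono[OF eventually_nhds_in_open[of "{0<..}" u]]\<close>)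
    next
      case 2
      have "((\<lambda>u. 0) has_real_derivative 2 * max 0 u) (at u)"
        using 2 by (auto intro!: derivative_eq_intros)
      then show ?thesis
        by (rule DERIV_cong_ev[OF refl _ refl, THEN iffD1, rotated])
           (use 2 in \<open>auto intro!: eventually_mono[OF eventually_nhds_in_open[of "{..<0}" u]]\<close>)
    next
      case 3
      have "((\<lambda>h. (max 0 h)\<^sup>2 / h) \<longlongrightarrow> 0) (at (0::real))"
      proof (rule Lim_null_comparison)
        show "\<forall>\<^sub>F h in at (0::real). norm ((max 0 h)\<^sup>2 / h) \<le> \<bar>h\<bar>"
          by (auto simp: eventually_at_filter max_def power2_eq_square)
        show "((\<lambda>h. \<bar>h\<bar>) \<longlongrightarrow> 0) (at (0::real))" by (auto intro!: tendsto_eq_intros)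
      qed
      then show ?thesis using 3 by (simp add: DERIV_def)
    qed
  qed
  have Gz: "norm x \<ge> 1 \<Longrightarrow> max 0 (1 - x \<bullet> x) = 0" for x :: 'a
    using one_le_power[of "norm x" 2] unfolding power2_norm_eq_inner[symmetric] by linarith
  have "(\<integral>x. G x \<partial>lborel) = 0"
  proof (rule integral_directional_derivative[of F b])
    fix x
    have 1: "((\<lambda>t. p (x + t *\<^sub>R b)) has_real_derivative partial b p x) (at 0)"
    proof -
      have "((\<lambda>t. p (x + t *\<^sub>R b)) has_derivative (\<lambda>h. partial (h *\<^sub>R b) p (x + 0 *\<^sub>R b))) (at 0)"
        by (rule has_derivative_compose[OF _ poly_has_derivative[OF p]])
           (auto intro!: derivative_eq_intros)
      moreover note lin = has_derivative_linear[OF poly_has_derivative[OF p, of x]]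
      ultimately show ?thesis
        by (simp add: has_field_derivative_def linear_cmul[OF lin] mult_commute_abs)
    qed
    have "((\<lambda>t. 1 - (x + t *\<^sub>R b) \<bullet> (x + t *\<^sub>R b)) has_real_derivative - 2 * (x \<bullet> b)) (at 0)"
      unfolding inner_add_left inner_add_right inner_scaleR_left inner_scaleR_right
      by (auto intro!: derivative_eq_intros simp: inner_commute)
    from DERIV_chain2[OF sq this]
    have 2: "((\<lambda>t. (max 0 (1 - (x + t *\<^sub>R b) \<bullet> (x + t *\<^sub>R b)))\<^sup>2) has_real_derivative
        2 * max 0 (1 - x \<bullet> x) * (- 2 * (x \<bullet> b))) (at 0)" by simp
    show "((\<lambda>t. F (x + t *\<^sub>R b)) has_real_derivative G x) (at 0)"
      using DERIV_mult[OF 1 2] unfolding F_def G_def by (simp add: algebra_simps)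
  next
    show "continuous_on UNIV F" unfolding F_def
      by (intro continuous_intros poly_continuous_on p)
    show "continuous_on UNIV G" unfolding G_def
      by (intro continuous_intros poly_continuous_on p poly_partial)
  qed (use b Gz in \<open>auto simp: F_def G_def\<close>)
  moreover have "indicator (ball 0 1) x * (partial b p x * (1 - x \<bullet> x)\<^sup>2 - 4 * (x \<bullet> b) * p x * (1 - x \<bullet> x)) = G x" for x
    using Gz[of x] by (auto simp: G_def indicator_def power2_norm_eq_inner[symmetric] max_def abs_square_le_1)
  ultimately show ?thesis by simp
qed

text \<open>Expanding the weight in \<open>integral_ball_by_parts\<close> leaves ball integrals of
  homogeneous polynomials. Converted to the sphere they involve only the two integrals I and J, so
  the vanishing sum is a linear relation between them.\<close>

lemma sphere_divergence:
  fixes g :: "'a::euclidean_space \<Rightarrow> real"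
  assumes g: "g \<in> hom_polys k" and b: "norm b \<le> 1"
  shows "(\<integral>x. partial b g x \<partial>sphere_measure) =
    (real DIM('a) + real k - 1) * (\<integral>x. (x \<bullet> b) * g x \<partial>sphere_measure)"
\<comment> \<open>This is the one case where D + k - 1, a denominator below, vanishes; both sides
  are then zero.\<close>
proof (cases "k = 0 \<and> DIM('a) = 1")
  case True
  then show ?thesis using g by (simp add: partial_hom_polys_0)
next
  case False
  define D where "D = real DIM('a)"
  define I where "I = (\<integral>x. partial b g x \<partial>sphere_measure)"
  define J where "J = (\<integral>x. (x \<bullet> b) * g x \<partial>sphere_measure)"
  define v where "v = measure lborel (ball 0 1 :: 'a set)"
  have v: "v > 0" unfolding v_def by (rule ball_emeasure)
  define B where "B f = (\<integral>x. indicator (ball 0 1) x * f x \<partial>(lborel :: 'a measure))" for f :: "'a \<Rightarrow> real"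
  have D: "D \<ge> 1" by (simp add: D_def Suc_leI)
  have Dk: "D + k - 1 > 0"
  proof (cases "k = 0")
    case True
    then have "DIM('a) \<ge> 2" using False DIM_positive[where 'a='a] by linarith
    then show ?thesis by (simp add: D_def)
  next
    case False
    then have "real k \<ge> 1" by simp
    then show ?thesis using D by linarith
  qed
  \<comment> \<open>\<open>e\<close> stands for k - 1. For k = 0 it has to be 0 instead, which does
    no harm because then I = 0.\<close>
  obtain e where e: "partial b g \<in> hom_polys e" "real e = real k - 1 \<or> I = 0"
  proof (cases k)
    case 0
    then show ?thesis using that[of 0] g by (simp add: partial_hom_polys_0 I_def)
  next
    case (Suc l)
    then show ?thesis using that[of l] partial_hom_polys[of g l] g by simp
  qed
  have sph: "(\<integral>x. (x \<bullet> x) ^ j * f x \<partial>sphere_measure) = (\<integral>x. f x \<partial>sphere_measure)"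
    for f :: "'a \<Rightarrow> real" and j
    by (intro Bochner_Integration.integral_cong) (auto simp: power2_norm_eq_inner[symmetric])
  \<comment> \<open>A power of \<open>x \<bullet> x\<close> raises the degree in the ball but equals
    1 on the sphere, so only the denominator changes.\<close>
  have Bh: "B (\<lambda>x. (x \<bullet> x) ^ j * f x) = v * D / (D + l + 2 * j) * (\<integral>x. f x \<partial>sphere_measure)"
    if "f \<in> hom_polys l" for f l j
    using integral_ball_hom_polys[OF hom_polys_power_inner_self_mult[OF that, of j]]
    by (simp add: B_def v_def D_def sph add.assoc)
  have Bint: "integrable lborel (\<lambda>x::'a. indicator (ball 0 1) x * f x)" if "real_polynomial_function f" for f
  proof -
    have "continuous_on (cball 0 1) f" using that by (rule poly_continuous_on)
    from continuous_on_compact_bounded[OF this compact_cball]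
    obtain L where "\<And>x. norm x \<le> 1 \<Longrightarrow> \<bar>f x\<bar> \<le> L"
      by (metis mem_cball_0)
    then show ?thesis
      by (intro integrable_on_ball[of _ _ L])
         (auto intro!: borel_measurable_continuous_onI poly_continuous_on that)
  qed
  define p where "p = partial b g"
  define q where "q x = (x \<bullet> b) * g x" for x
  have q: "q \<in> hom_polys (Suc k)" using g by (auto simp: q_def[abs_def])
  have pi: "integrable lborel (\<lambda>x::'a. indicator (ball 0 1) x * ((x \<bullet> x) ^ j * p x))" for j
    by (rule Bint, rule hom_polys_poly, rule hom_polys_power_inner_self_mult, unfold p_def, rule e)
  have qi: "integrable lborel (\<lambda>x::'a. indicator (ball 0 1) x * ((x \<bullet> x) ^ j * q x))" for j
    by (rule Bint, rule hom_polys_poly, rule hom_polys_power_inner_self_mult, rule q)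
  have "0 = (\<integral>x. indicator (ball 0 1) x * (partial b g x * (1 - x \<bullet> x)\<^sup>2 - 4 * (x \<bullet> b) * g x * (1 - x \<bullet> x)) \<partial>lborel)"
    using integral_ball_by_parts[OF hom_polys_poly[OF g] b] by simp
  also have "\<dots> = (\<integral>x. indicator (ball 0 1) x * ((x \<bullet> x) ^ 0 * p x)
      - 2 * (indicator (ball 0 1) x * ((x \<bullet> x) ^ 1 * p x))
      + indicator (ball 0 1) x * ((x \<bullet> x) ^ 2 * p x)
      - 4 * (indicator (ball 0 1) x * ((x \<bullet> x) ^ 0 * q x))
      + 4 * (indicator (ball 0 1) x * ((x \<bullet> x) ^ 1 * q x)) \<partial>lborel)"
    by (intro Bochner_Integration.integral_cong) (auto simp: power2_eq_square algebra_simps p_def q_def)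
  also have "\<dots> = B (\<lambda>x. (x \<bullet> x) ^ 0 * p x) - 2 * B (\<lambda>x. (x \<bullet> x) ^ 1 * p x)
      + B (\<lambda>x. (x \<bullet> x) ^ 2 * p x) - 4 * B (\<lambda>x. (x \<bullet> x) ^ 0 * q x) + 4 * B (\<lambda>x. (x \<bullet> x) ^ 1 * q x)"
    unfolding B_def
    by (simp only: Bochner_Integration.integral_add Bochner_Integration.integral_diff
        Bochner_Integration.integrable_add Bochner_Integration.integrable_diff
        integrable_mult_right integral_mult_right_zero pi qi)
  also have "\<dots> = v * D / (D + e) * I - 2 * (v * D / (D + e + 2) * I) + v * D / (D + e + 4) * I
      - 4 * (v * D / (D + k + 1) * J) + 4 * (v * D / (D + k + 3) * J)"
    unfolding Bh[OF e(1)[folded p_def]] Bh[OF q] by (simp add: I_def J_def p_def q_def[abs_def] add_ac)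
  also have "\<dots> = v * D / (D + k - 1) * I - 2 * (v * D / (D + k + 1) * I) + v * D / (D + k + 3) * I
      - 4 * (v * D / (D + k + 1) * J) + 4 * (v * D / (D + k + 3) * J)"
    using e(2)
  proof
    assume "real e = real k - 1"
    then have "D + e = D + k - 1" "D + e + 2 = D + k + 1" "D + e + 4 = D + k + 3" by linarith+
    then show ?thesis by (simp only:)
  qed simp
  \<comment> \<open>With N = D + k + 1, the coefficient of I is 1/(N - 2) - 2/N + 1/(N + 2) = 8/((N
    - 2) N (N + 2)), and that of J is -4/N + 4/(N + 2) = -8/(N (N + 2)), both times v D.\<close>
  also have "\<dots> = 8 * v * D / ((D + k - 1) * (D + k + 1) * (D + k + 3)) * (I - (D + k - 1) * J)"
    using Dk by (simp add: divide_simps) (simp add: algebra_simps)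
  finally have "I = (D + k - 1) * J"
    using v D Dk by simp
  then show ?thesis by (simp add: I_def J_def D_def)
qed

section \<open>Orthogonality and the addition theorem\<close>

lemma sphere_integral_one: "(\<integral>x. 1 \<partial>(sphere_measure :: 'a::euclidean_space measure)) = (1::real)"
  using sphere_integral_eq[of "\<lambda>x::'a. 1::real"] ball_emeasure(2)[where 'a='a]
  by simp

lemma sphere_integrable_poly:
  fixes p :: "'a::euclidean_space \<Rightarrow> real"
  shows "real_polynomial_function p \<Longrightarrow> integrable sphere_measure p"
  by (intro sphere_integrable poly_continuous_on)

definition harmonic_polys :: "nat \<Rightarrow> ('a::euclidean_space \<Rightarrow> real) set" where
  "harmonic_polys l = {p \<in> hom_polys l. \<forall>x. laplacian p x = 0}"

lemma spherical_harmonics_eq: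
  "spherical_harmonics l = {f. \<exists>p\<in>harmonic_polys l. \<forall>x\<in>sphere 0 1. f x = p x}"
  by (auto simp: spherical_harmonics_def harmonic_polys_def hom_polys_def)

lemma harmonic_poly: "p \<in> harmonic_polys l \<Longrightarrow> real_polynomial_function p"
  by (auto simp: harmonic_polys_def)

text \<open>\<open>sphere_divergence\<close> is applied to \<open>partial b p * q\<close>, of degree
  l - 1 + m, and summed over b. Harmonicity of p removes its second derivatives on the left, and
  Euler's identity produces the factor l on the right.\<close>

lemma harmonic_green:
  fixes p q :: "'a::euclidean_space \<Rightarrow> real"
  assumes p: "p \<in> harmonic_polys l" and q: "q \<in> hom_polys m"
  shows "(\<integral>x. (\<Sum>b\<in>Basis. partial b p x * partial b q x) \<partial>sphere_measure) =
    (real DIM('a) + real l + real m - 2) * (real l * (\<integral>x. p x * q x \<partial>sphere_measure))"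
proof (cases l)
  case 0
  then have "p \<in> hom_polys 0" using p by (simp add: harmonic_polys_def)
  then show ?thesis using 0 by (simp add: partial_hom_polys_0)
next
  case (Suc l')
  have hp: "p \<in> hom_polys l" using p by (simp add: harmonic_polys_def)
  note poly = hom_polys_poly[OF hp] hom_polys_poly[OF q]
  have h: "(\<lambda>x. partial b p x * q x) \<in> hom_polys (l' + m)" for b
    using partial_hom_polys[of p l' b] hp q Suc by auto
  have "(\<integral>x. (\<Sum>b\<in>Basis. partial b p x * partial b q x) \<partial>sphere_measure) =
      (\<integral>x. (\<Sum>b\<in>Basis. partial b (\<lambda>x. partial b p x * q x) x) \<partial>sphere_measure)"
  proof (rule Bochner_Integration.integral_cong)
    fix x :: 'a
    have "laplacian p x * q x = 0" using p by (simp add: harmonic_polys_def)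
    then show "(\<Sum>b\<in>Basis. partial b p x * partial b q x) =
        (\<Sum>b\<in>Basis. partial b (\<lambda>x. partial b p x * q x) x)"
      using poly by (simp add: partial_mult poly_partial sum.distrib laplacian_eq sum_distrib_right)
  qed simp
  also have "\<dots> = (\<Sum>b\<in>Basis. (\<integral>x. partial b (\<lambda>x. partial b p x * q x) x \<partial>sphere_measure))"
    using h by (intro Bochner_Integration.integral_sum sphere_integrable_poly) blast
  also have "\<dots> = (\<Sum>b\<in>Basis. (real DIM('a) + real (l' + m) - 1) *
      (\<integral>x. (x \<bullet> b) * (partial b p x * q x) \<partial>sphere_measure))"
    by (intro sum.cong refl sphere_divergence[OF h]) simp
  also have "\<dots> = (real DIM('a) + real (l' + m) - 1) *
      (\<integral>x. (\<Sum>b\<in>Basis. (x \<bullet> b) * (partial b p x * q x)) \<partial>sphere_measure)"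
  proof -
    have "integrable sphere_measure (\<lambda>x::'a. (x \<bullet> b) * (partial b p x * q x))" for b
      using hom_polys_inner_mult[OF h] by (intro sphere_integrable_poly) blast
    then show ?thesis by (subst Bochner_Integration.integral_sum) (auto simp: sum_distrib_left)
  qed
  also have "(\<lambda>x. \<Sum>b\<in>Basis. (x \<bullet> b) * (partial b p x * q x)) = (\<lambda>x. real l * (p x * q x))"
    using euler_identity[OF hp] by (simp add: sum_distrib_right[symmetric] mult.assoc[symmetric])
  finally have "(\<integral>x. (\<Sum>b\<in>Basis. partial b p x * partial b q x) \<partial>sphere_measure) =
      (real DIM('a) + real (l' + m) - 1) * (real l * (\<integral>x. p x * q x \<partial>sphere_measure))"
    by (simp only: integral_mult_right_zero)
  moreover have "real DIM('a) + real (l' + m) - 1 = real DIM('a) + real l + real m - 2"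
    using Suc by simp
  ultimately show ?thesis by (simp only:)
qed

text \<open>The left side of \<open>harmonic_green\<close> and the factor \<open>?c\<close> are
  symmetric in p and q, so l and m times the integral agree once \<open>?c\<close> is cancelled. It
  is positive because l + m \<ge> 1 and the dimension is at least 2.\<close>

lemma harmonic_orthogonal:
  fixes p q :: "'a::euclidean_space \<Rightarrow> real"
  assumes p: "p \<in> harmonic_polys l" and q: "q \<in> harmonic_polys m" and "l \<noteq> m" and D: "DIM('a) \<ge> 2"
  shows "(\<integral>x. p x * q x \<partial>sphere_measure) = 0"
proof -
  let ?I = "\<integral>x. p x * q x \<partial>sphere_measure" and ?c = "real DIM('a) + real l + real m - 2"
  have h: "p \<in> hom_polys l" "q \<in> hom_polys m"
    using p q by (auto simp: harmonic_polys_def)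
  have "?c * (real l * ?I) = ?c * (real m * ?I)"
    using harmonic_green[OF p h(2)] harmonic_green[OF q h(1)]
    by (simp add: mult.commute[of "q _"] mult.commute[of "partial _ q _"] add_ac)
  moreover have "?c > 0"
    using D \<open>l \<noteq> m\<close> by linarith
  ultimately show ?thesis using \<open>l \<noteq> m\<close> by simp
qed

section \<open>Rotation fields\<close>

definition rot_deriv :: "'a::euclidean_space \<Rightarrow> 'a \<Rightarrow> ('a \<Rightarrow> real) \<Rightarrow> 'a \<Rightarrow> real" where
  "rot_deriv a b p x = (x \<bullet> a) * partial b p x - (x \<bullet> b) * partial a p x"

lemma rot_deriv_mult:
  assumes "real_polynomial_function p" "real_polynomial_function q"
  shows "rot_deriv a b (\<lambda>x. p x * q x) x = rot_deriv a b p x * q x + p x * rot_deriv a b q x"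
  using assms by (simp add: rot_deriv_def partial_mult algebra_simps)

lemma rot_deriv_sum:
  assumes "finite I" "\<And>i. i \<in> I \<Longrightarrow> real_polynomial_function (p i)"
  shows "rot_deriv a b (\<lambda>x. \<Sum>i\<in>I. p i x) x = (\<Sum>i\<in>I. rot_deriv a b (p i) x)"
  using assms by (simp add: rot_deriv_def partial_sum sum_distrib_left sum_subtractf)

lemma rot_deriv_hom_polys:
  assumes "p \<in> hom_polys k"
  shows "rot_deriv a b p \<in> hom_polys k"
proof (cases k)
  case 0
  then have "rot_deriv a b p = (\<lambda>x. 0)"
    using assms by (simp add: rot_deriv_def[abs_def] partial_hom_polys_0)
  then show ?thesis by simp
next
  case (Suc j)
  then have "partial c p \<in> hom_polys j" for c
    using assms partial_hom_polys by blast
  then show ?thesis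
    unfolding rot_deriv_def[abs_def] Suc by (intro hom_polys_diff hom_polys_inner_mult)
qed

text \<open>The rotation derivative is a difference of partial derivatives of
  \<open>(x \<bullet> a) * p x\<close> and \<open>(x \<bullet> b) * p x\<close>.
  \<open>sphere_divergence\<close> sends both to the same multiple of the integral of
  \<open>(x \<bullet> a) * (x \<bullet> b) * p x\<close>.\<close>

lemma rot_deriv_integral:
  fixes p :: "'a::euclidean_space \<Rightarrow> real"
  assumes p: "p \<in> hom_polys k" and ab: "a \<in> Basis" "b \<in> Basis"
  shows "(\<integral>x. rot_deriv a b p x \<partial>sphere_measure) = 0"
proof -
  let ?A = "\<lambda>x. (x \<bullet> a) * p x" and ?B = "\<lambda>x. (x \<bullet> b) * p x"
  have h: "?A \<in> hom_polys (Suc k)" "?B \<in> hom_polys (Suc k)" using p by auto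
  have "rot_deriv a b p = (\<lambda>x. partial b ?A x - partial a ?B x)"
    using p ab by (simp add: fun_eq_iff rot_deriv_def partial_mult poly_inner hom_polys_poly inner_commute)
  then have "(\<integral>x. rot_deriv a b p x \<partial>sphere_measure) =
      (\<integral>x. partial b ?A x \<partial>sphere_measure) - (\<integral>x. partial a ?B x \<partial>sphere_measure)"
    using h by (simp add: Bochner_Integration.integral_diff sphere_integrable_poly hom_polys_poly poly_partial)
  also have "\<dots> = 0"
    using ab by (simp add: sphere_divergence[OF h(1)] sphere_divergence[OF h(2)] mult.left_commute)
  finally show ?thesis .
qed

lemma laplacian_inner_mult:
  assumes u: "real_polynomial_function u" and a: "a \<in> Basis"
  shows "laplacian (\<lambda>x. (x \<bullet> a) * u x) x = 2 * partial a u x + (x \<bullet> a) * laplacian u x"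
proof -
  have "(\<Sum>b\<in>Basis. (b \<bullet> a) * partial b u x) = partial a u x"
    using a by (simp add: inner_Basis if_distrib[of "\<lambda>t. t * _"] cong: if_cong)
  moreover have "laplacian (\<lambda>x. x \<bullet> a) = (\<lambda>x. 0)"
    by (simp add: laplacian_eq)
  ultimately show ?thesis using u by (simp add: laplacian_mult poly_inner)
qed

lemma laplacian_partial:
  assumes "real_polynomial_function p"
  shows "laplacian (partial b p) x = partial b (laplacian p) x"
  using assms unfolding laplacian_eq
  by (simp add: partial_sum poly_partial partial_commute[of _ b])

text \<open>The Laplacian of each half leaves twice the mixed derivative of p in the directions a
  and b, and these cancel in the difference.\<close>

lemma rot_deriv_harmonic:
  assumes p: "p \<in> harmonic_polys l" and ab: "a \<in> Basis" "b \<in> Basis"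
  shows "rot_deriv a b p \<in> harmonic_polys l"
proof -
  have poly: "real_polynomial_function p" using p by (rule harmonic_poly)
  have "laplacian p = (\<lambda>x. 0)" using p by (auto simp: harmonic_polys_def)
  then have "laplacian (rot_deriv a b p) x = 0" for x
    unfolding rot_deriv_def[abs_def] using poly ab
    by (simp add: laplacian_diff real_polynomial_function.intros poly_inner poly_partial
        laplacian_inner_mult laplacian_partial partial_commute[of p a b])
  then show ?thesis
    using p rot_deriv_hom_polys by (auto simp: harmonic_polys_def)
qed

text \<open>
  The rotation fields span the tangent spaces, so a homogeneous polynomial that they annihilate
  is, by Euler's identity, a multiple of a power of the norm.
\<close>

lemma rot_deriv_eq_0_imp_const:
  fixes G :: "'a::euclidean_space \<Rightarrow> real"
  assumes G: "G \<in> hom_polys (2 * l)" and D: "DIM('a) \<ge> 2"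
    and rot: "\<And>a b x. a \<in> Basis \<Longrightarrow> b \<in> Basis \<Longrightarrow> x \<in> sphere 0 1 \<Longrightarrow> rot_deriv a b G x = 0"
    and xy: "x \<in> sphere 0 1" "y \<in> sphere 0 1"
  shows "G x = G y"
proof -
  have rot': "rot_deriv a b G z = 0" if "a \<in> Basis" "b \<in> Basis" "z \<noteq> 0" for a b z
    using hom_polys_scale[OF rot_deriv_hom_polys[OF G], of a b "norm z" "z /\<^sub>R norm z"]
      rot[OF that(1,2), of "z /\<^sub>R norm z"] that(3) by simp
  \<comment> \<open>Vanishing of the rotation derivatives allows a and b to be exchanged in the sum
    over a, after which Euler's identity evaluates it: the gradient is radial.\<close>
  have grad: "(z \<bullet> z) * partial b G z = (z \<bullet> b) * (2 * real l * G z)" if "b \<in> Basis" "z \<noteq> 0" for b z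
  proof -
    have "(z \<bullet> z) * partial b G z = (\<Sum>a\<in>Basis. (z \<bullet> a) * ((z \<bullet> a) * partial b G z))"
      by (subst euclidean_inner) (simp add: sum_distrib_right mult.assoc)
    also have "\<dots> = (\<Sum>a\<in>Basis. (z \<bullet> a) * ((z \<bullet> b) * partial a G z))"
      using rot'[OF _ that] by (intro sum.cong refl) (simp add: rot_deriv_def)
    also have "\<dots> = (z \<bullet> b) * (\<Sum>a\<in>Basis. (z \<bullet> a) * partial a G z)"
      by (simp add: sum_distrib_left mult.left_commute)
    finally show ?thesis using euler_identity[OF G, of z] by simp
  qed
  have grad': "(z \<bullet> z) * partial h G z = (z \<bullet> h) * (2 * real l * G z)" if "z \<noteq> 0" for h z
  proof -
    note lin = has_derivative_linear[OF poly_has_derivative[OF hom_polys_poly[OF G], of z]]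
    have "partial (\<Sum>b\<in>Basis. (h \<bullet> b) *\<^sub>R b) G z = (\<Sum>b\<in>Basis. (h \<bullet> b) * partial b G z)"
      by (simp add: linear_sum[OF lin] linear_cmul[OF lin] del: euclidean_representation)
    then have "(z \<bullet> z) * partial h G z = (\<Sum>b\<in>Basis. (h \<bullet> b) * ((z \<bullet> z) * partial b G z))"
      by (simp add: euclidean_representation sum_distrib_left mult.left_commute)
    also have "\<dots> = (\<Sum>b\<in>Basis. (z \<bullet> b) * (h \<bullet> b)) * (2 * real l * G z)"
      unfolding sum_distrib_right by (intro sum.cong refl) (simp add: grad that mult_ac)
    finally show ?thesis by (simp add: euclidean_inner[symmetric])
  qed
  \<comment> \<open>Dividing by the norm to the power 2 l leaves degree 0, so the radial derivative
    vanishes too. The punctured space is connected because the dimension is at least 2.\<close>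
  define Q where "Q z = G z / (z \<bullet> z) ^ l" for z
  have "Q x = Q y"
  proof (rule has_derivative_zero_unique_connected[where f = Q and s = "- {0}" and x = x and y = y])
    show "open (- {0::'a})" by auto
    show "connected (- {0::'a})" using D by (rule connected_punctured_universe)
    fix z :: 'a assume "z \<in> - {0}"
    then have z: "z \<noteq> 0" "z \<bullet> z \<noteq> 0" by auto
    have 1: "((\<lambda>z. (z \<bullet> z) ^ l) has_derivative (\<lambda>h. real l * (z \<bullet> z) ^ (l - 1) * (2 * (z \<bullet> h)))) (at z)"
      by (auto intro!: derivative_eq_intros simp: inner_commute)
    have "(Q has_derivative (\<lambda>h. (partial h G z * (z \<bullet> z) ^ l -
        G z * (real l * (z \<bullet> z) ^ (l - 1) * (2 * (z \<bullet> h)))) / ((z \<bullet> z) ^ l * (z \<bullet> z) ^ l))) (at z)"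
      unfolding Q_def
      by (rule has_derivative_divide'[OF poly_has_derivative[OF hom_polys_poly[OF G]] 1]) (use z in simp)
    moreover have "partial h G z * (z \<bullet> z) ^ l - G z * (real l * (z \<bullet> z) ^ (l - 1) * (2 * (z \<bullet> h))) = 0" for h
    proof (cases l)
      case 0
      then show ?thesis using G by (simp add: partial_hom_polys_0)
    next
      case (Suc j)
      have "partial h G z * (z \<bullet> z) ^ l = (z \<bullet> z) ^ j * ((z \<bullet> z) * partial h G z)"
        by (simp add: Suc)
      then show ?thesis unfolding grad'[OF z(1)] by (simp add: Suc algebra_simps)
    qed
    ultimately show "(Q has_derivative (\<lambda>h. 0)) (at z)" by simp
  qed (use xy in auto)
  then show ?thesis using xy by (simp add: Q_def power2_norm_eq_inner[symmetric])
qed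

section \<open>The orthonormal basis and the addition theorem\<close>

locale sph_onb =
  fixes Z :: "nat \<Rightarrow> nat" and Y :: "nat \<Rightarrow> nat \<Rightarrow> 'a::euclidean_space \<Rightarrow> real"
  assumes onb: "sph_harm_onb Z Y" and DIM_ge_2: "DIM('a) \<ge> 2"
begin

text \<open>\<open>Y l k\<close> is arbitrary off the sphere and cannot be differentiated.
  \<open>H l k\<close> is a harmonic polynomial with the same restriction, on which all calculus is
  done.\<close>

definition H :: "nat \<Rightarrow> nat \<Rightarrow> 'a \<Rightarrow> real" where
  "H l k = (SOME p. p \<in> harmonic_polys l \<and> (\<forall>x\<in>sphere 0 1. Y l k x = p x))"

lemma H:
  assumes "k \<in> {1..Z l}"
  shows H_harmonic: "H l k \<in> harmonic_polys l"
    and Y_eq_H: "x \<in> sphere 0 1 \<Longrightarrow> Y l k x = H l k x"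
proof -
  have "Y l k \<in> spherical_harmonics l"
    using onb assms by (auto simp: sph_harm_onb_def)
  then have "\<exists>p. p \<in> harmonic_polys l \<and> (\<forall>x\<in>sphere 0 1. Y l k x = p x)"
    by (auto simp: spherical_harmonics_eq)
  from someI_ex[OF this] show "H l k \<in> harmonic_polys l"
    "x \<in> sphere 0 1 \<Longrightarrow> Y l k x = H l k x"
    by (auto simp: H_def)
qed

lemma H_hom: "k \<in> {1..Z l} \<Longrightarrow> H l k \<in> hom_polys l"
  using H_harmonic by (auto simp: harmonic_polys_def)

lemma H_poly: "k \<in> {1..Z l} \<Longrightarrow> real_polynomial_function (H l k)"
  by (rule hom_polys_poly[OF H_hom])

lemma H_continuous_on: "k \<in> {1..Z l} \<Longrightarrow> continuous_on S (H l k)"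
  by (rule poly_continuous_on[OF H_poly])

lemma H_orthonormal:
  assumes "k \<in> {1..Z l}" "k' \<in> {1..Z l'}"
  shows "(\<integral>x. H l k x * H l' k' x \<partial>sphere_measure) = (if (l, k) = (l', k') then 1 else 0)"
proof (cases "l = l'")
  case True
  have "(\<integral>x. H l k x * H l' k' x \<partial>sphere_measure) = (\<integral>x. Y l k x * Y l' k' x \<partial>sphere_measure)"
    by (intro Bochner_Integration.integral_cong) (use assms in \<open>auto simp: Y_eq_H\<close>)
  then show ?thesis using onb assms True by (auto simp: sph_harm_onb_def)
next
  case False
  then show ?thesis
    using harmonic_orthogonal[OF H_harmonic H_harmonic _ DIM_ge_2] assms by auto
qed

lemma harmonic_expansion:
  assumes p: "p \<in> harmonic_polys l"
  shows "\<exists>c. \<forall>x\<in>sphere 0 1. p x = (\<Sum>k = 1..Z l. c k * H l k x)"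
proof -
  have "p \<in> spherical_harmonics l" using p by (auto simp: spherical_harmonics_eq)
  then obtain c where "\<forall>x\<in>sphere 0 1. p x = (\<Sum>k = 1..Z l. c k * Y l k x)"
    using onb by (auto simp: sph_harm_onb_def) metis
  then show ?thesis by (intro exI[of _ c]) (auto intro!: sum.cong simp: Y_eq_H)
qed

lemma H_sum_integral:
  assumes f: "continuous_on (sphere 0 1) f"
    and fin: "finite I" "\<And>l k. (l, k) \<in> I \<Longrightarrow> k \<in> {1..Z l}"
  shows "(\<integral>x. f x * (\<Sum>(l, k)\<in>I. c l k * H l k x) \<partial>sphere_measure) =
    (\<Sum>(l, k)\<in>I. c l k * (\<integral>x. f x * H l k x \<partial>sphere_measure))"
proof -
  have int: "integrable sphere_measure (\<lambda>x. f x * H l k x)" if "(l, k) \<in> I" for l k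
    using fin(2)[OF that] by (intro sphere_integrable continuous_intros f H_continuous_on) auto
  have "(\<integral>x. f x * (\<Sum>(l, k)\<in>I. c l k * H l k x) \<partial>sphere_measure) =
      (\<integral>x. (\<Sum>i\<in>I. c (fst i) (snd i) * (f x * H (fst i) (snd i) x)) \<partial>sphere_measure)"
    by (simp add: sum_distrib_left case_prod_unfold mult.left_commute)
  also have "\<dots> = (\<Sum>i\<in>I. (\<integral>x. c (fst i) (snd i) * (f x * H (fst i) (snd i) x) \<partial>sphere_measure))"
    by (rule Bochner_Integration.integral_sum) (use int in auto)
  finally show ?thesis by (simp add: case_prod_unfold)
qed

lemma harmonic_expansion_coeff:
  assumes p: "p \<in> harmonic_polys l" and x: "x \<in> sphere 0 1"
  shows "p x = (\<Sum>k = 1..Z l. (\<integral>x. p x * H l k x \<partial>sphere_measure) * H l k x)"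
proof -
  obtain c where c: "\<And>x. x \<in> sphere 0 1 \<Longrightarrow> p x = (\<Sum>k = 1..Z l. c k * H l k x)"
    using harmonic_expansion[OF p] by blast
  have "(\<integral>x. p x * H l j x \<partial>sphere_measure) = c j" if j: "j \<in> {1..Z l}" for j
  proof -
    have "(\<integral>x. p x * H l j x \<partial>sphere_measure) =
        (\<integral>x. H l j x * (\<Sum>(l', k)\<in>{l} \<times> {1..Z l}. c k * H l' k x) \<partial>sphere_measure)"
      by (intro Bochner_Integration.integral_cong) (auto simp: c sum.cartesian_product[symmetric])
    also have "\<dots> = (\<Sum>(l', k)\<in>{l} \<times> {1..Z l}. c k * (\<integral>x. H l j x * H l' k x \<partial>sphere_measure))"
      using H_sum_integral[OF H_continuous_on[OF j], of "{l} \<times> {1..Z l}" "\<lambda>_ k. c k"] by auto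
    also have "\<dots> = (\<Sum>k\<in>{1..Z l}. c k * (if j = k then 1 else 0))"
      using j by (simp add: sum.cartesian_product[symmetric] H_orthonormal)
    also have "\<dots> = c j"
      using j by (simp add: if_distrib[of "\<lambda>t. _ * t"] sum.delta' cong: if_cong)
    finally show ?thesis .
  qed
  then show ?thesis using c[OF x] by simp
qed

text \<open>A rotation field maps the harmonics of degree l to themselves. Its matrix
  \<open>c\<close> in the orthonormal basis is antisymmetric, by the product rule and
  \<open>rot_deriv_integral\<close>. The derivative of \<open>G\<close> is twice the quadratic form
  \<open>S\<close> of this matrix, which vanishes. So \<open>G\<close> is constant on the sphere,
  and its mean value is the number of basis elements.\<close>

theorem addition_theorem:
  assumes x: "x \<in> sphere 0 1"
  shows "(\<Sum>k = 1..Z l. (H l k x)\<^sup>2) = real (Z l)"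
proof -
  define G where "G x = (\<Sum>k = 1..Z l. H l k x * H l k x)" for x
  have G: "G \<in> hom_polys (2 * l)"
    unfolding G_def[abs_def]
  proof (rule hom_polys_sum)
    show "(\<lambda>x. H l k x * H l k x) \<in> hom_polys (2 * l)" if "k \<in> {1..Z l}" for k
      using hom_polys_mult[OF H_hom[OF that] H_hom[OF that]] by (simp add: mult_2)
  qed simp
  have rot: "rot_deriv a b G z = 0" if ab: "a \<in> Basis" "b \<in> Basis" and z: "z \<in> sphere 0 1" for a b z
  proof -
    define c where "c k j = (\<integral>x. rot_deriv a b (H l k) x * H l j x \<partial>sphere_measure)" for k j
    have c: "c j k = - c k j" if kj: "k \<in> {1..Z l}" "j \<in> {1..Z l}" for k j
    proof -
      have R: "rot_deriv a b (H l i) \<in> hom_polys l" if "i \<in> {1..Z l}" for i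
        by (rule rot_deriv_hom_polys[OF H_hom[OF that]])
      have "(\<integral>x. rot_deriv a b (\<lambda>x. H l k x * H l j x) x \<partial>sphere_measure) = 0"
        by (rule rot_deriv_integral[OF hom_polys_mult ab]) (use kj H_hom in auto)
      moreover have "integrable sphere_measure (\<lambda>x. rot_deriv a b (H l k) x * H l j x)"
        "integrable sphere_measure (\<lambda>x. H l k x * rot_deriv a b (H l j) x)"
        using kj R
        by (auto intro!: sphere_integrable_poly real_polynomial_function.intros(4) H_poly intro: hom_polys_poly)
      ultimately have "c k j + (\<integral>x. H l k x * rot_deriv a b (H l j) x \<partial>sphere_measure) = 0"
        unfolding c_def using kj by (simp add: rot_deriv_mult H_poly)
      then show ?thesis by (simp add: c_def mult.commute)
    qed
    define S where "S = (\<Sum>k = 1..Z l. \<Sum>j = 1..Z l. c k j * (H l k z * H l j z))"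
    have "S = (\<Sum>j = 1..Z l. \<Sum>k = 1..Z l. c k j * (H l k z * H l j z))"
      unfolding S_def by (rule sum.swap)
    also have "\<dots> = (\<Sum>j = 1..Z l. \<Sum>k = 1..Z l. - (c j k * (H l j z * H l k z)))"
    proof (intro sum.cong refl)
      fix j k assume "j \<in> {1..Z l}" "k \<in> {1..Z l}"
      then have "c k j = - c j k" by (intro c)
      then show "c k j * (H l k z * H l j z) = - (c j k * (H l j z * H l k z))" by simp
    qed
    also have "\<dots> = - S" by (simp add: S_def sum_negf)
    finally have "S = 0" by simp
    have "rot_deriv a b G z = (\<Sum>k = 1..Z l. 2 * H l k z * rot_deriv a b (H l k) z)"
      unfolding G_def[abs_def]
      by (subst rot_deriv_sum) (auto simp: rot_deriv_mult H_poly real_polynomial_function.intros(4) intro!: sum.cong)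
    also have "\<dots> = (\<Sum>k = 1..Z l. 2 * H l k z * (\<Sum>j = 1..Z l. c k j * H l j z))"
      unfolding c_def
      by (intro sum.cong refl arg_cong2[where f = "(*)"] harmonic_expansion_coeff[OF _ z] rot_deriv_harmonic[OF H_harmonic] ab)
    also have "\<dots> = 2 * S" by (simp add: S_def sum_distrib_left mult_ac)
    finally show ?thesis using \<open>S = 0\<close> by simp
  qed
  have const: "G z = G x" if "z \<in> sphere 0 1" for z
    by (rule rot_deriv_eq_0_imp_const[OF G DIM_ge_2 rot that x])
  have "(\<integral>z. G z \<partial>sphere_measure) = (\<integral>z. G x * 1 \<partial>(sphere_measure :: 'a measure))"
    by (intro Bochner_Integration.integral_cong) (auto intro: const)
  also have "\<dots> = G x"
    unfolding integral_mult_right_zero sphere_integral_one by (rule mult_1_right)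
  finally have "G x = (\<integral>z. G z \<partial>sphere_measure)" ..
  also have "\<dots> = (\<Sum>k = 1..Z l. \<integral>z. H l k z * H l k z \<partial>sphere_measure)"
    unfolding G_def
    by (intro Bochner_Integration.integral_sum sphere_integrable_poly real_polynomial_function.intros(4) H_poly)
  also have "\<dots> = real (Z l)" by (simp add: H_orthonormal)
  finally show ?thesis by (simp add: G_def power2_eq_square)
qed

end

section \<open>Counting spherical harmonics\<close>

text \<open>Gaussian elimination: equation \<open>j0\<close> is solved for an unknown
  \<open>i0\<close> with nonzero coefficient, which leaves one equation and one unknown
  fewer.\<close>

lemma underdetermined_system:
  fixes a :: "'i \<Rightarrow> 'j \<Rightarrow> real"
  assumes "finite J" "finite I" "card J < card I"
  shows "\<exists>t. (\<exists>i\<in>I. t i \<noteq> 0) \<and> (\<forall>j\<in>J. (\<Sum>i\<in>I. t i * a i j) = 0)"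
  using assms
proof (induction J arbitrary: I a rule: finite_induct)
  case empty
  then obtain i where "i \<in> I" by fastforce
  then show ?case by (intro exI[of _ "\<lambda>_. 1"]) auto
next
  case (insert j0 J)
  show ?case
  proof (cases "\<forall>i\<in>I. a i j0 = 0")
    case True
    obtain t where "\<exists>i\<in>I. t i \<noteq> 0" "\<forall>j\<in>J. (\<Sum>i\<in>I. t i * a i j) = 0"
      using insert.IH[of I a] insert.prems insert.hyps by auto
    then show ?thesis using True by (intro exI[of _ t]) auto
  next
    case False
    then obtain i0 where i0: "i0 \<in> I" "a i0 j0 \<noteq> 0" by blast
    define b where "b i j = a i j - a i j0 / a i0 j0 * a i0 j" for i j
    obtain t where t: "\<exists>i\<in>I - {i0}. t i \<noteq> 0" "\<And>j. j \<in> J \<Longrightarrow> (\<Sum>i\<in>I - {i0}. t i * b i j) = 0"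
    proof -
      have "card J < card (I - {i0})" using insert.prems insert.hyps i0 by simp
      from insert.IH[OF _ this, of b] show ?thesis using that insert.prems by blast
    qed
    define s where "s = (\<Sum>i\<in>I - {i0}. t i * (a i j0 / a i0 j0))"
    define u where "u = t(i0 := - s)"
    have sum: "(\<Sum>i\<in>I. u i * a i j) = (\<Sum>i\<in>I - {i0}. t i * b i j)" for j
    proof -
      have "(\<Sum>i\<in>I. u i * a i j) = - s * a i0 j + (\<Sum>i\<in>I - {i0}. t i * a i j)"
        using i0 insert.prems by (simp add: sum.remove u_def)
      also have "\<dots> = (\<Sum>i\<in>I - {i0}. t i * b i j)"
        by (simp add: s_def b_def sum_distrib_right right_diff_distrib sum_subtractf mult.assoc)
      finally show ?thesis .
    qed
    have "(\<Sum>i\<in>I - {i0}. t i * b i j0) = 0" using i0 by (simp add: b_def)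
    then have "\<forall>j\<in>insert j0 J. (\<Sum>i\<in>I. u i * a i j) = 0"
      using t(2) sum by auto
    moreover have "\<exists>i\<in>I. u i \<noteq> 0" using t(1) by (auto simp: u_def)
    ultimately show ?thesis by blast
  qed
qed

text \<open>Equality is demanded on the sphere only. This allows \<open>x \<bullet> x\<close> to be
  replaced by 1.\<close>

definition sphere_span :: "'i set \<Rightarrow> ('i \<Rightarrow> 'a \<Rightarrow> real) \<Rightarrow> ('a::euclidean_space \<Rightarrow> real) set" where
  "sphere_span I m = {f. \<exists>c. \<forall>x\<in>sphere 0 1. f x = (\<Sum>i\<in>I. c i * m i x)}"

lemma sphere_span_cong:
  "g \<in> sphere_span I m \<Longrightarrow> (\<And>x. x \<in> sphere 0 1 \<Longrightarrow> f x = g x) \<Longrightarrow> f \<in> sphere_span I m"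
  by (auto simp: sphere_span_def)

lemma sphere_span_zero: "(\<lambda>x. 0) \<in> sphere_span I m"
  by (auto simp: sphere_span_def intro!: exI[of _ "\<lambda>_. 0"])

lemma sphere_span_base: "finite I \<Longrightarrow> i \<in> I \<Longrightarrow> m i \<in> sphere_span I m"
  by (auto simp: sphere_span_def sum.delta if_distrib[of "\<lambda>t. t * _"] intro!: exI[of _ "\<lambda>j. if j = i then 1 else 0"] cong: if_cong)

lemma sphere_span_add:
  assumes "f \<in> sphere_span I m" "g \<in> sphere_span I m"
  shows "(\<lambda>x. f x + g x) \<in> sphere_span I m"
proof -
  obtain c d where "\<forall>x\<in>sphere 0 1. f x = (\<Sum>i\<in>I. c i * m i x)" "\<forall>x\<in>sphere 0 1. g x = (\<Sum>i\<in>I. d i * m i x)"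
    using assms by (auto simp: sphere_span_def)
  then show ?thesis
    by (auto simp: sphere_span_def sum.distrib distrib_right intro!: exI[of _ "\<lambda>i. c i + d i"])
qed

lemma sphere_span_cmult:
  assumes "f \<in> sphere_span I m"
  shows "(\<lambda>x. a * f x) \<in> sphere_span I m"
proof -
  obtain c where "\<forall>x\<in>sphere 0 1. f x = (\<Sum>i\<in>I. c i * m i x)"
    using assms by (auto simp: sphere_span_def)
  then show ?thesis
    by (auto simp: sphere_span_def sum_distrib_left mult.assoc intro!: exI[of _ "\<lambda>i. a * c i"])
qed

lemma sphere_span_sum:
  assumes "finite K" "\<And>k. k \<in> K \<Longrightarrow> f k \<in> sphere_span I m"
  shows "(\<lambda>x. \<Sum>k\<in>K. f k x) \<in> sphere_span I m"
  using assms by (induction K) (auto simp: sphere_span_zero sphere_span_add)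

lemma sphere_span_mono:
  assumes "f \<in> sphere_span I m" "I \<subseteq> J" "finite J"
  shows "f \<in> sphere_span J m"
proof -
  obtain c where c: "\<forall>x\<in>sphere 0 1. f x = (\<Sum>i\<in>I. c i * m i x)"
    using assms by (auto simp: sphere_span_def)
  have "(\<Sum>i\<in>I. c i * m i x) = (\<Sum>i\<in>J. (if i \<in> I then c i else 0) * m i x)" for x
    using assms by (intro sum.mono_neutral_cong_left) auto
  then show ?thesis using c by (auto simp: sphere_span_def)
qed

text \<open>
  On the sphere the square of one coordinate \<open>e\<close> can be eliminated.  Multiplication by a
  coordinate then raises no exponent by more than two.
\<close>

definition reduced_indices :: "'a::euclidean_space \<Rightarrow> nat \<Rightarrow> (('a \<Rightarrow> nat) \<times> nat) set" where
  "reduced_indices e N = ((Basis - {e}) \<rightarrow>\<^sub>E {..2 * N}) \<times> {0, 1}"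

definition reduced_monomial :: "'a::euclidean_space \<Rightarrow> ('a \<Rightarrow> nat) \<times> nat \<Rightarrow> 'a \<Rightarrow> real" where
  "reduced_monomial e = (\<lambda>(\<alpha>, j) x. (\<Prod>b\<in>Basis - {e}. (x \<bullet> b) ^ \<alpha> b) * (x \<bullet> e) ^ j)"

lemma finite_reduced_indices: "finite (reduced_indices e N)"
  by (auto simp: reduced_indices_def intro!: finite_PiE)

lemma card_reduced_indices:
  "e \<in> Basis \<Longrightarrow> card (reduced_indices (e :: 'a::euclidean_space) N) = 2 * (2 * N + 1) ^ (DIM('a) - 1)"
  by (simp add: reduced_indices_def card_cartesian_product card_PiE)

lemma reduced_indices_mono: "k \<le> N \<Longrightarrow> reduced_indices e k \<subseteq> reduced_indices e N"
  by (auto simp: reduced_indices_def PiE_def Pi_def intro: order.trans)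

lemma reduced_monomial_upd:
  fixes x :: "'a::euclidean_space"
  assumes "b \<in> Basis - {e}"
  shows "reduced_monomial e (\<alpha>(b := \<alpha> b + i), j) x = (x \<bullet> b) ^ i * reduced_monomial e (\<alpha>, j) x"
proof -
  have "(\<Prod>c\<in>Basis - {e} - {b}. (x \<bullet> c) ^ (\<alpha>(b := \<alpha> b + i)) c) = (\<Prod>c\<in>Basis - {e} - {b}. (x \<bullet> c) ^ \<alpha> c)"
    by (intro prod.cong) auto
  then show ?thesis
    unfolding reduced_monomial_def
    using prod.remove[OF _ assms, of "\<lambda>c. (x \<bullet> c) ^ (\<alpha>(b := \<alpha> b + i)) c"]
      prod.remove[OF _ assms, of "\<lambda>c. (x \<bullet> c) ^ \<alpha> c"]
    by (simp add: power_add)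
qed

lemma reduced_span_inner_mult:
  fixes f :: "'a::euclidean_space \<Rightarrow> real"
  assumes f: "f \<in> sphere_span (reduced_indices e N) (reduced_monomial e)"
    and e: "e \<in> Basis" and b: "b \<in> Basis"
  shows "(\<lambda>x. (x \<bullet> b) * f x) \<in> sphere_span (reduced_indices e (Suc N)) (reduced_monomial e)"
    (is "_ \<in> ?S")
proof -
  let ?m = "reduced_monomial e"
  have base: "?m (\<alpha>, j) \<in> ?S" if "(\<alpha>, j) \<in> reduced_indices e (Suc N)" for \<alpha> j
    using that by (intro sphere_span_base finite_reduced_indices)
  have upd: "(\<lambda>x. (x \<bullet> c) ^ i * ?m (\<alpha>, j) x) \<in> ?S"
    if \<alpha>: "(\<alpha>, j) \<in> reduced_indices e N" and c: "c \<in> Basis - {e}" and i: "i \<le> 2" for \<alpha> j c i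
  proof -
    have "(\<alpha>(c := \<alpha> c + i), j) \<in> reduced_indices e (Suc N)"
      using \<alpha> c i by (auto simp: reduced_indices_def PiE_def Pi_def extensional_def le_Suc_eq)
    from base[OF this] show ?thesis
      by (rule sphere_span_cong) (simp add: reduced_monomial_upd[OF c])
  qed
  have mono: "(\<lambda>x. (x \<bullet> b) * ?m (\<alpha>, j) x) \<in> ?S" if \<alpha>: "(\<alpha>, j) \<in> reduced_indices e N" for \<alpha> j
  proof (cases "b = e")
    case False
    then show ?thesis using upd[OF \<alpha>, of b 1] b by simp
  next
    case True
    have \<alpha>0: "(\<alpha>, 0) \<in> reduced_indices e N" "(\<alpha>, 1) \<in> reduced_indices e N"
      using \<alpha> by (auto simp: reduced_indices_def)
    have sub: "reduced_indices e N \<subseteq> reduced_indices e (Suc N)" by (rule reduced_indices_mono) simp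
    consider "j = 0" | "j = 1" using \<alpha> by (auto simp: reduced_indices_def)
    then show ?thesis
    proof cases
      case 1
      have "?m (\<alpha>, 1) \<in> ?S" using base \<alpha>0 sub by blast
      then show ?thesis
        by (rule sphere_span_cong) (simp add: 1 True reduced_monomial_def)
    next
      case 2
      \<comment> \<open>The square of the coordinate e is traded for 1 minus the other squares. Each
        of these raises one other exponent by 2, for which the box of side 2 N has been
        chosen.\<close>
      have "(\<lambda>x. ?m (\<alpha>, 0) x + (\<Sum>c\<in>Basis - {e}. (- 1) * ((x \<bullet> c) ^ 2 * ?m (\<alpha>, 0) x))) \<in> ?S"
        using base[of \<alpha> 0] \<alpha>0 sub by (intro sphere_span_add sphere_span_sum sphere_span_cmult upd) auto
      then show ?thesis
      proof (rule sphere_span_cong)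
        fix x :: 'a assume "x \<in> sphere 0 1"
        then have "1 = (\<Sum>c\<in>Basis. (x \<bullet> c) ^ 2)"
          by (simp add: euclidean_inner[of x x, symmetric] power2_eq_square flip: power2_norm_eq_inner)
        also have "\<dots> = (x \<bullet> e) ^ 2 + (\<Sum>c\<in>Basis - {e}. (x \<bullet> c) ^ 2)"
          using e by (simp add: sum.remove)
        finally have *: "(x \<bullet> e) ^ 2 = 1 - (\<Sum>c\<in>Basis - {e}. (x \<bullet> c) ^ 2)" by simp
        have "(x \<bullet> b) * ?m (\<alpha>, j) x = (x \<bullet> e) ^ 2 * ?m (\<alpha>, 0) x"
          by (simp add: True 2 reduced_monomial_def power2_eq_square)
        also have "\<dots> = ?m (\<alpha>, 0) x + (\<Sum>c\<in>Basis - {e}. (- 1) * ((x \<bullet> c) ^ 2 * ?m (\<alpha>, 0) x))"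
          unfolding * by (simp add: left_diff_distrib sum_distrib_right sum_negf)
        finally show "(x \<bullet> b) * ?m (\<alpha>, j) x = \<dots>" .
      qed
    qed
  qed
  obtain c where c: "\<And>x. x \<in> sphere 0 1 \<Longrightarrow> f x = (\<Sum>i\<in>reduced_indices e N. c i * ?m i x)"
    using f by (auto simp: sphere_span_def)
  have "(\<lambda>x. \<Sum>i\<in>reduced_indices e N. c i * ((x \<bullet> b) * ?m i x)) \<in> ?S"
    using mono by (intro sphere_span_sum finite_reduced_indices sphere_span_cmult) (metis surj_pair)
  then show ?thesis
    by (rule sphere_span_cong) (simp add: c sum_distrib_left mult.left_commute)
qed

text \<open>Euler's identity writes p as a combination of coordinates times derivatives of lower
  degree, so the induction runs without expanding p into monomials.\<close>

lemma hom_polys_reduced_span: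
  fixes p :: "'a::euclidean_space \<Rightarrow> real"
  assumes e: "e \<in> Basis" and "p \<in> hom_polys k"
  shows "p \<in> sphere_span (reduced_indices e k) (reduced_monomial e)"
  using assms(2)
proof (induction k arbitrary: p)
  case 0
  let ?\<alpha> = "\<lambda>b\<in>Basis - {e}. 0::nat"
  have "reduced_monomial e (?\<alpha>, 0) \<in> sphere_span (reduced_indices e 0) (reduced_monomial e)"
    by (intro sphere_span_base finite_reduced_indices) (auto simp: reduced_indices_def)
  from sphere_span_cmult[OF this, of "p 0"] show ?case
    by (rule sphere_span_cong) (subst hom_polys_0D[OF 0], simp add: reduced_monomial_def)
next
  case (Suc k)
  have "(\<lambda>x. inverse (real (Suc k)) * (\<Sum>b\<in>Basis. (x \<bullet> b) * partial b p x))
      \<in> sphere_span (reduced_indices e (Suc k)) (reduced_monomial e)"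
    using Suc partial_hom_polys e
    by (intro sphere_span_cmult sphere_span_sum reduced_span_inner_mult) auto
  then show ?case
    by (rule sphere_span_cong) (simp add: euler_identity[OF Suc.prems])
qed

context sph_onb
begin

text \<open>The \<open>H l k\<close> with l \<le> N lie in the span of the reduced monomials. If
  there were more of them than monomials, a nontrivial combination would vanish on the sphere;
  pairing it with each \<open>H l0 k0\<close> shows that all its coefficients are zero. Eliminating
  one coordinate is what gives the exponent d = DIM - 1.\<close>

lemma sum_Z_le:
  "(\<Sum>l\<le>N. Z l) \<le> 2 * (2 * N + 1) ^ (DIM('a) - 1)"
proof (rule ccontr)
  assume neg: "\<not> ?thesis"
  obtain e :: 'a where e: "e \<in> Basis" using nonempty_Basis by blast
  define I where "I = Sigma {..N} (\<lambda>l. {1..Z l})"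
  let ?J = "reduced_indices e N" and ?m = "reduced_monomial e"
  have fin: "finite I" by (simp add: I_def)
  have I: "k \<in> {1..Z l}" if "(l, k) \<in> I" for l k using that by (simp add: I_def)
  have "card ?J < card I"
    using neg e by (simp add: card_reduced_indices I_def)
  have "\<exists>c. \<forall>x\<in>sphere 0 1. H (fst i) (snd i) x = (\<Sum>j\<in>?J. c j * ?m j x)" if "i \<in> I" for i
  proof -
    have i: "snd i \<in> {1..Z (fst i)}" "fst i \<le> N" using that by (auto simp: I_def)
    show ?thesis
      using sphere_span_mono[OF hom_polys_reduced_span[OF e H_hom[OF i(1)]] reduced_indices_mono[OF i(2)] finite_reduced_indices]
      by (simp add: sphere_span_def)
  qed
  then obtain a where a: "\<And>i x. i \<in> I \<Longrightarrow> x \<in> sphere 0 1 \<Longrightarrow> H (fst i) (snd i) x = (\<Sum>j\<in>?J. a i j * ?m j x)"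
    by metis
  obtain t where t: "\<exists>i\<in>I. t i \<noteq> 0" "\<And>j. j \<in> ?J \<Longrightarrow> (\<Sum>i\<in>I. t i * a i j) = 0"
    using underdetermined_system[OF finite_reduced_indices fin \<open>card ?J < card I\<close>, of a] by blast
  have zero: "(\<Sum>i\<in>I. t i * H (fst i) (snd i) x) = 0" if x: "x \<in> sphere 0 1" for x
  proof -
    have "(\<Sum>i\<in>I. t i * H (fst i) (snd i) x) = (\<Sum>i\<in>I. \<Sum>j\<in>?J. t i * a i j * ?m j x)"
      using a[OF _ x] by (simp add: sum_distrib_left mult.assoc)
    also have "\<dots> = (\<Sum>j\<in>?J. (\<Sum>i\<in>I. t i * a i j) * ?m j x)"
      by (subst sum.swap) (simp add: sum_distrib_right)
    finally show ?thesis using t(2) by simp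
  qed
  have "t (l0, k0) = 0" if i0: "(l0, k0) \<in> I" for l0 k0
  proof -
    have "0 = (\<integral>x. H l0 k0 x * (\<Sum>(l, k)\<in>I. t (l, k) * H l k x) \<partial>sphere_measure)"
      using zero by (subst Bochner_Integration.integral_cong[OF refl, of _ _ "\<lambda>x. 0"]) (auto simp: case_prod_unfold)
    also have "\<dots> = (\<Sum>(l, k)\<in>I. t (l, k) * (\<integral>x. H l0 k0 x * H l k x \<partial>sphere_measure))"
      by (rule H_sum_integral[OF H_continuous_on[OF I[OF i0]] fin]) (rule I)
    also have "\<dots> = (\<Sum>i\<in>I. t i * (if i = (l0, k0) then 1 else 0))"
    proof (intro sum.cong refl)
      fix i assume i: "i \<in> I"
      obtain l k where lk: "i = (l, k)" by force
      have "(\<integral>x. H l0 k0 x * H l k x \<partial>sphere_measure) = (if i = (l0, k0) then 1 else 0)"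
        using H_orthonormal[OF I[OF i0] I[OF i[unfolded lk]]] by (simp add: lk eq_commute)
      then show "(case i of (l, k) \<Rightarrow> t (l, k) * (\<integral>x. H l0 k0 x * H l k x \<partial>sphere_measure)) =
          t i * (if i = (l0, k0) then 1 else 0)"
        by (simp add: lk)
    qed
    also have "\<dots> = t (l0, k0)"
      using fin i0 by (simp add: if_distrib[of "\<lambda>t. _ * t"] sum.delta cong: if_cong)
    finally show ?thesis by simp
  qed
  then show False using t(1) by auto
qed

section \<open>Completeness\<close>

text \<open>On the sphere these are the polynomials of degree at most N. The definition supplies the
  degree that \<open>real_polynomial_function\<close> does not carry.\<close>

definition H_span :: "nat \<Rightarrow> ('a \<Rightarrow> real) set" where
  "H_span N = sphere_span (Sigma {..N} (\<lambda>l. {1..Z l})) (\<lambda>(l, k). H l k)"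

lemma H_span_mono: "f \<in> H_span M \<Longrightarrow> M \<le> N \<Longrightarrow> f \<in> H_span N"
  unfolding H_span_def by (erule sphere_span_mono) auto

text \<open>On the sphere the decomposition of p reads p = h + q with h harmonic and q of degree k -
  2, to which the induction applies.\<close>

lemma hom_polys_H_span:
  "p \<in> hom_polys k \<Longrightarrow> p \<in> H_span k"
proof (induction k arbitrary: p rule: less_induct)
  case (less k)
  obtain h q where hq: "h \<in> hom_polys k" "q \<in> hom_polys (k - 2)" "\<And>x. laplacian h x = 0"
    "\<And>x. p x = h x + (x \<bullet> x) * q x" "k < 2 \<Longrightarrow> q = (\<lambda>x. 0)"
    using hom_polys_decomposition[OF less.prems] by blast
  have "h \<in> H_span k"
  proof -
    obtain c where "\<And>x. x \<in> sphere 0 1 \<Longrightarrow> h x = (\<Sum>j = 1..Z k. c j * H k j x)"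
      using harmonic_expansion[of h k] hq by (auto simp: harmonic_polys_def)
    moreover have "(\<lambda>x. \<Sum>j = 1..Z k. c j * H k j x) \<in> H_span k"
      unfolding H_span_def
    proof (intro sphere_span_sum sphere_span_cmult)
      fix j assume "j \<in> {1..Z k}"
      then show "H k j \<in> sphere_span (Sigma {..k} (\<lambda>l. {1..Z l})) (\<lambda>(l, k). H l k)"
        using sphere_span_base[of "Sigma {..k} (\<lambda>l. {1..Z l})" "(k, j)" "\<lambda>(l, k). H l k"] by simp
    qed simp
    ultimately show ?thesis unfolding H_span_def by (rule sphere_span_cong[rotated])
  qed
  moreover have "q \<in> H_span k"
  proof (cases "k < 2")
    case True
    then show ?thesis using hq(5) by (simp add: H_span_def sphere_span_zero)
  next
    case False
    then show ?thesis using less.IH[OF _ hq(2)] H_span_mono[of q "k - 2" k] by simp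
  qed
  ultimately have "(\<lambda>x. h x + q x) \<in> H_span k"
    unfolding H_span_def by (rule sphere_span_add)
  then show ?case
    unfolding H_span_def by (rule sphere_span_cong) (simp add: hq(4) power2_norm_eq_inner[symmetric])
qed

text \<open>A product of two basis polynomials is homogeneous of the sum of the degrees, so
  \<open>hom_polys_H_span\<close> applies to it.\<close>

lemma H_span_mult:
  assumes f: "f \<in> H_span M" and g: "g \<in> H_span N"
  shows "(\<lambda>x. f x * g x) \<in> H_span (M + N)"
proof -
  let ?I = "\<lambda>N. Sigma {..N} (\<lambda>l. {1..Z l})" and ?h = "\<lambda>i. H (fst i) (snd i)"
  obtain c d where c: "\<And>x. x \<in> sphere 0 1 \<Longrightarrow> f x = (\<Sum>i\<in>?I M. c i * ?h i x)"
    and d: "\<And>x. x \<in> sphere 0 1 \<Longrightarrow> g x = (\<Sum>i\<in>?I N. d i * ?h i x)"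
    using f g by (auto simp: H_span_def sphere_span_def case_prod_unfold)
  have "(\<lambda>x. ?h i x * ?h j x) \<in> H_span (M + N)" if "i \<in> ?I M" "j \<in> ?I N" for i j
    by (rule H_span_mono[OF hom_polys_H_span[OF hom_polys_mult[OF H_hom H_hom]]]) (use that in auto)
  then have "(\<lambda>x. \<Sum>i\<in>?I M. \<Sum>j\<in>?I N. c i * (d j * (?h i x * ?h j x))) \<in> H_span (M + N)"
    unfolding H_span_def by (intro sphere_span_sum sphere_span_cmult) auto
  then show ?thesis
    unfolding H_span_def
    by (rule sphere_span_cong) (simp add: c d sum_product mult_ac)
qed

lemma poly_H_span:
  "real_polynomial_function p \<Longrightarrow> \<exists>N. p \<in> H_span N"
proof (induction p rule: real_polynomial_function.induct)
  case (linear f)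
  then have "f \<in> hom_polys 1"
    by (intro hom_polysI real_polynomial_function.intros) (simp_all add: linear_cmul bounded_linear.linear)
  then show ?case using hom_polys_H_span by blast
next
  case (const c)
  then show ?case using hom_polys_H_span hom_polys_const by blast
next
  case (add f g)
  then obtain M N where "f \<in> H_span M" "g \<in> H_span N" by blast
  then have "f \<in> H_span (max M N)" "g \<in> H_span (max M N)" by (auto elim: H_span_mono)
  then show ?case unfolding H_span_def using sphere_span_add by blast
next
  case (mult f g)
  then show ?case using H_span_mult by blast
qed

text \<open>The integral is transferred to the ball. There the radial extension of h vanishes almost
  everywhere, while the set where it is nonzero, the origin removed, is open.\<close>

lemma sphere_integral_sq_eq_0:
  fixes h :: "'a \<Rightarrow> real"
  assumes h: "continuous_on (sphere 0 1) h" and 0: "(\<integral>x. h x * h x \<partial>sphere_measure) = 0"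
    and x: "x \<in> sphere 0 1"
  shows "h x = 0"
proof (rule ccontr)
  assume "h x \<noteq> 0"
  let ?g = "\<lambda>x. h (x /\<^sub>R norm x)"
  have h2: "continuous_on (sphere 0 1) (\<lambda>x. h x * h x)" by (intro continuous_intros h)
  obtain B where B: "\<And>x. x \<in> sphere 0 1 \<Longrightarrow> \<bar>h x * h x\<bar> \<le> B"
    using continuous_on_compact_bounded[OF h2] by auto
  have "(\<integral>x. indicator (ball 0 1) x * (?g x * ?g x) \<partial>lborel) = 0"
    using 0 ball_emeasure(2)[where 'a='a] unfolding sphere_integral_eq[OF h2] by simp
  moreover have "integrable lborel (\<lambda>x. indicator (ball 0 1) x * (?g x * ?g x))"
  proof (rule integrable_on_ball)
    show "(\<lambda>x. ?g x * ?g x) \<in> borel_measurable borel" by (rule radial_measurable[OF h2])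
    \<comment> \<open>At the origin the radial extension has the value \<open>h 0\<close>, about
      which \<open>B\<close> says nothing.\<close>
    show "\<bar>?g x * ?g x\<bar> \<le> max B \<bar>h 0 * h 0\<bar>" for x
      using B[of "x /\<^sub>R norm x"] by (cases "x = 0") (auto simp: le_max_iff_disj)
  qed
  ultimately have AE: "AE x in lborel. indicator (ball 0 1) x * (?g x * ?g x) = 0"
    by (subst (asm) integral_nonneg_eq_0_iff_AE) auto
  define U where "U = {y \<in> ball 0 1 - {0}. ?g y \<noteq> 0}"
  have "open U"
  proof -
    have "continuous_on (ball 0 1 - {0}) ?g"
    proof (rule continuous_on_compose2[OF h])
      show "continuous_on (ball 0 1 - {0}) (\<lambda>x::'a. x /\<^sub>R norm x)"
        by (intro continuous_intros) auto
    qed (auto simp: field_simps split: if_splits)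
    then have "open ((ball 0 1 - {0}) \<inter> ?g -` (- {0}))"
      by (rule continuous_open_preimage) auto
    also have "(ball 0 1 - {0}) \<inter> ?g -` (- {0}) = U" by (auto simp: U_def)
    finally show ?thesis .
  qed
  have "AE x in lborel. x \<notin> U"
    using AE by eventually_elim (auto simp: U_def)
  then have "U \<in> null_sets lborel"
    using \<open>open U\<close> by (subst (asm) AE_iff_null_sets[symmetric]) auto
  then have "U = {}" using \<open>open U\<close> open_not_negligible negligible_iff_null_sets null_sets_completionI by blast
  \<comment> \<open>This point lies in the open ball away from the origin and is projected to
    x.\<close>
  moreover have "(1 / 2) *\<^sub>R x \<in> U"
    using x \<open>h x \<noteq> 0\<close> by (auto simp: U_def)
  ultimately show False by blast
qed

text \<open>By Stone-Weierstrass a polynomial p approximates h uniformly. It lies in some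
  \<open>H_span N\<close>, hence is orthogonal to h, and the integral of h h equals that of h (h -
  p), which is arbitrarily small.\<close>

lemma H_complete:
  assumes h: "continuous_on (sphere 0 1) h"
    and orth: "\<And>l k. k \<in> {1..Z l} \<Longrightarrow> (\<integral>x. h x * H l k x \<partial>sphere_measure) = 0"
    and x: "x \<in> sphere 0 1"
  shows "h x = 0"
proof -
  define A where "A = (\<integral>x. \<bar>h x\<bar> \<partial>sphere_measure)"
  have A: "A \<ge> 0" by (simp add: A_def)
  have "(\<integral>x. h x * h x \<partial>sphere_measure) \<le> 0 + e" if e: "e > 0" for e
  proof -
    \<comment> \<open>The 1 keeps the tolerance meaningful when the integral \<open>A\<close> of the
      modulus of h is zero.\<close>
    have "e / (A + 1) > 0" using A e by simp
    from Stone_Weierstrass_real_polynomial_function[OF compact_sphere h this]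
    obtain p where p: "real_polynomial_function p"
      "\<And>x. x \<in> sphere 0 1 \<Longrightarrow> \<bar>h x - p x\<bar> < e / (A + 1)"
      by blast
    obtain N where N: "p \<in> H_span N" using poly_H_span[OF p(1)] by blast
    have p0: "(\<integral>x. h x * p x \<partial>sphere_measure) = 0"
    proof -
      let ?I = "Sigma {..N} (\<lambda>l. {1..Z l})"
      obtain c where c: "\<And>x. x \<in> sphere 0 1 \<Longrightarrow> p x = (\<Sum>(l, k)\<in>?I. c (l, k) * H l k x)"
        using N by (auto simp: H_span_def sphere_span_def case_prod_unfold)
      have "(\<integral>x. h x * p x \<partial>sphere_measure) =
          (\<integral>x. h x * (\<Sum>(l, k)\<in>?I. c (l, k) * H l k x) \<partial>sphere_measure)"
        by (intro Bochner_Integration.integral_cong) (auto simp: c)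
      also have "\<dots> = (\<Sum>(l, k)\<in>?I. c (l, k) * (\<integral>x. h x * H l k x \<partial>sphere_measure))"
        by (rule H_sum_integral[OF h]) auto
      also have "\<dots> = 0" by (rule sum.neutral) (auto simp: orth)
      finally show ?thesis .
    qed
    have int: "integrable sphere_measure (\<lambda>x. h x * h x)" "integrable sphere_measure (\<lambda>x. h x * p x)"
      "integrable sphere_measure (\<lambda>x. \<bar>h x\<bar>)"
      by (intro sphere_integrable continuous_intros h poly_continuous_on p(1))+
    have "(\<integral>x. h x * h x \<partial>sphere_measure) = (\<integral>x. h x * h x - h x * p x \<partial>sphere_measure)"
      using int p0 by simp
    also have "\<dots> \<le> (\<integral>x. e / (A + 1) * \<bar>h x\<bar> \<partial>sphere_measure)"
    proof (rule Bochner_Integration.integral_mono)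
      fix x :: 'a assume "x \<in> space sphere_measure"
      then have "\<bar>h x\<bar> * \<bar>h x - p x\<bar> \<le> \<bar>h x\<bar> * (e / (A + 1))"
        using p(2)[of x] by (intro mult_left_mono) auto
      moreover have "h x * h x - h x * p x \<le> \<bar>h x\<bar> * \<bar>h x - p x\<bar>"
        unfolding abs_mult[symmetric] right_diff_distrib[symmetric] by (rule abs_ge_self)
      ultimately show "h x * h x - h x * p x \<le> e / (A + 1) * \<bar>h x\<bar>"
        by (simp add: mult.commute)
    qed (use int in auto)
    also have "\<dots> = e * (A / (A + 1))" by (simp add: A_def)
    also have "\<dots> \<le> e * 1" using A that by (intro mult_left_mono) auto
    finally show ?thesis by simp
  qed
  then have "(\<integral>x. h x * h x \<partial>sphere_measure) \<le> 0" by (rule field_le_epsilon)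
  moreover have "(\<integral>x. h x * h x \<partial>sphere_measure) \<ge> 0" by (rule Bochner_Integration.integral_nonneg) auto
  ultimately show ?thesis using sphere_integral_sq_eq_0[OF h _ x] by linarith
qed

end

section \<open>The sampling error on polynomials\<close>

lemma suminf_ennreal_le_iff:
  assumes "\<And>i. 0 \<le> f i" "0 \<le> B"
  shows "(\<Sum>i. ennreal (f i)) \<le> ennreal B \<longleftrightarrow> (\<forall>N. (\<Sum>i<N. f i) \<le> B)"
  unfolding suminf_eq_SUP SUP_le_iff using assms by (simp add: sum_ennreal)

text \<open>All later estimates are made on real partial sums. A common bound for them also excludes
  the value infinity.\<close>

lemma sobolev_norm_le_iff:
  fixes Y :: "nat \<Rightarrow> nat \<Rightarrow> 'a::euclidean_space \<Rightarrow> real"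
  assumes B: "0 \<le> B"
  shows "sobolev_norm Z Y s u \<le> ennreal B \<longleftrightarrow>
    (\<forall>N. (\<Sum>l<N. (1 + sphere_eigenvalue (DIM('a) - 1) l) powr s * (\<Sum>k = 1..Z l. (u (Y l k))\<^sup>2)) \<le> B\<^sup>2)"
proof -
  have "sobolev_norm Z Y s u \<le> ennreal B \<longleftrightarrow> sobolev_norm_sq Z Y s u \<le> ennreal (B\<^sup>2)"
  proof (cases "sobolev_norm_sq Z Y s u")
    case (real r)
    then show ?thesis using B by (simp add: sobolev_norm_def real_sqrt_le_iff' sqrt_le_D real_le_lsqrt ennreal_le_iff)
  next
    case top
    then show ?thesis by (simp add: sobolev_norm_def top_unique)
  qed
  also have "\<dots> \<longleftrightarrow> (\<forall>N. (\<Sum>l<N. (1 + sphere_eigenvalue (DIM('a) - 1) l) powr s *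
      (\<Sum>k = 1..Z l. (u (Y l k))\<^sup>2)) \<le> B\<^sup>2)"
    unfolding sobolev_norm_sq_def power2_abs
    by (intro suminf_ennreal_le_iff mult_nonneg_nonneg sum_nonneg) auto
  finally show ?thesis .
qed

lemma power2_powr: "(x powr a)\<^sup>2 = x powr (2 * a)" for x a :: real
  by (simp add: power2_eq_square powr_add[symmetric])

lemma powr_diff_le:
  fixes x a :: real
  assumes x: "x \<ge> 1" and a: "a > 0"
  shows "x powr (- a) - (x + 1) powr (- a) \<le> a * x powr (- a - 1)"
proof -
  have "\<exists>z>x. z < x + 1 \<and> (x + 1) powr (- a) - x powr (- a) = (x + 1 - x) * (- a * z powr (- a - 1))"
    using x by (intro MVT2) (auto intro!: derivative_eq_intros)
  then obtain z where z: "x < z" "z < x + 1"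
    "(x + 1) powr (- a) - x powr (- a) = (x + 1 - x) * (- a * z powr (- a - 1))"
    by blast
  have "z powr (- a - 1) \<le> x powr (- a - 1)"
    using z x a by (intro powr_mono2') auto
  then have "a * z powr (- a - 1) \<le> a * x powr (- a - 1)" using a by simp
  moreover from z(3) have "(x + 1) powr (- a) - x powr (- a) = - (a * z powr (- a - 1))" by simp
  ultimately show ?thesis by linarith
qed

lemma summation_by_parts:
  fixes a z :: "nat \<Rightarrow> real"
  shows "(\<Sum>l\<le>N. a l * z l) = a N * (\<Sum>i\<le>N. z i) + (\<Sum>l<N. (a l - a (Suc l)) * (\<Sum>i\<le>l. z i))"
  by (induction N) (auto simp: algebra_simps)

text \<open>A termwise bound from the cumulative hypothesis would lose a power. Partial summation
  moves the difference onto the weights, which gains a factor 1/(1 + l) by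
  \<open>powr_diff_le\<close>; the resulting exponent e - a - 1 is summable.\<close>

lemma weighted_sum_bounded:
  fixes z :: "nat \<Rightarrow> real"
  assumes z: "\<And>l. 0 \<le> z l" "\<And>N. (\<Sum>l\<le>N. z l) \<le> C * (1 + real N) powr e"
    and C: "0 \<le> C" and ea: "0 \<le> e" "e < a"
  shows "\<exists>S. \<forall>N. (\<Sum>l<N. (1 + real l) powr (- a) * z l) \<le> S"
proof -
  have a: "a > 0" using ea by linarith
  have "summable (\<lambda>l. (1 + real l) powr (e - a - 1))"
    using ea summable_Suc_iff[of "\<lambda>l. real l powr (e - a - 1)"]
    by (simp add: summable_real_powr_iff)
  then have sm: "summable (\<lambda>l. a * C * (1 + real l) powr (e - a - 1))" by (rule summable_mult)
  \<comment> \<open>\<open>C\<close> bounds the boundary term of the partial summation, since e - a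
    < 0; the series bounds the sum of differences.\<close>
  let ?S = "C + (\<Sum>l. a * C * (1 + real l) powr (e - a - 1))"
  have "(\<Sum>l\<le>N. (1 + real l) powr (- a) * z l) \<le> ?S" for N
  proof -
    have "(1 + real N) powr (- a) * (\<Sum>i\<le>N. z i) \<le> (1 + real N) powr (- a) * (C * (1 + real N) powr e)"
      by (intro mult_left_mono z(2)) simp
    also have "\<dots> = C * (1 + real N) powr (e - a)"
      by (simp add: powr_add[symmetric])
    also have "\<dots> \<le> C * 1"
      using powr_mono[of "e - a" 0 "1 + real N"] ea C by (intro mult_left_mono) auto
    finally have 1: "(1 + real N) powr (- a) * (\<Sum>i\<le>N. z i) \<le> C" by simp
    have "((1 + real l) powr (- a) - (1 + real (Suc l)) powr (- a)) * (\<Sum>i\<le>l. z i)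
        \<le> a * C * (1 + real l) powr (e - a - 1)" for l
    proof -
      have "((1 + real l) powr (- a) - (1 + real (Suc l)) powr (- a)) * (\<Sum>i\<le>l. z i) \<le>
          (a * (1 + real l) powr (- a - 1)) * (C * (1 + real l) powr e)"
        using powr_diff_le[of "1 + real l" a] a z C
        by (intro mult_mono) (auto simp: add_ac intro: sum_nonneg)
      also have "\<dots> = a * C * ((1 + real l) powr (- a - 1) * (1 + real l) powr e)"
        by simp
      also have "\<dots> = a * C * (1 + real l) powr (e - a - 1)"
        unfolding powr_add[symmetric] by (simp add: algebra_simps)
      finally show ?thesis .
    qed
    then have "(\<Sum>l<N. ((1 + real l) powr (- a) - (1 + real (Suc l)) powr (- a)) * (\<Sum>i\<le>l. z i))
        \<le> (\<Sum>l<N. a * C * (1 + real l) powr (e - a - 1))"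
      by (intro sum_mono)
    also have "\<dots> \<le> (\<Sum>l. a * C * (1 + real l) powr (e - a - 1))"
      by (rule sum_le_suminf[OF sm]) (use a C in auto)
    finally show ?thesis
      unfolding summation_by_parts using 1 by linarith
  qed
  moreover have "(\<Sum>l<N. (1 + real l) powr (- a) * z l) \<le> (\<Sum>l\<le>N. (1 + real l) powr (- a) * z l)" for N
    by (rule sum_mono2) (use z in auto)
  ultimately have "(\<Sum>l<N. (1 + real l) powr (- a) * z l) \<le> ?S" for N
    by (rule order.trans[rotated])
  then show ?thesis by blast
qed

lemma sampling_error_cong:
  assumes "\<And>x. x \<in> sphere 0 1 \<Longrightarrow> f x = g x" "\<And>j. j \<in> {1..m} \<Longrightarrow> X j \<in> sphere 0 1"
  shows "sampling_error m X w f = sampling_error m X w g"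
  unfolding sampling_error_def
  by (intro arg_cong2[where f = "(-)"] sum.cong Bochner_Integration.integral_cong) (use assms in auto)

lemma sampling_error_sum:
  assumes "\<And>i. i \<in> I \<Longrightarrow> continuous_on (sphere 0 1) (g i)"
  shows "sampling_error m X w (\<lambda>x. \<Sum>i\<in>I. c i * g i x) = (\<Sum>i\<in>I. c i * sampling_error m X w (g i))"
proof -
  have "(\<integral>x. (\<Sum>i\<in>I. c i * g i x) \<partial>sphere_measure) = (\<Sum>i\<in>I. c i * (\<integral>x. g i x \<partial>sphere_measure))"
    using assms by (subst Bochner_Integration.integral_sum) (auto intro!: sphere_integrable integrable_mult_right)
  moreover have "(\<Sum>j = 1..m. w j * (\<Sum>i\<in>I. c i * g i (X j))) = (\<Sum>i\<in>I. c i * (\<Sum>j = 1..m. w j * g i (X j)))"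
    unfolding sum_distrib_left by (subst sum.swap) (simp add: mult.left_commute)
  ultimately show ?thesis
    by (simp add: sampling_error_def right_diff_distrib sum_subtractf)
qed

context sph_onb
begin

section \<open>Sobolev weights and finite expansions\<close>

definition lam :: "nat \<Rightarrow> real" where
  "lam l = 1 + sphere_eigenvalue (DIM('a) - 1) l"

definition coeff :: "('a \<Rightarrow> real) \<Rightarrow> nat \<Rightarrow> nat \<Rightarrow> real" where
  "coeff f l k = (\<integral>x. f x * H l k x \<partial>sphere_measure)"

definition proj :: "('a \<Rightarrow> real) \<Rightarrow> nat \<Rightarrow> 'a \<Rightarrow> real" where
  "proj f l x = (\<Sum>k = 1..Z l. coeff f l k * H l k x)"

definition proj_norm :: "('a \<Rightarrow> real) \<Rightarrow> nat \<Rightarrow> real" where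
  "proj_norm f l = sqrt (\<Sum>k = 1..Z l. (coeff f l k)\<^sup>2)"

lemma lam_eq: "lam l = 1 + real l * (real l + real (DIM('a) - 1) - 1)"
  by (simp add: lam_def sphere_eigenvalue_def)

lemma DIM_diff_ge_1: "1 \<le> real (DIM('a) - 1)"
  using DIM_ge_2 by linarith

lemma lam_ge_1: "1 \<le> lam l" and lam_pos: "0 < lam l"
proof -
  show "1 \<le> lam l" unfolding lam_eq using DIM_diff_ge_1 by (auto intro!: mult_nonneg_nonneg)
  then show "0 < lam l" by linarith
qed

lemma lam_mono: "l \<le> n \<Longrightarrow> lam l \<le> lam n"
  unfolding lam_eq using DIM_diff_ge_1 by (intro add_mono mult_mono) auto

lemma lam_ge_sq: "(real l)\<^sup>2 \<le> lam l"
proof -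
  have "real l * real l \<le> real l * (real l + real (DIM('a) - 1) - 1)"
    using DIM_diff_ge_1 by (intro mult_left_mono) auto
  then show ?thesis unfolding lam_eq power2_eq_square by linarith
qed

lemma lam_ge: "(1 + real l)\<^sup>2 \<le> 2 * lam l"
proof -
  have "0 \<le> (real l - 1)\<^sup>2" by simp
  then have "(1 + real l)\<^sup>2 \<le> 2 + 2 * (real l)\<^sup>2" by (simp add: power2_eq_square algebra_simps)
  moreover have "1 + (real l)\<^sup>2 \<le> lam l"
  proof -
    have "real l * real l \<le> real l * (real l + real (DIM('a) - 1) - 1)"
      using DIM_diff_ge_1 by (intro mult_left_mono) auto
    then show ?thesis unfolding lam_eq power2_eq_square by linarith
  qed
  ultimately show ?thesis by linarith
qed

lemma lam_le: "lam l \<le> real (DIM('a) - 1) * (1 + real l)\<^sup>2"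
proof -
  define d where "d = real (DIM('a) - 1)"
  have d: "d \<ge> 1" unfolding d_def by (rule DIM_diff_ge_1)
  have "d * (1 + real l)\<^sup>2 - lam l = (d - 1) * (1 + real l + (real l)\<^sup>2) + 2 * real l"
    unfolding lam_eq d_def[symmetric] by (simp add: power2_eq_square algebra_simps)
  moreover have "\<dots> \<ge> 0" using d by (intro add_nonneg_nonneg mult_nonneg_nonneg) auto
  ultimately show ?thesis by (simp add: d_def)
qed

lemma sum_Sigma_Z:
  "(\<Sum>(l, k)\<in>Sigma {..N} (\<lambda>l. {1..Z l}). g l k) = (\<Sum>l<Suc N. \<Sum>k = 1..Z l. g l k)"
  by (subst sum.Sigma[symmetric]) (auto simp: lessThan_Suc_atMost)

lemma H_sum_continuous_on:
  "continuous_on S (\<lambda>x. \<Sum>(l, k)\<in>Sigma {..N} (\<lambda>l. {1..Z l}). c l k * H l k x)"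
  unfolding case_prod_unfold
proof (intro continuous_on_sum continuous_on_mult continuous_on_const H_continuous_on)
  show "snd i \<in> {1..Z (fst i)}" if "i \<in> Sigma {..N} (\<lambda>l. {1..Z l})" for i
    using that by auto
qed

lemma H_sum_coeff:
  assumes k: "k \<in> {1..Z l}"
  shows "(\<integral>x. (\<Sum>(l', k')\<in>Sigma {..N} (\<lambda>l. {1..Z l}). c l' k' * H l' k' x) * H l k x \<partial>sphere_measure) =
    (if l \<le> N then c l k else 0)"
proof -
  let ?I = "Sigma {..N} (\<lambda>l. {1..Z l})"
  have "(\<integral>x. (\<Sum>(l', k')\<in>?I. c l' k' * H l' k' x) * H l k x \<partial>sphere_measure) =
      (\<Sum>(l', k')\<in>?I. c l' k' * (\<integral>x. H l k x * H l' k' x \<partial>sphere_measure))"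
    unfolding mult.commute[of _ "H l k _"]
    by (rule H_sum_integral[OF H_continuous_on[OF k]]) auto
  also have "\<dots> = (\<Sum>i\<in>?I. c (fst i) (snd i) * (if i = (l, k) then 1 else 0))"
  proof (intro sum.cong refl)
    fix i assume i: "i \<in> ?I"
    obtain l' k' where i': "i = (l', k')" by force
    have "k' \<in> {1..Z l'}" using i i' by auto
    from H_orthonormal[OF k this]
    have "(\<integral>x. H l k x * H l' k' x \<partial>sphere_measure) = (if i = (l, k) then 1 else 0)"
      by (simp add: i' eq_commute)
    then show "(case i of (l', k') \<Rightarrow> c l' k' * (\<integral>x. H l k x * H l' k' x \<partial>sphere_measure)) =
        c (fst i) (snd i) * (if i = (l, k) then 1 else 0)"
      by (simp add: i')
  qed
  also have "\<dots> = (if (l, k) \<in> ?I then c l k else 0)"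
    by (simp add: if_distrib[of "\<lambda>t. _ * t"] sum.delta cong: if_cong)
  finally show ?thesis using k by simp
qed

text \<open>Parseval's identity for finite expansions.\<close>

lemma H_sum_norm_sq:
  fixes c :: "nat \<Rightarrow> nat \<Rightarrow> real" and N :: nat
  defines "g \<equiv> \<lambda>x. \<Sum>(l, k)\<in>Sigma {..N} (\<lambda>l. {1..Z l}). c l k * H l k x"
  shows "(\<integral>x. g x * g x \<partial>sphere_measure) = (\<Sum>(l, k)\<in>Sigma {..N} (\<lambda>l. {1..Z l}). (c l k)\<^sup>2)"
proof -
  let ?I = "Sigma {..N} (\<lambda>l. {1..Z l})"
  have "(\<integral>x. g x * g x \<partial>sphere_measure) =
      (\<integral>x. g x * (\<Sum>(l, k)\<in>?I. c l k * H l k x) \<partial>sphere_measure)"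
    by (simp add: g_def)
  also have "\<dots> = (\<Sum>(l, k)\<in>?I. c l k * (\<integral>x. g x * H l k x \<partial>sphere_measure))"
    unfolding g_def by (rule H_sum_integral[OF H_sum_continuous_on]) auto
  also have "\<dots> = (\<Sum>(l, k)\<in>?I. (c l k)\<^sup>2)"
  proof (intro sum.cong refl)
    fix i assume i: "i \<in> ?I"
    obtain l k where lk: "i = (l, k)" by force
    have "(\<integral>x. g x * H l k x \<partial>sphere_measure) = c l k"
      unfolding g_def using i lk by (subst H_sum_coeff) auto
    then show "(case i of (l, k) \<Rightarrow> c l k * (\<integral>x. g x * H l k x \<partial>sphere_measure)) =
        (case i of (l, k) \<Rightarrow> (c l k)\<^sup>2)"
      by (simp add: lk power2_eq_square)
  qed
  finally show ?thesis .
qed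

lemma H_span_iff:
  "g \<in> H_span N \<longleftrightarrow> (\<exists>c. \<forall>x\<in>sphere 0 1. g x = (\<Sum>(l, k)\<in>Sigma {..N} (\<lambda>l. {1..Z l}). c l k * H l k x))"
proof -
  have *: "(\<Sum>i\<in>I. c i * (case i of (l, k) \<Rightarrow> H l k) x) = (\<Sum>(l, k)\<in>I. c (l, k) * H l k x)"
    for c and I :: "(nat \<times> nat) set" and x
    by (simp add: case_prod_unfold)
  show ?thesis
    unfolding H_span_def sphere_span_def mem_Collect_eq *
  proof
    let ?I = "Sigma {..N} (\<lambda>l. {1..Z l})"
    show "\<exists>c. \<forall>x\<in>sphere 0 1. g x = (\<Sum>(l, k)\<in>?I. c l k * H l k x)"
      if "\<exists>c. \<forall>x\<in>sphere 0 1. g x = (\<Sum>(l, k)\<in>?I. c (l, k) * H l k x)"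
    proof -
      from that obtain c where "\<forall>x\<in>sphere 0 1. g x = (\<Sum>(l, k)\<in>?I. c (l, k) * H l k x)" by blast
      then show ?thesis by (intro exI[of _ "\<lambda>l k. c (l, k)"])
    qed
    show "\<exists>c. \<forall>x\<in>sphere 0 1. g x = (\<Sum>(l, k)\<in>?I. c (l, k) * H l k x)"
      if "\<exists>c. \<forall>x\<in>sphere 0 1. g x = (\<Sum>(l, k)\<in>?I. c l k * H l k x)"
    proof -
      from that obtain c where "\<forall>x\<in>sphere 0 1. g x = (\<Sum>(l, k)\<in>?I. c l k * H l k x)" by blast
      then show ?thesis by (intro exI[of _ "\<lambda>(l, k). c l k"]) simp
    qed
  qed
qed

lemma H_span_expansion:
  assumes g: "g \<in> H_span N"
  obtains c where "\<And>x. x \<in> sphere 0 1 \<Longrightarrow> g x = (\<Sum>(l, k)\<in>Sigma {..N} (\<lambda>l. {1..Z l}). c l k * H l k x)"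
    "(\<integral>x. g x * g x \<partial>sphere_measure) = (\<Sum>(l, k)\<in>Sigma {..N} (\<lambda>l. {1..Z l}). (c l k)\<^sup>2)"
proof -
  let ?I = "Sigma {..N} (\<lambda>l. {1..Z l})"
  obtain c where c: "\<And>x. x \<in> sphere 0 1 \<Longrightarrow> g x = (\<Sum>(l, k)\<in>?I. c l k * H l k x)"
    using g unfolding H_span_iff by blast
  have "(\<integral>x. g x * g x \<partial>sphere_measure) =
      (\<integral>x. (\<Sum>(l, k)\<in>?I. c l k * H l k x) * (\<Sum>(l, k)\<in>?I. c l k * H l k x) \<partial>sphere_measure)"
    by (intro Bochner_Integration.integral_cong) (auto simp: c)
  also have "\<dots> = (\<Sum>(l, k)\<in>?I. (c l k)\<^sup>2)" by (rule H_sum_norm_sq)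
  finally show ?thesis using c by (intro that[of c])
qed

lemma H_span_continuous_on: "g \<in> H_span N \<Longrightarrow> continuous_on (sphere 0 1) g"
proof -
  assume "g \<in> H_span N"
  then obtain c where c: "\<And>x. x \<in> sphere 0 1 \<Longrightarrow> g x = (\<Sum>(l, k)\<in>Sigma {..N} (\<lambda>l. {1..Z l}). c l k * H l k x)"
    unfolding H_span_iff by blast
  from H_sum_continuous_on[of "sphere 0 1" c N] show ?thesis
    by (rule continuous_on_eq) (simp add: c)
qed

text \<open>The duality of H^r and H^-r: Cauchy-Schwarz with the weights
  \<open>lam l powr (r / 2)\<close> and their inverses. Since g has degree at most N, its H^r norm
  is at most \<open>lam N powr (r / 2)\<close> times its L2 norm.\<close>

lemma sampling_error_H_span_le:
  assumes g: "g \<in> H_span N" and X: "\<And>j. j \<in> {1..m} \<Longrightarrow> X j \<in> sphere 0 1"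
    and r: "0 \<le> r" and B: "0 \<le> B"
    and nu: "\<And>N. (\<Sum>l<N. lam l powr (- r) * (\<Sum>k = 1..Z l. (sampling_error m X w (H l k))\<^sup>2)) \<le> B\<^sup>2"
  shows "\<bar>sampling_error m X w g\<bar> \<le> B * lam N powr (r / 2) * sqrt (\<integral>x. g x * g x \<partial>sphere_measure)"
proof -
  let ?I = "Sigma {..N} (\<lambda>l. {1..Z l})" and ?nu = "sampling_error m X w"
  obtain c where c: "\<And>x. x \<in> sphere 0 1 \<Longrightarrow> g x = (\<Sum>(l, k)\<in>?I. c l k * H l k x)"
    "(\<integral>x. g x * g x \<partial>sphere_measure) = (\<Sum>(l, k)\<in>?I. (c l k)\<^sup>2)"
    using H_span_expansion[OF g] by blast
  define a where "a i = c (fst i) (snd i) * lam (fst i) powr (r / 2)" for i :: "nat \<times> nat"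
  define b where "b i = lam (fst i) powr (- r / 2) * ?nu (H (fst i) (snd i))" for i :: "nat \<times> nat"
  have "?nu g = ?nu (\<lambda>x. \<Sum>i\<in>?I. c (fst i) (snd i) * H (fst i) (snd i) x)"
    by (rule sampling_error_cong) (use c(1) X in \<open>auto simp: case_prod_unfold\<close>)
  also have "\<dots> = (\<Sum>i\<in>?I. c (fst i) (snd i) * ?nu (H (fst i) (snd i)))"
    by (rule sampling_error_sum) (auto intro!: H_continuous_on)
  also have "\<dots> = (\<Sum>i\<in>?I. a i * b i)"
  proof (intro sum.cong refl)
    fix i :: "nat \<times> nat"
    have "lam (fst i) powr (r / 2) * lam (fst i) powr (- r / 2) = 1"
      using lam_pos[of "fst i"] by (simp add: powr_add[symmetric])
    then show "c (fst i) (snd i) * ?nu (H (fst i) (snd i)) = a i * b i"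
      unfolding a_def b_def by (simp add: mult_ac)
  qed
  finally have "(?nu g)\<^sup>2 \<le> (\<Sum>i\<in>?I. (a i)\<^sup>2) * (\<Sum>i\<in>?I. (b i)\<^sup>2)"
    using Cauchy_Schwarz_ineq_sum[of a b ?I] by simp
  also have "\<dots> \<le> (lam N powr r * (\<integral>x. g x * g x \<partial>sphere_measure)) * B\<^sup>2"
  proof (rule mult_mono)
    have "(a i)\<^sup>2 \<le> lam N powr r * (c (fst i) (snd i))\<^sup>2" if "i \<in> ?I" for i
    proof -
      have "(a i)\<^sup>2 = lam (fst i) powr r * (c (fst i) (snd i))\<^sup>2"
        by (simp add: a_def power_mult_distrib power2_powr mult.commute)
      also have "\<dots> \<le> lam N powr r * (c (fst i) (snd i))\<^sup>2"
        using that r lam_pos[of "fst i"] by (intro mult_right_mono powr_mono2 lam_mono) auto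
      finally show ?thesis .
    qed
    then show "(\<Sum>i\<in>?I. (a i)\<^sup>2) \<le> lam N powr r * (\<integral>x. g x * g x \<partial>sphere_measure)"
      unfolding c(2) sum_distrib_left case_prod_unfold by (rule sum_mono)
    have "(\<Sum>i\<in>?I. (b i)\<^sup>2) = (\<Sum>(l, k)\<in>?I. lam l powr (- r) * (?nu (H l k))\<^sup>2)"
      by (simp add: b_def power_mult_distrib power2_powr case_prod_unfold)
    also have "\<dots> \<le> B\<^sup>2"
      using nu[of "Suc N"] unfolding sum_Sigma_Z by (simp add: sum_distrib_left)
    finally show "(\<Sum>i\<in>?I. (b i)\<^sup>2) \<le> B\<^sup>2" .
  qed (auto intro!: sum_nonneg mult_nonneg_nonneg Bochner_Integration.integral_nonneg)
  also have "\<dots> = (B * lam N powr (r / 2) * sqrt (\<integral>x. g x * g x \<partial>sphere_measure))\<^sup>2"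
    by (simp add: power_mult_distrib power2_powr real_sqrt_pow2 Bochner_Integration.integral_nonneg)
  finally show ?thesis
    using B by (intro power2_le_imp_le[of "\<bar>_\<bar>"]) (auto intro!: mult_nonneg_nonneg Bochner_Integration.integral_nonneg)
qed

text \<open>Here s > d/2 + r enters: \<open>lam l powr (r - s)\<close> decays like (1 + l)^(-2(s -
  r)) with 2(s - r) > d, while the cumulative dimensions grow like N^d.\<close>

lemma lam_weighted_Z_bounded:
  assumes rs: "real (DIM('a) - 1) / 2 + r < s"
  shows "\<exists>S\<ge>0. \<forall>N. (\<Sum>l<N. lam l powr (r - s) * real (Z l)) \<le> S\<^sup>2"
proof -
  define d where "d = DIM('a) - 1"
  have t: "0 < s - r" using rs DIM_diff_ge_1 by linarith
  have bound: "real (\<Sum>l\<le>N. Z l) \<le> (2 * 2 ^ d) * (1 + real N) powr real d" for N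
  proof -
    have "(\<Sum>l\<le>N. Z l) \<le> 2 * (2 * N + 1) ^ d"
      using sum_Z_le[of N] by (simp add: d_def)
    also have "\<dots> \<le> 2 * (2 * (1 + N)) ^ d"
      by (intro mult_left_mono power_mono) auto
    finally have "real (\<Sum>l\<le>N. Z l) \<le> real (2 * (2 * (1 + N)) ^ d)"
      by (rule of_nat_mono)
    also have "\<dots> = (2 * 2 ^ d) * (1 + real N) powr real d"
      by (simp add: power_mult_distrib[symmetric] powr_realpow)
    finally show ?thesis .
  qed
  have "real d < 2 * (s - r)" using rs by (simp add: d_def field_simps)
  then have "\<exists>S. \<forall>N. (\<Sum>l<N. (1 + real l) powr (- (2 * (s - r))) * real (Z l)) \<le> S"
    using bound by (intro weighted_sum_bounded[where C = "2 * 2 ^ d" and e = "real d"]) auto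
  then obtain S where S: "\<And>N. (\<Sum>l<N. (1 + real l) powr (- (2 * (s - r))) * real (Z l)) \<le> S"
    by blast
  \<comment> \<open>The exponent r - s is negative, so the lower bound (1 + l)^2 / 2 for
    \<open>lam l\<close> is the useful one; its denominator produces
    \<open>2 powr (s - r)\<close>.\<close>
  have "lam l powr (r - s) \<le> 2 powr (s - r) * (1 + real l) powr (- (2 * (s - r)))" for l
  proof -
    have "lam l powr (r - s) \<le> ((1 + real l)\<^sup>2 / 2) powr (r - s)"
      using lam_ge[of l] t by (intro powr_mono2') auto
    also have "\<dots> = 2 powr (s - r) * (1 + real l) powr (- (2 * (s - r)))"
      using powr_powr[of "1 + real l" 2 "r - s"]
      by (simp add: powr_divide powr_minus_divide[of 2 "s - r"] field_simps) (simp add: powr_minus[of 2, symmetric] powr_add[symmetric])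
    finally show ?thesis .
  qed
  then have "(\<Sum>l<N. lam l powr (r - s) * real (Z l)) \<le>
      (\<Sum>l<N. 2 powr (s - r) * (1 + real l) powr (- (2 * (s - r))) * real (Z l))" for N
    by (intro sum_mono mult_right_mono) auto
  also have "\<dots> N \<le> 2 powr (s - r) * S" for N
    using S[of N] by (simp add: sum_distrib_left[symmetric] mult.assoc)
  finally have "(\<Sum>l<N. lam l powr (r - s) * real (Z l)) \<le> 2 powr (s - r) * max S 0" for N
    by (rule order.trans) (auto intro!: mult_left_mono)
  then show ?thesis
    by (intro exI[of _ "sqrt (2 powr (s - r) * max S 0)"]) auto
qed

end

section \<open>Uniform convergence of the expansion and sampling of products\<close>

lemma sphere_integral_abs_le:
  fixes f :: "'a::euclidean_space \<Rightarrow> real"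
  assumes f: "continuous_on (sphere 0 1) f" and e: "\<And>x. x \<in> sphere 0 1 \<Longrightarrow> \<bar>f x\<bar> \<le> e"
  shows "\<bar>\<integral>x. f x \<partial>sphere_measure\<bar> \<le> e"
proof -
  have "\<bar>\<integral>x. f x \<partial>sphere_measure\<bar> \<le> (\<integral>x. \<bar>f x\<bar> \<partial>sphere_measure)"
    by (rule integral_abs_bound)
  also have "\<dots> \<le> (\<integral>x. e * 1 \<partial>(sphere_measure :: 'a measure))"
    by (intro Bochner_Integration.integral_mono sphere_integrable continuous_intros f) (use e in auto)
  also have "\<dots> = e"
    unfolding integral_mult_right_zero sphere_integral_one by (rule mult_1_right)
  finally show ?thesis .
qed

lemma sphere_integral_uniform_limit:
  fixes f :: "nat \<Rightarrow> 'a::euclidean_space \<Rightarrow> real"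
  assumes f: "\<And>n. continuous_on (sphere 0 1) (f n)" and g: "continuous_on (sphere 0 1) g"
    and h: "continuous_on (sphere 0 1) h" and lim: "uniform_limit (sphere 0 1) f g sequentially"
  shows "(\<lambda>n. \<integral>x. f n x * h x \<partial>sphere_measure) \<longlonglongrightarrow> (\<integral>x. g x * h x \<partial>sphere_measure)"
proof -
  obtain B' where B': "0 \<le> B'" "\<And>x. x \<in> sphere 0 1 \<Longrightarrow> \<bar>h x\<bar> \<le> B'"
    using continuous_on_compact_bounded[OF h compact_sphere] by blast
  define B where "B = B' + 1"
  have B: "0 < B" "\<And>x. x \<in> sphere 0 1 \<Longrightarrow> \<bar>h x\<bar> \<le> B"
    unfolding B_def using B'(1) B'(2) by (linarith, smt (verit))
  show ?thesis
  proof (rule tendstoI)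
    fix e :: real assume e: "e > 0"
    have "\<forall>\<^sub>F n in sequentially. \<forall>x\<in>sphere 0 1. dist (f n x) (g x) < e / 2 / B"
      using lim e B(1) by (intro uniform_limitD) auto
    then show "\<forall>\<^sub>F n in sequentially. dist (\<integral>x. f n x * h x \<partial>sphere_measure) (\<integral>x. g x * h x \<partial>sphere_measure) < e"
    proof eventually_elim
      case (elim n)
      have int: "integrable sphere_measure (\<lambda>x. f n x * h x)" "integrable sphere_measure (\<lambda>x. g x * h x)"
        by (intro sphere_integrable continuous_on_mult f g h)+
      have "(\<integral>x. f n x * h x \<partial>sphere_measure) - (\<integral>x. g x * h x \<partial>sphere_measure) =
          (\<integral>x. (f n x - g x) * h x \<partial>sphere_measure)"
        using int by (simp add: left_diff_distrib)
      also have "\<bar>\<dots>\<bar> \<le> e / 2"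
      proof (rule sphere_integral_abs_le)
        show "continuous_on (sphere 0 1) (\<lambda>x. (f n x - g x) * h x)"
          by (intro continuous_intros f g h)
        fix x :: 'a assume x: "x \<in> sphere 0 1"
        have "\<bar>f n x - g x\<bar> * \<bar>h x\<bar> \<le> e / 2 / B * B"
          using elim x B e by (intro mult_mono) (auto simp: dist_real_def less_imp_le)
        also have "\<dots> = e / 2" using B(1) by simp
        finally show "\<bar>(f n x - g x) * h x\<bar> \<le> e / 2" by (simp add: abs_mult)
      qed
      finally show ?case using e by (simp add: dist_real_def)
    qed
  qed
qed

lemma sum_sqrt_mult_le:
  fixes a b :: "nat \<Rightarrow> real"
  assumes "(\<Sum>i\<in>I. (a i)\<^sup>2) \<le> A\<^sup>2" "(\<Sum>i\<in>I. (b i)\<^sup>2) \<le> B\<^sup>2" "0 \<le> A" "0 \<le> B"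
  shows "(\<Sum>i\<in>I. a i * b i) \<le> A * B"
proof (rule power2_le_imp_le)
  have "(\<Sum>i\<in>I. a i * b i)\<^sup>2 \<le> (\<Sum>i\<in>I. (a i)\<^sup>2) * (\<Sum>i\<in>I. (b i)\<^sup>2)"
    by (rule Cauchy_Schwarz_ineq_sum)
  also have "\<dots> \<le> A\<^sup>2 * B\<^sup>2" using assms by (intro mult_mono sum_nonneg) auto
  finally show "(\<Sum>i\<in>I. a i * b i)\<^sup>2 \<le> (A * B)\<^sup>2" by (simp add: power_mult_distrib)
qed (use assms in auto)

context sph_onb
begin

lemma proj_H_span: "proj f l \<in> H_span l"
  unfolding proj_def[abs_def]
  by (intro hom_polys_H_span hom_polys_sum hom_polys_cmult H_hom) auto

lemma proj_continuous_on: "continuous_on (sphere 0 1) (proj f l)"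
  by (rule H_span_continuous_on[OF proj_H_span])

lemma proj_norm_nonneg: "0 \<le> proj_norm f l"
  unfolding proj_norm_def by (intro real_sqrt_ge_zero sum_nonneg) auto

lemma proj_norm_sq: "(proj_norm f l)\<^sup>2 = (\<Sum>k = 1..Z l. (coeff f l k)\<^sup>2)"
  unfolding proj_norm_def by (intro real_sqrt_pow2 sum_nonneg) auto

lemma proj_le:
  assumes x: "x \<in> sphere 0 1"
  shows "\<bar>proj f l x\<bar> \<le> sqrt (real (Z l)) * proj_norm f l"
proof -
  have "(proj f l x)\<^sup>2 \<le> (proj_norm f l)\<^sup>2 * real (Z l)"
    unfolding proj_def proj_norm_sq addition_theorem[OF x, of l, symmetric]
    by (rule Cauchy_Schwarz_ineq_sum)
  then have "sqrt ((proj f l x)\<^sup>2) \<le> sqrt ((proj_norm f l)\<^sup>2 * real (Z l))"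
    by (rule real_sqrt_le_mono)
  then show ?thesis
    using proj_norm_nonneg[of f l] by (simp add: real_sqrt_mult mult.commute)
qed

lemma coeff_proj:
  assumes k: "k \<in> {1..Z l}"
  shows "(\<integral>x. proj f l' x * H l k x \<partial>sphere_measure) = (if l = l' then coeff f l k else 0)"
proof -
  have "(\<integral>x. proj f l' x * H l k x \<partial>sphere_measure) =
      (\<integral>x. H l k x * (\<Sum>(l', k')\<in>{l'} \<times> {1..Z l'}. coeff f l' k' * H l' k' x) \<partial>sphere_measure)"
    by (intro Bochner_Integration.integral_cong) (auto simp: proj_def sum.cartesian_product[symmetric])
  also have "\<dots> = (\<Sum>(l', k')\<in>{l'} \<times> {1..Z l'}. coeff f l' k' * (\<integral>x. H l k x * H l' k' x \<partial>sphere_measure))"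
    by (rule H_sum_integral[OF H_continuous_on[OF k]]) auto
  also have "\<dots> = (\<Sum>k' = 1..Z l'. coeff f l' k' * (if (l, k) = (l', k') then 1 else 0))"
    using k by (simp add: sum.cartesian_product[symmetric] H_orthonormal del: prod.inject)
  also have "\<dots> = (if l = l' then coeff f l k else 0)"
    using k by (cases "l = l'") (simp_all add: if_distrib[of "\<lambda>t. _ * t"] sum.delta' cong: if_cong)
  finally show ?thesis .
qed

text \<open>Cauchy-Schwarz after splitting r = (r - s) + s in the exponent: \<open>S\<close>
  collects the dimensions and \<open>F\<close> the Sobolev norm of f.\<close>

lemma proj_sum_bounds:
  assumes S: "0 \<le> S" "\<And>N. (\<Sum>l<N. lam l powr (r - s) * real (Z l)) \<le> S\<^sup>2"
    and F: "0 \<le> F" "\<And>N. (\<Sum>l<N. lam l powr s * (\<Sum>k = 1..Z l. (coeff f l k)\<^sup>2)) \<le> F\<^sup>2"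
  shows "(\<Sum>l<N. lam l powr (r / 2) * (sqrt (real (Z l)) * proj_norm f l)) \<le> S * F"
proof -
  have "(\<Sum>l<N. lam l powr (r / 2) * (sqrt (real (Z l)) * proj_norm f l)) =
      (\<Sum>l<N. (lam l powr ((r - s) / 2) * sqrt (real (Z l))) * (lam l powr (s / 2) * proj_norm f l))"
  proof (intro sum.cong refl)
    fix l
    have "lam l powr (r / 2) = lam l powr ((r - s) / 2) * lam l powr (s / 2)"
      by (simp add: powr_add[symmetric] diff_divide_distrib)
    then show "lam l powr (r / 2) * (sqrt (real (Z l)) * proj_norm f l) =
        (lam l powr ((r - s) / 2) * sqrt (real (Z l))) * (lam l powr (s / 2) * proj_norm f l)"
      by simp
  qed
  also have "\<dots> \<le> S * F"
  proof (rule sum_sqrt_mult_le)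
    have "(lam l powr (t / 2))\<^sup>2 = lam l powr t" for l t by (simp add: power2_powr)
    then show "(\<Sum>l<N. (lam l powr ((r - s) / 2) * sqrt (real (Z l)))\<^sup>2) \<le> S\<^sup>2"
      "(\<Sum>l<N. (lam l powr (s / 2) * proj_norm f l)\<^sup>2) \<le> F\<^sup>2"
      using S F by (simp_all add: power_mult_distrib proj_norm_sq)
  qed (use S F in auto)
  finally show ?thesis .
qed

text \<open>The sampling error evaluates f at points, so the expansion must converge uniformly and
  not only in L2. The bound \<open>M\<close> gives a uniform limit by the Weierstrass test; this
  limit has the same coefficients as f, so it equals f by \<open>H_complete\<close>.\<close>

lemma proj_uniform_limit:
  assumes f: "continuous_on (sphere 0 1) f"
    and M: "\<And>N. (\<Sum>l<N. sqrt (real (Z l)) * proj_norm f l) \<le> M"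
  shows "uniform_limit (sphere 0 1) (\<lambda>N x. \<Sum>l<N. proj f l x) f sequentially"
proof -
  define g where "g x = (\<Sum>l. proj f l x)" for x
  have "summable (\<lambda>l. sqrt (real (Z l)) * proj_norm f l)"
  proof (rule bounded_imp_summable)
    show "(\<Sum>l\<le>N. sqrt (real (Z l)) * proj_norm f l) \<le> M" for N
      using M[of "Suc N"] by (simp only: lessThan_Suc_atMost)
  qed (simp add: proj_norm_nonneg)
  then have lim: "uniform_limit (sphere 0 1) (\<lambda>N x. \<Sum>l<N. proj f l x) g sequentially"
    unfolding g_def by (intro Weierstrass_m_test) (use proj_le in auto)
  have cont: "continuous_on (sphere 0 1) (\<lambda>x. \<Sum>l<N. proj f l x)" for N
    by (intro continuous_on_sum proj_continuous_on)
  have g: "continuous_on (sphere 0 1) g"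
    by (rule uniform_limit_theorem[OF _ lim]) (auto simp: cont)
  have "f x - g x = 0" if x: "x \<in> sphere 0 1" for x
  proof (rule H_complete[OF _ _ x])
    show "continuous_on (sphere 0 1) (\<lambda>x. f x - g x)" by (intro continuous_intros f g)
    fix l k assume k: "k \<in> {1..Z l}"
    have "(\<lambda>N. \<integral>x. (\<Sum>l<N. proj f l x) * H l k x \<partial>sphere_measure) \<longlonglongrightarrow> (\<integral>x. g x * H l k x \<partial>sphere_measure)"
      by (rule sphere_integral_uniform_limit[OF cont g H_continuous_on[OF k] lim])
    moreover have "(\<integral>x. (\<Sum>l<N. proj f l x) * H l k x \<partial>sphere_measure) = coeff f l k" if "N > l" for N
    proof -
      have "(\<integral>x. (\<Sum>l<N. proj f l x) * H l k x \<partial>sphere_measure) =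
          (\<Sum>l'<N. \<integral>x. proj f l' x * H l k x \<partial>sphere_measure)"
        unfolding sum_distrib_right
        by (intro Bochner_Integration.integral_sum sphere_integrable continuous_on_mult proj_continuous_on H_continuous_on k)
      also have "\<dots> = (\<Sum>l'<N. if l = l' then coeff f l k else 0)"
        by (simp only: coeff_proj[OF k])
      finally show ?thesis using that by (simp add: sum.delta)
    qed
    then have "\<forall>\<^sub>F N in sequentially. (\<integral>x. (\<Sum>l<N. proj f l x) * H l k x \<partial>sphere_measure) = coeff f l k"
      by (rule eventually_mono[OF eventually_gt_at_top])
    then have "(\<lambda>N. \<integral>x. (\<Sum>l<N. proj f l x) * H l k x \<partial>sphere_measure) \<longlonglongrightarrow> coeff f l k"
      by (rule tendsto_eventually)
    ultimately have "(\<integral>x. g x * H l k x \<partial>sphere_measure) = coeff f l k"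
      by (rule LIMSEQ_unique)
    moreover have "integrable sphere_measure (\<lambda>x. f x * H l k x)" "integrable sphere_measure (\<lambda>x. g x * H l k x)"
      by (intro sphere_integrable continuous_on_mult f g H_continuous_on k)+
    ultimately show "(\<integral>x. (f x - g x) * H l k x \<partial>sphere_measure) = 0"
      by (simp add: left_diff_distrib coeff_def)
  qed
  then have "\<And>x. x \<in> sphere 0 1 \<Longrightarrow> g x = f x" by simp
  then show ?thesis by (intro iffD1[OF uniform_limit_cong'[OF refl] lim])
qed

text \<open>
  Multiplication by \<open>f\<close> is split along the degrees of \<open>f\<close>: a component of degree \<open>l\<close> raises the
  degree of \<open>p\<close> by at most \<open>l\<close> and has its supremum controlled by the addition theorem.
\<close>

lemma sampling_error_mult_le:
  assumes f: "continuous_on (sphere 0 1) f" and p: "p \<in> H_span n"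
    and X: "\<And>j. j \<in> {1..m} \<Longrightarrow> X j \<in> sphere 0 1"
    and r: "0 \<le> r"
    and B: "0 \<le> B" "\<And>N. (\<Sum>l<N. lam l powr (- r) * (\<Sum>k = 1..Z l. (sampling_error m X w (H l k))\<^sup>2)) \<le> B\<^sup>2"
    and S: "0 \<le> S" "\<And>N. (\<Sum>l<N. lam l powr (r - s) * real (Z l)) \<le> S\<^sup>2"
    and F: "0 \<le> F" "\<And>N. (\<Sum>l<N. lam l powr s * (\<Sum>k = 1..Z l. (coeff f l k)\<^sup>2)) \<le> F\<^sup>2"
  shows "\<bar>sampling_error m X w (\<lambda>x. f x * p x)\<bar> \<le>
    B * (2 * real (DIM('a) - 1)) powr (r / 2) * (1 + real n) powr r * S * F * sqrt (\<integral>x. p x * p x \<partial>sphere_measure)"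
proof -
  let ?nu = "sampling_error m X w" and ?d = "real (DIM('a) - 1)"
  define P where "P = sqrt (\<integral>x. p x * p x \<partial>sphere_measure)"
  have P: "0 \<le> P" unfolding P_def by (intro real_sqrt_ge_zero Bochner_Integration.integral_nonneg) auto
  have pc: "continuous_on (sphere 0 1) p" by (rule H_span_continuous_on[OF p])
  have d: "1 \<le> ?d" by (rule DIM_diff_ge_1)
  have "(\<Sum>l<N. sqrt (real (Z l)) * proj_norm f l) \<le> S * F" for N
  proof -
    have "(\<Sum>l<N. sqrt (real (Z l)) * proj_norm f l) \<le>
        (\<Sum>l<N. lam l powr (r / 2) * (sqrt (real (Z l)) * proj_norm f l))"
    proof (rule sum_mono)
      fix l
      have "1 * (sqrt (real (Z l)) * proj_norm f l) \<le> lam l powr (r / 2) * (sqrt (real (Z l)) * proj_norm f l)"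
        using r lam_ge_1[of l] proj_norm_nonneg by (intro mult_right_mono ge_one_powr_ge_zero) auto
      then show "sqrt (real (Z l)) * proj_norm f l \<le> lam l powr (r / 2) * (sqrt (real (Z l)) * proj_norm f l)" by simp
    qed
    also have "\<dots> \<le> S * F" by (rule proj_sum_bounds[OF S F])
    finally show ?thesis .
  qed
  from proj_uniform_limit[OF f this]
  have lim: "uniform_limit (sphere 0 1) (\<lambda>N x. \<Sum>l<N. proj f l x) f sequentially" .
  let ?f = "\<lambda>N x. \<Sum>l<N. proj f l x"
  have fc: "continuous_on (sphere 0 1) (?f N)" for N
    by (intro continuous_on_sum proj_continuous_on)
  have conv: "(\<lambda>N. ?nu (\<lambda>x. ?f N x * p x)) \<longlonglongrightarrow> ?nu (\<lambda>x. f x * p x)"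
    unfolding sampling_error_def
  proof (intro tendsto_intros)
    show "(\<lambda>N. \<integral>x. ?f N x * p x \<partial>sphere_measure) \<longlonglongrightarrow> (\<integral>x. f x * p x \<partial>sphere_measure)"
      by (rule sphere_integral_uniform_limit[OF fc f pc lim])
    show "(\<lambda>N. ?f N (X j)) \<longlonglongrightarrow> f (X j)" if "j \<in> {1..m}" for j
      by (rule tendsto_uniform_limitI[OF lim X[OF that]])
  qed
  let ?C = "B * (2 * ?d) powr (r / 2) * (1 + real n) powr r"
  have piece: "\<bar>?nu (\<lambda>x. proj f l x * p x)\<bar> \<le> ?C * P * (lam l powr (r / 2) * (sqrt (real (Z l)) * proj_norm f l))" for l
  proof -
    have span: "(\<lambda>x. proj f l x * p x) \<in> H_span (l + n)" by (rule H_span_mult[OF proj_H_span p])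
    \<comment> \<open>The L2 norm of the product is at most the supremum of the component of f times
      the L2 norm of p.\<close>
    have L2: "sqrt (\<integral>x. (proj f l x * p x) * (proj f l x * p x) \<partial>sphere_measure) \<le> sqrt (real (Z l)) * proj_norm f l * P"
    proof -
      have "(\<integral>x. (proj f l x * p x) * (proj f l x * p x) \<partial>sphere_measure) \<le>
          (\<integral>x. (sqrt (real (Z l)) * proj_norm f l)\<^sup>2 * (p x * p x) \<partial>sphere_measure)"
      proof (intro Bochner_Integration.integral_mono sphere_integrable continuous_on_mult continuous_on_const proj_continuous_on pc)
        fix x :: 'a assume "x \<in> space sphere_measure"
        then have "(proj f l x)\<^sup>2 \<le> (sqrt (real (Z l)) * proj_norm f l)\<^sup>2"
          using proj_le[of x f l] by (simp add: abs_le_square_iff[symmetric] proj_norm_nonneg abs_mult)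
        then have "(proj f l x)\<^sup>2 * (p x * p x) \<le> (sqrt (real (Z l)) * proj_norm f l)\<^sup>2 * (p x * p x)"
          by (rule mult_right_mono) simp
        then show "(proj f l x * p x) * (proj f l x * p x) \<le> (sqrt (real (Z l)) * proj_norm f l)\<^sup>2 * (p x * p x)"
          by (simp add: power2_eq_square mult_ac)
      qed
      then have "sqrt (\<integral>x. (proj f l x * p x) * (proj f l x * p x) \<partial>sphere_measure) \<le>
          sqrt ((sqrt (real (Z l)) * proj_norm f l)\<^sup>2 * (\<integral>x. p x * p x \<partial>sphere_measure))"
        by (intro real_sqrt_le_mono) simp
      also have "\<dots> = sqrt (real (Z l)) * proj_norm f l * P"
        by (simp add: real_sqrt_mult P_def proj_norm_nonneg abs_mult)
      finally show ?thesis .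
    qed
    have lam: "lam (l + n) powr (r / 2) \<le> (2 * ?d) powr (r / 2) * (1 + real n) powr r * lam l powr (r / 2)"
    proof -
      \<comment> \<open>The degrees are separated here. \<open>lam_le\<close> contributes the factor
        d and \<open>lam_ge\<close> the factor 2 of the constant 2 d.\<close>
      have "(1 + real (l + n))\<^sup>2 \<le> ((1 + real n) * (1 + real l))\<^sup>2"
        by (intro power_mono) (auto simp: algebra_simps)
      also have "\<dots> \<le> (1 + real n)\<^sup>2 * (2 * lam l)"
        unfolding power_mult_distrib by (intro mult_left_mono lam_ge) auto
      finally have "lam (l + n) \<le> ?d * ((1 + real n)\<^sup>2 * (2 * lam l))"
        using lam_le[of "l + n"] d by (meson mult_left_mono order.trans order.trans[OF zero_le_one])
      also have "\<dots> = (2 * ?d) * (1 + real n)\<^sup>2 * lam l" by (simp only: mult_ac)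
      finally have "lam (l + n) powr (r / 2) \<le> ((2 * ?d) * (1 + real n)\<^sup>2 * lam l) powr (r / 2)"
        using r lam_pos[of "l + n"] by (intro powr_mono2) auto
      also have "\<dots> = (2 * ?d) powr (r / 2) * ((1 + real n)\<^sup>2) powr (r / 2) * lam l powr (r / 2)"
        by (simp add: powr_mult)
      also have "((1 + real n)\<^sup>2) powr (r / 2) = (1 + real n) powr r"
        using powr_powr[of "1 + real n" 2 "r / 2"] by (simp add: powr_numeral)
      finally show ?thesis .
    qed
    have "\<bar>?nu (\<lambda>x. proj f l x * p x)\<bar> \<le> B * lam (l + n) powr (r / 2) *
        sqrt (\<integral>x. (proj f l x * p x) * (proj f l x * p x) \<partial>sphere_measure)"
      by (rule sampling_error_H_span_le[OF span X r B])
    also have "\<dots> \<le> B * ((2 * ?d) powr (r / 2) * (1 + real n) powr r * lam l powr (r / 2)) *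
        (sqrt (real (Z l)) * proj_norm f l * P)"
      using B(1) L2 lam by (intro mult_mono mult_left_mono) (auto intro!: Bochner_Integration.integral_nonneg)
    finally show ?thesis by (simp add: mult_ac)
  qed
  have "\<bar>?nu (\<lambda>x. ?f N x * p x)\<bar> \<le> ?C * P * (S * F)" for N
  proof -
    have "?nu (\<lambda>x. ?f N x * p x) = ?nu (\<lambda>x. \<Sum>l<N. 1 * (proj f l x * p x))"
      by (simp add: sum_distrib_right)
    also have "\<dots> = (\<Sum>l<N. 1 * ?nu (\<lambda>x. proj f l x * p x))"
      by (intro sampling_error_sum continuous_on_mult proj_continuous_on pc)
    finally have "\<bar>?nu (\<lambda>x. ?f N x * p x)\<bar> \<le> (\<Sum>l<N. \<bar>?nu (\<lambda>x. proj f l x * p x)\<bar>)"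
      by (simp add: sum_abs)
    also have "\<dots> \<le> (\<Sum>l<N. ?C * P * (lam l powr (r / 2) * (sqrt (real (Z l)) * proj_norm f l)))"
      by (intro sum_mono piece)
    also have "\<dots> = ?C * P * (\<Sum>l<N. lam l powr (r / 2) * (sqrt (real (Z l)) * proj_norm f l))"
      by (simp add: sum_distrib_left)
    also have "\<dots> \<le> ?C * P * (S * F)"
      using B(1) P by (intro mult_left_mono proj_sum_bounds[OF S F]) auto
    finally show ?thesis .
  qed
  then have "\<bar>?nu (\<lambda>x. f x * p x)\<bar> \<le> ?C * P * (S * F)"
    by (intro LIMSEQ_le_const2[OF tendsto_rabs[OF conv]]) auto
  then show ?thesis by (simp add: P_def mult_ac)
qed

section \<open>Hyperinterpolation\<close>

lemma fun_distribution_Y: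
  assumes "k \<in> {1..Z l}"
  shows "fun_distribution f (Y l k) = coeff f l k"
  unfolding fun_distribution_def coeff_def
  by (intro Bochner_Integration.integral_cong) (use assms in \<open>auto simp: Y_eq_H\<close>)

lemma sobolev_norm_le:
  assumes B: "0 \<le> B" and c: "\<And>l k. k \<in> {1..Z l} \<Longrightarrow> u (Y l k) = c l k"
  shows "sobolev_norm Z Y s u \<le> ennreal B \<longleftrightarrow>
    (\<forall>N. (\<Sum>l<N. lam l powr s * (\<Sum>k = 1..Z l. (c l k)\<^sup>2)) \<le> B\<^sup>2)"
proof -
  have "(\<Sum>k = 1..Z l. (u (Y l k))\<^sup>2) = (\<Sum>k = 1..Z l. (c l k)\<^sup>2)" for l
    by (intro sum.cong refl) (simp only: c)
  then show ?thesis unfolding sobolev_norm_le_iff[OF B] lam_def by (simp only:)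
qed

lemma hyperinterpolation_eq:
  assumes x: "x \<in> sphere 0 1" and X: "\<And>j. j \<in> {1..m} \<Longrightarrow> X j \<in> sphere 0 1"
  shows "hyperinterpolation Z Y m X w n f x =
    (\<Sum>(l, k)\<in>Sigma {..n} (\<lambda>l. {1..Z l}). (\<Sum>j = 1..m. w j * (f (X j) * H l k (X j))) * H l k x)"
proof -
  have "hyperinterpolation Z Y m X w n f x =
      (\<Sum>j = 1..m. \<Sum>(l, k)\<in>Sigma {..n} (\<lambda>l. {1..Z l}). w j * f (X j) * (H l k x * H l k (X j)))"
    unfolding hyperinterpolation_def reproducing_kernel_def sum_distrib_left
    using x X by (intro sum.cong refl)
      (simp add: sum.Sigma[symmetric] atLeast0AtMost Y_eq_H)
  also have "\<dots> = (\<Sum>i\<in>Sigma {..n} (\<lambda>l. {1..Z l}). \<Sum>j = 1..m.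
      w j * f (X j) * (H (fst i) (snd i) x * H (fst i) (snd i) (X j)))"
    unfolding case_prod_unfold by (rule sum.swap)
  finally show ?thesis
    by (simp add: case_prod_unfold sum_distrib_left sum_distrib_right mult_ac)
qed

lemma coeff_hyperinterpolation_error:
  assumes f: "continuous_on (sphere 0 1) f" and X: "\<And>j. j \<in> {1..m} \<Longrightarrow> X j \<in> sphere 0 1"
    and k: "k \<in> {1..Z l}"
  shows "coeff (\<lambda>x. f x - hyperinterpolation Z Y m X w n f x) l k =
    (if l \<le> n then - sampling_error m X w (\<lambda>x. f x * H l k x) else coeff f l k)"
proof -
  define c where "c l k = (\<Sum>j = 1..m. w j * (f (X j) * H l k (X j)))" for l k
  let ?g = "\<lambda>x. \<Sum>(l, k)\<in>Sigma {..n} (\<lambda>l. {1..Z l}). c l k * H l k x"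
  have g: "hyperinterpolation Z Y m X w n f x = ?g x" if "x \<in> sphere 0 1" for x
    unfolding c_def by (rule hyperinterpolation_eq[OF that X])
  have "coeff (\<lambda>x. f x - hyperinterpolation Z Y m X w n f x) l k =
      (\<integral>x. f x * H l k x - ?g x * H l k x \<partial>sphere_measure)"
    unfolding coeff_def
    by (rule Bochner_Integration.integral_cong[OF refl])
       (simp only: space_sphere_measure g left_diff_distrib)
  also have "\<dots> = coeff f l k - (\<integral>x. ?g x * H l k x \<partial>sphere_measure)"
    unfolding coeff_def
    by (intro Bochner_Integration.integral_diff sphere_integrable continuous_on_mult f
        H_sum_continuous_on H_continuous_on k)
  also have "\<dots> = (if l \<le> n then - sampling_error m X w (\<lambda>x. f x * H l k x) else coeff f l k)"
    unfolding H_sum_coeff[OF k] by (simp add: sampling_error_def coeff_def c_def)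
  finally show ?thesis .
qed

text \<open>
  The low-degree part of the error is estimated by duality: it is tested against the polynomial
  whose coefficients are those of the error itself, weighted with the square of the norm.
\<close>

lemma low_degree_error_le:
  assumes f: "continuous_on (sphere 0 1) f"
    and X: "\<And>j. j \<in> {1..m} \<Longrightarrow> X j \<in> sphere 0 1"
    and r: "0 \<le> r" and q: "0 \<le> q"
    and B: "0 \<le> B" "\<And>N. (\<Sum>l<N. lam l powr (- r) * (\<Sum>k = 1..Z l. (sampling_error m X w (H l k))\<^sup>2)) \<le> B\<^sup>2"
    and S: "0 \<le> S" "\<And>N. (\<Sum>l<N. lam l powr (r - s) * real (Z l)) \<le> S\<^sup>2"
    and F: "0 \<le> F" "\<And>N. (\<Sum>l<N. lam l powr s * (\<Sum>k = 1..Z l. (coeff f l k)\<^sup>2)) \<le> F\<^sup>2"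
  shows "(\<Sum>l<Suc n. lam l powr q * (\<Sum>k = 1..Z l. (sampling_error m X w (\<lambda>x. f x * H l k x))\<^sup>2)) \<le>
    (B * (2 * real (DIM('a) - 1)) powr (r / 2) * (1 + real n) powr r * S * F * lam n powr (q / 2))\<^sup>2"
proof -
  let ?nu = "sampling_error m X w" and ?I = "Sigma {..n} (\<lambda>l. {1..Z l})"
  let ?A = "B * (2 * real (DIM('a) - 1)) powr (r / 2) * (1 + real n) powr r * S * F"
  define e where "e l k = ?nu (\<lambda>x. f x * H l k x)" for l k
  \<comment> \<open>With these coefficients the sampling error of f p is exactly \<open>T\<close>,
    and the squared L2 norm of p is at most \<open>lam n powr q * T\<close>.\<close>
  define c where "c l k = lam l powr q * e l k" for l k
  define p where "p x = (\<Sum>(l, k)\<in>?I. c l k * H l k x)" for x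
  define T where "T = (\<Sum>(l, k)\<in>?I. lam l powr q * (e l k)\<^sup>2)"
  have T: "0 \<le> T" unfolding T_def by (intro sum_nonneg) auto
  have p: "p \<in> H_span n" unfolding H_span_iff p_def by blast
  have "?nu (\<lambda>x. f x * p x) = ?nu (\<lambda>x. \<Sum>i\<in>?I. c (fst i) (snd i) * (f x * H (fst i) (snd i) x))"
    by (simp add: p_def case_prod_unfold sum_distrib_left mult.left_commute)
  also have "\<dots> = (\<Sum>i\<in>?I. c (fst i) (snd i) * e (fst i) (snd i))"
    unfolding e_def
  proof (rule sampling_error_sum)
    show "continuous_on (sphere 0 1) (\<lambda>x. f x * H (fst i) (snd i) x)" if "i \<in> ?I" for i
      using that by (intro continuous_on_mult f H_continuous_on) auto
  qed
  also have "\<dots> = T"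
    by (simp add: T_def c_def case_prod_unfold power2_eq_square mult.assoc)
  finally have "T \<le> ?A * sqrt (\<integral>x. p x * p x \<partial>sphere_measure)"
    using sampling_error_mult_le[OF f p X r B S F] by linarith
  also have "(\<integral>x. p x * p x \<partial>sphere_measure) = (\<Sum>(l, k)\<in>?I. (c l k)\<^sup>2)"
    unfolding p_def by (rule H_sum_norm_sq)
  also have "\<dots> \<le> lam n powr q * T"
    unfolding T_def sum_distrib_left
  proof (rule sum_mono)
    fix i assume i: "i \<in> ?I"
    obtain l k where lk: "i = (l, k)" by force
    have "(c l k)\<^sup>2 = lam l powr q * (lam l powr q * (e l k)\<^sup>2)"
      by (simp add: c_def power2_eq_square mult_ac)
    also have "\<dots> \<le> lam n powr q * (lam l powr q * (e l k)\<^sup>2)"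
      using i lk q lam_pos[of l] by (intro mult_right_mono powr_mono2 lam_mono) auto
    finally show "(case i of (l, k) \<Rightarrow> (c l k)\<^sup>2) \<le>
        lam n powr q * (case i of (l, k) \<Rightarrow> lam l powr q * (e l k)\<^sup>2)"
      by (simp add: lk)
  qed
  finally have "T \<le> ?A * sqrt (lam n powr q * T)"
    using B S F by (simp add: mult_left_mono)
  also have "sqrt (lam n powr q * T) = lam n powr (q / 2) * sqrt T"
    using lam_pos[of n] by (simp add: real_sqrt_mult powr_half_sqrt[symmetric] powr_powr)
  finally have "sqrt T * sqrt T \<le> (?A * lam n powr (q / 2)) * sqrt T"
    using T by (simp add: mult_ac)
  moreover have "0 \<le> ?A * lam n powr (q / 2)" using B S F by simp
  \<comment> \<open>One factor \<open>sqrt T\<close> is divided out; the case T = 0 is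
    separate.\<close>
  ultimately have "sqrt T \<le> ?A * lam n powr (q / 2)"
    using T mult_right_le_imp_le[of "sqrt T" "sqrt T"] by (cases "T = 0") (auto simp only: real_sqrt_zero real_sqrt_gt_0_iff order_le_less)
  then have "(sqrt T)\<^sup>2 \<le> (?A * lam n powr (q / 2))\<^sup>2"
    using T by (intro power_mono) auto
  then show ?thesis
    using T sum_Sigma_Z[of "\<lambda>l k. lam l powr q * (e l k)\<^sup>2" n]
    by (simp only: T_def e_def sum_distrib_left real_sqrt_pow2)
qed

text \<open>In \<open>K\<close>, the first factor and \<open>S\<close> come from the estimate of
  products, \<open>2 powr r\<close> from 1 + n \<le> 2 n, and the power of 4 d from
  \<open>lam n\<close> \<le> 4 d n^2. The last two use n \<ge> 1.\<close>

lemma hyperinterpolation_error_le: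
  assumes f: "continuous_on (sphere 0 1) f"
    and X: "\<And>j. j \<in> {1..m} \<Longrightarrow> X j \<in> sphere 0 1"
    and r: "0 \<le> r" and q: "0 \<le> q" "q \<le> s" and n: "1 \<le> n"
    and B: "0 \<le> B" "sobolev_norm Z Y (- r) (sampling_error m X w) \<le> ennreal B"
    and S: "0 \<le> S" "\<And>N. (\<Sum>l<N. lam l powr (r - s) * real (Z l)) \<le> S\<^sup>2"
    and F: "0 \<le> F" "sobolev_norm Z Y s (fun_distribution f) \<le> ennreal F"
    and K: "K = (2 * real (DIM('a) - 1)) powr (r / 2) * 2 powr r * S * (4 * real (DIM('a) - 1)) powr (q / 2)"
  shows "sobolev_norm Z Y q (fun_distribution (\<lambda>x. f x - hyperinterpolation Z Y m X w n f x)) \<le>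
    ennreal ((real n powr (- (s - q)) + K * B * real n powr (r + q)) * F)"
proof -
  let ?nu = "sampling_error m X w" and ?d = "real (DIM('a) - 1)"
  define t where "t = real n powr (- (s - q)) * F"
  define E where "E = K * B * real n powr (r + q) * F"
  have K0: "0 \<le> K" using S(1) by (simp add: K)
  have tE: "0 \<le> t" "0 \<le> E" using F(1) B(1) K0 by (simp_all add: t_def E_def)
  have B2: "(\<Sum>l<N. lam l powr (- r) * (\<Sum>k = 1..Z l. (?nu (H l k))\<^sup>2)) \<le> B\<^sup>2" for N
  proof -
    have "?nu (Y l k) = ?nu (H l k)" if "k \<in> {1..Z l}" for l k
      by (rule sampling_error_cong) (use that X Y_eq_H in auto)
    then show ?thesis using B sobolev_norm_le[of B ?nu "\<lambda>l k. ?nu (H l k)" "- r"] by simp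
  qed
  have F2: "(\<Sum>l<N. lam l powr s * (\<Sum>k = 1..Z l. (coeff f l k)\<^sup>2)) \<le> F\<^sup>2" for N
    using F sobolev_norm_le[of F "fun_distribution f" "coeff f" s] fun_distribution_Y by simp
  define D where "D l k = (if l \<le> n then - ?nu (\<lambda>x. f x * H l k x) else coeff f l k)" for l k
  define h where "h l = lam l powr q * (\<Sum>k = 1..Z l. (?nu (\<lambda>x. f x * H l k x))\<^sup>2)" for l
  have h: "0 \<le> h l" for l unfolding h_def by (intro mult_nonneg_nonneg sum_nonneg) auto
  have low: "(\<Sum>l<Suc n. h l) \<le> E\<^sup>2"
  proof -
    have "(1 + real n) powr r \<le> (2 * real n) powr r"
      using r n by (intro powr_mono2) auto
    also have "\<dots> = 2 powr r * real n powr r" by (simp add: powr_mult)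
    finally have 1: "(1 + real n) powr r \<le> 2 powr r * real n powr r" .
    have "lam n \<le> ?d * (1 + real n)\<^sup>2" by (rule lam_le)
    also have "\<dots> \<le> ?d * (2 * real n)\<^sup>2"
      using n by (intro mult_left_mono power_mono) auto
    also have "\<dots> = (4 * ?d) * (real n)\<^sup>2" by (simp add: power_mult_distrib)
    finally have "lam n powr (q / 2) \<le> ((4 * ?d) * (real n)\<^sup>2) powr (q / 2)"
      using q lam_pos[of n] by (intro powr_mono2) auto
    also have "\<dots> = (4 * ?d) powr (q / 2) * ((real n)\<^sup>2) powr (q / 2)"
      by (simp add: powr_mult)
    also have "((real n)\<^sup>2) powr (q / 2) = real n powr q"
      using n powr_powr[of "real n" 2 "q / 2"] by (simp add: powr_numeral)
    finally have 2: "lam n powr (q / 2) \<le> (4 * ?d) powr (q / 2) * real n powr q" .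
    have "B * (2 * ?d) powr (r / 2) * (1 + real n) powr r * S * F * lam n powr (q / 2) \<le>
        B * (2 * ?d) powr (r / 2) * (2 powr r * real n powr r) * S * F * ((4 * ?d) powr (q / 2) * real n powr q)"
      using 1 2 B(1) S(1) F(1) by (intro mult_mono mult_nonneg_nonneg) auto
    also have "\<dots> = E" by (simp add: E_def K powr_add mult_ac)
    finally have "(B * (2 * ?d) powr (r / 2) * (1 + real n) powr r * S * F * lam n powr (q / 2))\<^sup>2 \<le> E\<^sup>2"
      using B(1) S(1) F(1) by (intro power_mono mult_nonneg_nonneg) auto
    then show ?thesis
      using low_degree_error_le[OF f X r q(1) B(1) B2 S F(1) F2, of n] unfolding h_def by linarith
  qed
  \<comment> \<open>For l > n the H^q weight is the H^s weight times
    \<open>lam l powr (- (s - q))\<close>, and \<open>lam l\<close> \<ge> n^2.\<close>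
  have split: "lam l powr q * (\<Sum>k = 1..Z l. (D l k)\<^sup>2) \<le>
      (if l < Suc n then h l else 0) + (real n powr (- (s - q)))\<^sup>2 * (lam l powr s * (\<Sum>k = 1..Z l. (coeff f l k)\<^sup>2))" for l
  proof (cases "l \<le> n")
    case True
    have "0 \<le> (real n powr (- (s - q)))\<^sup>2 * (lam l powr s * (\<Sum>k = 1..Z l. (coeff f l k)\<^sup>2))"
      by (intro mult_nonneg_nonneg sum_nonneg) auto
    then show ?thesis using True by (simp add: h_def D_def)
  next
    case False
    have "(real n)\<^sup>2 \<le> (real l)\<^sup>2" using False by (intro power_mono) auto
    also have "\<dots> \<le> lam l" by (rule lam_ge_sq)
    finally have "lam l powr (- (s - q)) \<le> ((real n)\<^sup>2) powr (- (s - q))"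
      using n q by (intro powr_mono2') auto
    also have "\<dots> = (real n powr (- (s - q)))\<^sup>2"
      using n powr_powr[of "real n" 2 "- (s - q)"] by (simp add: powr_numeral power2_powr)
    finally have "lam l powr (- (s - q)) * (lam l powr s * (\<Sum>k = 1..Z l. (coeff f l k)\<^sup>2)) \<le>
        (real n powr (- (s - q)))\<^sup>2 * (lam l powr s * (\<Sum>k = 1..Z l. (coeff f l k)\<^sup>2))"
      by (intro mult_right_mono mult_nonneg_nonneg sum_nonneg) auto
    moreover have "lam l powr q = lam l powr (- (s - q)) * lam l powr s"
      by (simp add: powr_add[symmetric])
    ultimately show ?thesis using False by (simp add: D_def mult.assoc)
  qed
  have "(\<Sum>l<N. lam l powr q * (\<Sum>k = 1..Z l. (D l k)\<^sup>2)) \<le> (t + E)\<^sup>2" for N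
  proof -
    have "(\<Sum>l<N. lam l powr q * (\<Sum>k = 1..Z l. (D l k)\<^sup>2)) \<le>
        (\<Sum>l<N. if l < Suc n then h l else 0) +
        (real n powr (- (s - q)))\<^sup>2 * (\<Sum>l<N. lam l powr s * (\<Sum>k = 1..Z l. (coeff f l k)\<^sup>2))"
      unfolding sum_distrib_left sum.distrib[symmetric] by (rule sum_mono) (use split in \<open>simp add: sum_distrib_left\<close>)
    also have "(\<Sum>l<N. if l < Suc n then h l else 0) \<le> E\<^sup>2"
    proof -
      have "(\<Sum>l<N. if l < Suc n then h l else 0) = (\<Sum>l\<in>{..<N} \<inter> {..<Suc n}. h l)"
        by (subst sum.inter_restrict) auto
      also have "\<dots> \<le> (\<Sum>l<Suc n. h l)" by (rule sum_mono2) (use h in auto)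
      finally show ?thesis using low by linarith
    qed
    also have "(real n powr (- (s - q)))\<^sup>2 * (\<Sum>l<N. lam l powr s * (\<Sum>k = 1..Z l. (coeff f l k)\<^sup>2)) \<le> t\<^sup>2"
      unfolding t_def power_mult_distrib by (intro mult_left_mono F2) auto
    also have "E\<^sup>2 + t\<^sup>2 \<le> (t + E)\<^sup>2" using tE by (simp add: power2_sum)
    finally show ?thesis by simp
  qed
  moreover have "fun_distribution (\<lambda>x. f x - hyperinterpolation Z Y m X w n f x) (Y l k) = D l k"
    if "k \<in> {1..Z l}" for l k
    unfolding fun_distribution_Y[OF that] D_def by (rule coeff_hyperinterpolation_error[OF f X that])
  ultimately have "sobolev_norm Z Y q (fun_distribution (\<lambda>x. f x - hyperinterpolation Z Y m X w n f x)) \<le> ennreal (t + E)"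
    using tE by (subst sobolev_norm_le[where c = D]) auto
  then show ?thesis by (simp add: t_def E_def distrib_right)
qed

end

text \<open>The exponent of \<delta> is chosen so that both terms become the same power of it. The
  lower bound on x controls the decreasing term, the upper bound the increasing one.\<close>

lemma balanced_degree_bound:
  fixes \<delta> x c1 c2 r q s :: real
  assumes x: "1 \<le> x" and c: "0 < c1" "0 < c2" and r: "0 \<le> r" and q: "0 \<le> q" "q < s"
    and low: "c1 * \<delta> powr (- r / (s + r)) \<le> x" and up: "x \<le> c2 * \<delta> powr (- r / (s + r))"
  shows "x powr (- (s - q)) + \<delta> powr r * x powr (r + q) \<le>
    (c1 powr (- (s - q)) + c2 powr (r + q)) * \<delta> powr (r * (s - q) / (s + r))"
proof -
  define a where "a = - r / (s + r)"
  have sr: "s + r > 0" using r q by linarith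
  \<comment> \<open>Since \<open>0 powr a = 0\<close>, a vanishing \<delta> would make the upper
    bound for x zero.\<close>
  have \<delta>: "\<delta> \<noteq> 0" using up x by auto
  have "x powr (- (s - q)) \<le> (c1 * \<delta> powr a) powr (- (s - q))"
    using low c \<delta> q unfolding a_def by (intro powr_mono2') auto
  also have "\<dots> = c1 powr (- (s - q)) * \<delta> powr (a * (- (s - q)))"
    using c by (simp only: powr_mult powr_powr)
  also have "a * (- (s - q)) = r * (s - q) / (s + r)"
    using sr by (simp add: a_def field_simps)
  finally have 1: "x powr (- (s - q)) \<le> c1 powr (- (s - q)) * \<delta> powr (r * (s - q) / (s + r))" .
  have "x powr (r + q) \<le> (c2 * \<delta> powr a) powr (r + q)"
    using up x r q unfolding a_def by (intro powr_mono2) auto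
  also have "\<dots> = c2 powr (r + q) * \<delta> powr (a * (r + q))"
    using c by (simp only: powr_mult powr_powr)
  finally have "\<delta> powr r * x powr (r + q) \<le> \<delta> powr r * (c2 powr (r + q) * \<delta> powr (a * (r + q)))"
    by (intro mult_left_mono) auto
  also have "\<dots> = c2 powr (r + q) * \<delta> powr (r + a * (r + q))"
    by (simp add: powr_add)
  also have "r + a * (r + q) = r * (s - q) / (s + r)"
    using sr by (simp add: a_def field_simps)
  finally show ?thesis using 1 by (simp add: distrib_right)
qed

theorem corollary4p3:
  fixes d :: nat
    and r q s C1 :: real
    and Z :: "nat \<Rightarrow> nat"
    and Y :: "nat \<Rightarrow> nat \<Rightarrow> 'a::euclidean_space \<Rightarrow> real"
    and M :: "nat set"
    and X :: "nat \<Rightarrow> nat \<Rightarrow> 'a"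
    and w :: "nat \<Rightarrow> nat \<Rightarrow> real"
  assumes dim: "d \<ge> 1" "DIM('a) = d + 1"
    and onb: "sph_harm_onb Z Y"
    and params: "r > real d / 2" "0 \<le> q" "q < s" "s > real d / 2 + r"
    and index_set: "infinite M" "\<And>m. m \<in> M \<Longrightarrow> m \<ge> 1"
    and points: "\<And>m j. m \<in> M \<Longrightarrow> j \<in> {1..m} \<Longrightarrow> X m j \<in> sphere 0 1"
    and weights_pos: "\<And>m j. m \<in> M \<Longrightarrow> j \<in> {1..m} \<Longrightarrow> w m j > 0"
    and weights_sum: "\<And>m. m \<in> M \<Longrightarrow> (\<Sum>j = 1..m. w m j) = 1"
    and sampling: "\<And>m. m \<in> M \<Longrightarrow>
       sobolev_norm Z Y (- r) (sampling_error m (X m) (w m))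
         \<le> ennreal (C1 * mesh_norm m (X m) powr r)"
  shows "(\<exists>C>0. \<forall>m\<in>M. \<forall>n\<ge>1. \<forall>f\<in>sobolev_functions Z Y s.
            sobolev_norm Z Y q
              (fun_distribution (\<lambda>x. f x - hyperinterpolation Z Y m (X m) (w m) n f x))
            \<le> ennreal (C * (real n powr (- (s - q))
                            + mesh_norm m (X m) powr r * real n powr (r + q)))
              * sobolev_norm Z Y s (fun_distribution f))
       \<and> (\<forall>c1>0. \<forall>c2>0. \<forall>n :: nat \<Rightarrow> nat.
            (\<forall>m\<in>M. n m \<ge> 1 \<and>
               c1 * mesh_norm m (X m) powr (- r / (s + r)) \<le> real (n m) \<and>
               real (n m) \<le> c2 * mesh_norm m (X m) powr (- r / (s + r))) \<longrightarrow>
            (\<exists>C'>0. \<forall>m\<in>M. \<forall>f\<in>sobolev_functions Z Y s.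
               sobolev_norm Z Y q
                 (fun_distribution (\<lambda>x. f x - hyperinterpolation Z Y m (X m) (w m) (n m) f x))
               \<le> ennreal (C' * mesh_norm m (X m) powr (r * (s - q) / (s + r)))
                 * sobolev_norm Z Y s (fun_distribution f)))"
proof -
  interpret sph_onb Z Y
    by unfold_locales (use dim onb in auto)
  have r: "0 \<le> r" using params by linarith
  obtain S where S: "S \<ge> 0" "\<And>N. (\<Sum>l<N. lam l powr (r - s) * real (Z l)) \<le> S\<^sup>2"
    using lam_weighted_Z_bounded[of r s] params dim by auto
  define K where "K = (2 * real (DIM('a) - 1)) powr (r / 2) * 2 powr r * S * (4 * real (DIM('a) - 1)) powr (q / 2)"
  have K: "0 \<le> K" using S(1) by (simp add: K_def)
  \<comment> \<open>\<open>C\<close> dominates both the coefficient 1 of the truncation term and the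
    coefficient \<open>K * \<bar>C1\<bar>\<close> of the sampling term. The sign of
    \<open>C1\<close> is unknown, hence the absolute value.\<close>
  define C where "C = 1 + K * \<bar>C1\<bar>"
  have C: "C > 0" using K by (simp add: C_def add_pos_nonneg)
  have main: "sobolev_norm Z Y q (fun_distribution (\<lambda>x. f x - hyperinterpolation Z Y m (X m) (w m) n f x))
      \<le> ennreal (C * (real n powr (- (s - q)) + mesh_norm m (X m) powr r * real n powr (r + q)))
        * sobolev_norm Z Y s (fun_distribution f)"
    if m: "m \<in> M" and n: "n \<ge> 1" and f: "f \<in> sobolev_functions Z Y s" for m n f
  proof -
    define \<delta> where "\<delta> = mesh_norm m (X m)"
    define F where "F = enn2real (sobolev_norm Z Y s (fun_distribution f))"
    have fc: "continuous_on (sphere 0 1) f" and fin: "sobolev_norm Z Y s (fun_distribution f) < \<infinity>"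
      using f by (auto simp: sobolev_functions_def sobolev_space_def)
    have F: "0 \<le> F" "sobolev_norm Z Y s (fun_distribution f) = ennreal F"
      using fin by (auto simp: F_def)
    have "sobolev_norm Z Y (- r) (sampling_error m (X m) (w m)) \<le> ennreal (C1 * \<delta> powr r)"
      using sampling[OF m] by (simp add: \<delta>_def)
    also have "\<dots> \<le> ennreal (\<bar>C1\<bar> * \<delta> powr r)"
      by (intro ennreal_leI mult_right_mono) auto
    finally have B: "sobolev_norm Z Y (- r) (sampling_error m (X m) (w m)) \<le> ennreal (\<bar>C1\<bar> * \<delta> powr r)" .
    have "sobolev_norm Z Y q (fun_distribution (\<lambda>x. f x - hyperinterpolation Z Y m (X m) (w m) n f x))
        \<le> ennreal ((real n powr (- (s - q)) + K * (\<bar>C1\<bar> * \<delta> powr r) * real n powr (r + q)) * F)"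
      using params n F by (intro hyperinterpolation_error_le[OF fc points[OF m] r _ _ _ _ B S _ _ K_def]) auto
    also have "\<dots> \<le> ennreal (C * (real n powr (- (s - q)) + \<delta> powr r * real n powr (r + q)) * F)"
    proof (intro ennreal_leI mult_right_mono F(1))
      have "1 * real n powr (- (s - q)) + K * \<bar>C1\<bar> * (\<delta> powr r * real n powr (r + q)) \<le>
          C * real n powr (- (s - q)) + C * (\<delta> powr r * real n powr (r + q))"
        using K by (intro add_mono mult_right_mono) (auto simp: C_def)
      then show "real n powr (- (s - q)) + K * (\<bar>C1\<bar> * \<delta> powr r) * real n powr (r + q) \<le>
          C * (real n powr (- (s - q)) + \<delta> powr r * real n powr (r + q))"
        by (simp add: distrib_left mult_ac)
    qed
    also have "\<dots> = ennreal (C * (real n powr (- (s - q)) + \<delta> powr r * real n powr (r + q))) * ennreal F"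
      using C F(1) by (intro ennreal_mult) auto
    finally show ?thesis by (simp add: \<delta>_def F(2))
  qed
  show ?thesis
  proof (intro conjI allI impI)
    show "\<exists>C>0. \<forall>m\<in>M. \<forall>n\<ge>1. \<forall>f\<in>sobolev_functions Z Y s.
        sobolev_norm Z Y q (fun_distribution (\<lambda>x. f x - hyperinterpolation Z Y m (X m) (w m) n f x))
        \<le> ennreal (C * (real n powr (- (s - q)) + mesh_norm m (X m) powr r * real n powr (r + q)))
          * sobolev_norm Z Y s (fun_distribution f)"
      using C main by blast
  next
    fix c1 c2 :: real and n :: "nat \<Rightarrow> nat"
    assume c: "0 < c1" "0 < c2"
      and n: "\<forall>m\<in>M. n m \<ge> 1 \<and> c1 * mesh_norm m (X m) powr (- r / (s + r)) \<le> real (n m) \<and>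
        real (n m) \<le> c2 * mesh_norm m (X m) powr (- r / (s + r))"
    define C' where "C' = C * (c1 powr (- (s - q)) + c2 powr (r + q))"
    have "C' > 0" using C c by (simp add: C'_def add_pos_pos)
    moreover have "sobolev_norm Z Y q
          (fun_distribution (\<lambda>x. f x - hyperinterpolation Z Y m (X m) (w m) (n m) f x))
        \<le> ennreal (C' * mesh_norm m (X m) powr (r * (s - q) / (s + r)))
          * sobolev_norm Z Y s (fun_distribution f)"
      if m: "m \<in> M" and f: "f \<in> sobolev_functions Z Y s" for m f
    proof -
      have "real (n m) powr (- (s - q)) + mesh_norm m (X m) powr r * real (n m) powr (r + q) \<le>
          (c1 powr (- (s - q)) + c2 powr (r + q)) * mesh_norm m (X m) powr (r * (s - q) / (s + r))"
        using n m c r params by (intro balanced_degree_bound) auto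
      then have "C * (real (n m) powr (- (s - q)) + mesh_norm m (X m) powr r * real (n m) powr (r + q)) \<le>
          C' * mesh_norm m (X m) powr (r * (s - q) / (s + r))"
        using C by (simp add: C'_def mult.assoc)
      then show ?thesis
        using main[OF m _ f, of "n m"] n m by (meson ennreal_leI mult_right_mono order.trans zero_le)
    qed
    ultimately show "\<exists>C'>0. \<forall>m\<in>M. \<forall>f\<in>sobolev_functions Z Y s.
        sobolev_norm Z Y q (fun_distribution (\<lambda>x. f x - hyperinterpolation Z Y m (X m) (w m) (n m) f x))
        \<le> ennreal (C' * mesh_norm m (X m) powr (r * (s - q) / (s + r)))
          * sobolev_norm Z Y s (fun_distribution f)"
      by blast
  qed
qed

end
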